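(* Let $(\mathcal M,g)$ and $(\mathcal N,h)$ be compact, connected, oriented Riemannian $2$-manifolds (possibly with boundary) such that $|\mathcal M|=|\mathcal N|$. Let $f:\mathcal M\to\mathcal N$ be an orientation-preserving diffeomorphism. Then $J_f\equiv 1$ if and only if $\delta\mathcal E_{\mathrm S}(f)[W]=0$ for every $W=V\circ f$, where $V\in\Gamma(T\mathcal N)$ is a smooth vector field satisfying $V|_{\partial\mathcal N}=0$.
   Context: $dA_g$ and $dA_h$ denote the Riemannian area forms of $(\mathcal M,g)$ and $(\mathcal N,h)$, and $|\mathcal M|=\int_{\mathcal M}dA_g$, $|\mathcal N|=\int_{\mathcal N}dA_h$. For an orientation-preserving diffeomorphism $f:\mathcal M\to\mathcal N$, the area ratio $J_f:\mathcal M\to(0,\infty)$ is the smooth function defined by $f^*dA_h=J_f\,dA_g$; $f$ is called area-preserving if $J_f\equiv1$. The stretch energy is $\mathcal E_{\mathrm S}(f)=\int_{\mathcal M}J_f^2\,dA_g$. For a smooth vector field $V$ on $\mathcal N$ with $V|_{\partial\mathcal N}=0$ (no condition if $\partial\mathcal N=\varnothing$) and local flow $\phi_t$ of $V$ with $\phi_0=\mathrm{id}_{\mathcal N}$, the first variation of $\mathcal E_{\mathrm S}$ at $f$ in the direction $W=V\circ f$ is $\delta\mathcal E_{\mathrm S}(f)[W]=\left.\frac{d}{dt}\right|_{t=0}\mathcal E_{\mathrm S}(\phi_t\circ f)$. *)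

theory Defs
  imports "HOL-Analysis.Analysis"
begin

primrec Ck_on_open :: "nat \<Rightarrow> 'a::real_normed_vector set \<Rightarrow> ('a \<Rightarrow> 'b::real_normed_vector) \<Rightarrow> bool" where
  "Ck_on_open 0 U f \<longleftrightarrow> continuous_on U f"
| "Ck_on_open (Suc k) U f \<longleftrightarrow>
     (\<forall>x\<in>U. f differentiable (at x)) \<and>
     (\<forall>v. Ck_on_open k U (\<lambda>x. frechet_derivative f (at x) v))"

text \<open>On a set that need not be open (such as a relatively open subset of a half-plane),
  smoothness means existence of local smooth extensions.\<close>

definition smooth_on :: "'a::real_normed_vector set \<Rightarrow> ('a \<Rightarrow> 'b::real_normed_vector) \<Rightarrow> bool" where
  "smooth_on S f \<longleftrightarrow>
     (\<forall>x\<in>S. \<exists>U F. open U \<and> x \<in> U \<and> (\<forall>k. Ck_on_open k U F) \<and> (\<forall>y\<in>U \<inter> S. F y = f y))"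

type_synonym 'a chart = "'a set \<times> ('a \<Rightarrow> real^2)"

text \<open>A tangent vector at \<open>p\<close> is represented by the family of its coordinate vectors in
  all charts around \<open>p\<close>; see \<open>tangent_space\<close> below.\<close>

type_synonym 'a tangent = "'a chart \<Rightarrow> real^2"

record 'a surface =
  surf_top :: "'a topology"
  atlas :: "'a chart set"
  metric_tensor :: "'a \<Rightarrow> 'a tangent \<Rightarrow> 'a tangent \<Rightarrow> real"

abbreviation points :: "'a surface \<Rightarrow> 'a set" where
  "points M \<equiv> topspace (surf_top M)"

definition half_plane :: "(real^2) set" where
  "half_plane = {x. 0 \<le> x $ 2}"

definition chart_image :: "'a chart \<Rightarrow> (real^2) set" where
  "chart_image c = snd c ` fst c"

definition chart_inv :: "'a chart \<Rightarrow> real^2 \<Rightarrow> 'a" where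
  "chart_inv c = inv_into (fst c) (snd c)"

definition is_chart :: "'a topology \<Rightarrow> 'a chart \<Rightarrow> bool" where
  "is_chart X c \<longleftrightarrow>
     openin X (fst c) \<and>
     openin (top_of_set half_plane) (chart_image c) \<and>
     homeomorphic_map (subtopology X (fst c)) (top_of_set (chart_image c)) (snd c)"

definition charts_at :: "'a surface \<Rightarrow> 'a \<Rightarrow> 'a chart set" where
  "charts_at M p = {c \<in> atlas M. p \<in> fst c}"

text \<open>Coordinate representation of \<open>f\<close> in charts \<open>c\<close> and \<open>d\<close>, and its domain. Derivatives are
  taken within that domain; as it is relatively open in the half-plane, they are unique.\<close>

definition local_rep :: "'a chart \<Rightarrow> 'b chart \<Rightarrow> ('a \<Rightarrow> 'b) \<Rightarrow> real^2 \<Rightarrow> real^2" where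
  "local_rep c d f = snd d \<circ> f \<circ> chart_inv c"

definition local_dom :: "'a chart \<Rightarrow> 'b chart \<Rightarrow> ('a \<Rightarrow> 'b) \<Rightarrow> (real^2) set" where
  "local_dom c d f = snd c ` {p \<in> fst c. f p \<in> fst d}"

definition local_deriv :: "'a chart \<Rightarrow> 'b chart \<Rightarrow> ('a \<Rightarrow> 'b) \<Rightarrow> 'a \<Rightarrow> real^2 \<Rightarrow> real^2" where
  "local_deriv c d f p =
     frechet_derivative (local_rep c d f) (at (snd c p) within local_dom c d f)"

text \<open>The orientation is encoded by requiring all transition maps of the atlas to have positive
  Jacobian determinant. In dimension two, every oriented manifold with boundary has such an
  atlas modelled on the upper half-plane.\<close>

definition oriented_surface :: "'a surface \<Rightarrow> bool" where
  "oriented_surface M \<longleftrightarrow>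
     Hausdorff_space (surf_top M) \<and> second_countable (surf_top M) \<and>
     (\<forall>c\<in>atlas M. is_chart (surf_top M) c) \<and>
     points M = (\<Union>c\<in>atlas M. fst c) \<and>
     (\<forall>c\<in>atlas M. \<forall>d\<in>atlas M. smooth_on (local_dom c d id) (local_rep c d id)) \<and>
     (\<forall>p\<in>points M. \<forall>c\<in>charts_at M p. \<forall>d\<in>charts_at M p.
        0 < det (matrix (local_deriv c d id p)))"

definition surface_boundary :: "'a surface \<Rightarrow> 'a set" where
  "surface_boundary M = {p \<in> points M. \<exists>c\<in>charts_at M p. snd c p $ 2 = 0}"

definition smooth_map :: "'a surface \<Rightarrow> 'b surface \<Rightarrow> ('a \<Rightarrow> 'b) \<Rightarrow> bool" where
  "smooth_map M N f \<longleftrightarrow>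
     continuous_map (surf_top M) (surf_top N) f \<and>
     (\<forall>c\<in>atlas M. \<forall>d\<in>atlas N. smooth_on (local_dom c d f) (local_rep c d f))"

definition orientation_preserving_diffeomorphism ::
    "'a surface \<Rightarrow> 'b surface \<Rightarrow> ('a \<Rightarrow> 'b) \<Rightarrow> bool" where
  "orientation_preserving_diffeomorphism M N f \<longleftrightarrow>
     bij_betw f (points M) (points N) \<and>
     smooth_map M N f \<and> smooth_map N M (inv_into (points M) f) \<and>
     (\<forall>p\<in>points M. \<forall>c\<in>charts_at M p. \<forall>d\<in>charts_at N (f p).
        0 < det (matrix (local_deriv c d f p)))"

text \<open>Setting the components in charts not containing \<open>p\<close> to zero makes the
  representation of tangent vectors unique; the zero vector is \<open>\<lambda>_. 0\<close>.\<close>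

definition tangent_space :: "'a surface \<Rightarrow> 'a \<Rightarrow> 'a tangent set" where
  "tangent_space M p =
     {v. (\<forall>c\<in>charts_at M p. \<forall>d\<in>charts_at M p. v d = local_deriv c d id p (v c)) \<and>
         (\<forall>c. c \<notin> charts_at M p \<longrightarrow> v c = 0)}"

definition coord_vector :: "'a surface \<Rightarrow> 'a chart \<Rightarrow> 2 \<Rightarrow> 'a \<Rightarrow> 'a tangent" where
  "coord_vector M c i p =
     (\<lambda>d. if d \<in> charts_at M p then local_deriv c d id p (axis i 1) else 0)"

definition differential ::
    "'a surface \<Rightarrow> 'b surface \<Rightarrow> ('a \<Rightarrow> 'b) \<Rightarrow> 'a \<Rightarrow> 'a tangent \<Rightarrow> 'b tangent" where
  "differential M N f p v =
     (let c = (SOME c. c \<in> charts_at M p)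
      in (\<lambda>d. if d \<in> charts_at N (f p) then local_deriv c d f p (v c) else 0))"

definition smooth_vector_field :: "'a surface \<Rightarrow> ('a \<Rightarrow> 'a tangent) \<Rightarrow> bool" where
  "smooth_vector_field M V \<longleftrightarrow>
     (\<forall>p\<in>points M. V p \<in> tangent_space M p) \<and>
     (\<forall>c\<in>atlas M. smooth_on (chart_image c) (\<lambda>x. V (chart_inv c x) c))"

definition metric_coeff :: "'a surface \<Rightarrow> 'a chart \<Rightarrow> 'a \<Rightarrow> real^2^2" where
  "metric_coeff M c p =
     (\<chi> i j. metric_tensor M p (coord_vector M c i p) (coord_vector M c j p))"

definition riemannian_surface :: "'a surface \<Rightarrow> bool" where
  "riemannian_surface M \<longleftrightarrow>
     oriented_surface M \<and>
     (\<forall>p\<in>points M. \<forall>u\<in>tangent_space M p. \<forall>v\<in>tangent_space M p.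
        metric_tensor M p u v = metric_tensor M p v u \<and>
        (\<forall>w\<in>tangent_space M p. metric_tensor M p (\<lambda>c. u c + w c) v =
           metric_tensor M p u v + metric_tensor M p w v) \<and>
        (\<forall>r. metric_tensor M p (\<lambda>c. r *\<^sub>R u c) v = r * metric_tensor M p u v) \<and>
        (u \<noteq> (\<lambda>_. 0) \<longrightarrow> 0 < metric_tensor M p u u)) \<and>
     (\<forall>c\<in>atlas M. smooth_on (chart_image c) (\<lambda>x. metric_coeff M c (chart_inv c x)))"

text \<open>In any chart \<open>c\<close> of the oriented atlas, the area form is
  $\sqrt{\det (g_{ij})}\, dx^1 \wedge dx^2$.\<close>

definition area_form :: "'a surface \<Rightarrow> 'a \<Rightarrow> 'a tangent \<Rightarrow> 'a tangent \<Rightarrow> real" where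
  "area_form M p u v =
     (let c = (SOME c. c \<in> charts_at M p)
      in sqrt (det (metric_coeff M c p)) * (u c $ 1 * v c $ 2 - u c $ 2 * v c $ 1))"

text \<open>The Borel measure obtained by integrating the area form: on Borel sets inside a chart
  domain it is the integral of the coefficient of the form with respect to
  $dx^1 \wedge dx^2$. By second countability these values determine the measure.\<close>

definition area_measure :: "'a surface \<Rightarrow> 'a measure" where
  "area_measure M = (THE \<mu>.
     space \<mu> = points M \<and>
     sets \<mu> = sigma_sets (points M) {U. openin (surf_top M) U} \<and>
     (\<forall>c\<in>atlas M. \<forall>B\<in>sets \<mu>. B \<subseteq> fst c \<longrightarrow>
        emeasure \<mu> B =
          (\<integral>\<^sup>+x. ennreal (let p = chart_inv c x in
                    area_form M p (coord_vector M c 1 p) (coord_vector M c 2 p))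
                * indicator (snd c ` B) x \<partial>lborel)))"

definition surface_integral :: "'a surface \<Rightarrow> ('a \<Rightarrow> real) \<Rightarrow> real" where
  "surface_integral M u = (\<integral>p. u p \<partial>area_measure M)"

definition area :: "'a surface \<Rightarrow> real" where
  "area M = surface_integral M (\<lambda>_. 1)"

text \<open>Pointwise form of $f^* dA_h = J_f\, dA_g$.\<close>

definition area_ratio :: "'a surface \<Rightarrow> 'b surface \<Rightarrow> ('a \<Rightarrow> 'b) \<Rightarrow> 'a \<Rightarrow> real" where
  "area_ratio M N f p = (THE J.
     \<forall>u\<in>tangent_space M p. \<forall>v\<in>tangent_space M p.
       area_form N (f p) (differential M N f p u) (differential M N f p v) =
       J * area_form M p u v)"

definition stretch_energy :: "'a surface \<Rightarrow> 'b surface \<Rightarrow> ('a \<Rightarrow> 'b) \<Rightarrow> real" where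
  "stretch_energy M N f = surface_integral M (\<lambda>p. (area_ratio M N f p)\<^sup>2)"

text \<open>Smoothness of the flow is joint smoothness in time and position. On a compact surface, a
  smooth field vanishing on the boundary has such a flow, uniform in the initial point.\<close>

definition local_flow :: "'a surface \<Rightarrow> ('a \<Rightarrow> 'a tangent) \<Rightarrow> (real \<Rightarrow> 'a \<Rightarrow> 'a) \<Rightarrow> bool" where
  "local_flow N V \<phi> \<longleftrightarrow> (\<exists>\<epsilon>>0.
     continuous_map (prod_topology (top_of_set {-\<epsilon><..<\<epsilon>}) (surf_top N)) (surf_top N)
       (\<lambda>(t, q). \<phi> t q) \<and>
     (\<forall>c\<in>atlas N. \<forall>d\<in>atlas N.
        smooth_on {(t, x). t \<in> {-\<epsilon><..<\<epsilon>} \<and> x \<in> local_dom c d (\<phi> t)}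
          (\<lambda>(t, x). local_rep c d (\<phi> t) x)) \<and>
     (\<forall>q\<in>points N. \<phi> 0 q = q) \<and>
     (\<forall>t\<in>{-\<epsilon><..<\<epsilon>}. \<forall>q\<in>points N. \<forall>d\<in>charts_at N (\<phi> t q).
        ((\<lambda>s. snd d (\<phi> s q)) has_vector_derivative V (\<phi> t q) d) (at t)))"

definition admissible_field :: "'a surface \<Rightarrow> ('a \<Rightarrow> 'a tangent) \<Rightarrow> bool" where
  "admissible_field N V \<longleftrightarrow>
     smooth_vector_field N V \<and> (\<forall>q\<in>surface_boundary N. V q = (\<lambda>_. 0))"

text \<open>\<open>D\<close> is the first variation at \<open>f\<close> in the direction \<open>W = V \<circ> f\<close>. Since \<open>f\<close> is a
  diffeomorphism, \<open>W\<close> determines \<open>V\<close>; on a compact surface a local flow of \<open>V\<close> exists and any two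
  agree for small times, so quantifying over all of them involves no choice.\<close>

definition has_first_variation ::
    "'a surface \<Rightarrow> 'b surface \<Rightarrow> ('a \<Rightarrow> 'b) \<Rightarrow> ('a \<Rightarrow> 'b tangent) \<Rightarrow> real \<Rightarrow> bool" where
  "has_first_variation M N f W D \<longleftrightarrow>
     (\<exists>V. admissible_field N V \<and> (\<forall>p\<in>points M. W p = V (f p)) \<and>
        (\<forall>\<phi>. local_flow N V \<phi> \<longrightarrow>
           ((\<lambda>t. stretch_energy M N (\<phi> t \<circ> f)) has_real_derivative D) (at 0)))"

end

theory Submission
  imports Defs
begin

text \<open>
  For a diffeomorphism $f$ and the flow \<open>\<phi>\<^sub>t\<close> of an admissible field $V$ put
  \<open>a\<^sub>t\<close> for the area ratio of \<open>\<phi>\<^sub>t\<close>. As area ratios multiply under composition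
  (\<open>area_ratio_compose\<close>), differentiating under the integral gives the first variation
  $2 \int_{\mathcal M} J_f^2\, (\dot a_0 \circ f)\, dA_g$ (\<open>variation_formulas\<close>), which by the pullback formula
  (\<open>integral_pullback\<close>) is $2 \int_{\mathcal N} u\, \dot a_0\, dA_h$ with $u = J_f \circ f^{-1}$.

  If $J_f = 1$, then this is twice the derivative of the area $\int_{\mathcal M} J_{\phi_t \circ f}\, dA_g$, which is constant:
  integral curves are unique, so \<open>\<phi>\<^sub>-\<^sub>t\<close> inverts \<open>\<phi>\<^sub>t\<close> and the pullback formula applies to \<open>\<phi>\<^sub>t \<circ> f\<close>.
  Hence $f$ is critical (\<open>area_preserving_imp_critical\<close>). This argument replaces the divergence theorem
  on a manifold with boundary.

  For the converse it suffices to test with fields whose flow can be written down, which avoids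
  solving differential equations. Inside one chart, with \<open>\<rho>\<close> the area density, fix a weight
  \<open>\<sigma> = exp (\<beta> (x\<^sub>i - x0\<^sub>i))\<close>. In the coordinates straightening \<open>\<sigma> dx\<close> to the standard area form, let \<open>\<phi>\<^sub>t\<close> rotate each
  small circle by an angle depending smoothly on the radius. This flow is explicit, compactly supported, preserves
  \<open>\<sigma> dx\<close>, and is Hamiltonian with a bump function $K$ as Hamiltonian, up to a factor (\<open>swirl_hamiltonian\<close>).
  With $w = \rho / \sigma$ its area ratio is \<open>w (\<phi>\<^sub>t x) / w x\<close>, and criticality says
  $\int u\, dw \wedge dK = 0$, that is, $\int K\, du \wedge dw = 0$ (\<open>green_identity\<close>). If $du$ did not vanish at an interior
  point, then \<open>\<beta>\<close> and \<open>i\<close> could be chosen such that $du \wedge dw > 0$ near it, a contradiction for small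
  support of $K$ (\<open>critical_imp_gradient_zero\<close>). So \<open>u\<close> is constant by connectedness, and equal to one since the
  total areas agree.

  All integrals rest on the area measure, which is constructed by gluing the measures of finitely
  many charts (\<open>ex_area_measure\<close>) and pulled back by substitution (\<open>area_measure_pullback\<close>).
\<close>



section \<open>Smooth functions on subsets of normed spaces\<close>

lemma Ck_on_open_subset:
  "Ck_on_open k U f \<Longrightarrow> V \<subseteq> U \<Longrightarrow> Ck_on_open k V f"
  by (induction k arbitrary: f) (auto intro: continuous_on_subset)

lemma Ck_on_open_imp_continuous_on: "Ck_on_open k U f \<Longrightarrow> continuous_on U f"
  by (cases k) (auto intro!: continuous_at_imp_continuous_on differentiable_imp_continuous_within)

lemma Ck_on_open_Suc_imp: "Ck_on_open (Suc k) U f \<Longrightarrow> Ck_on_open k U f"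
proof (induction k arbitrary: f)
  case 0
  then show ?case using Ck_on_open_imp_continuous_on[of "Suc 0"] by simp
next
  case (Suc k)
  have "Ck_on_open (Suc k) U (\<lambda>x. frechet_derivative f (at x) v)" for v
    using Suc.prems by (subst (asm) Ck_on_open.simps(2)) blast
  then have "Ck_on_open k U (\<lambda>x. frechet_derivative f (at x) v)" for v
    by (rule Suc.IH)
  moreover have "\<forall>x\<in>U. f differentiable (at x)" using Suc.prems by simp
  ultimately show ?case by simp
qed

lemma Ck_on_open_cong:
  assumes "open U"
  shows "Ck_on_open k U f \<Longrightarrow> (\<And>x. x \<in> U \<Longrightarrow> f x = g x) \<Longrightarrow> Ck_on_open k U g"
proof (induction k arbitrary: f g)
  case 0
  then show ?case by (simp cong: continuous_on_cong)
next
  case (Suc k)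
  have g': "(g has_derivative frechet_derivative f (at x)) (at x)" if x: "x \<in> U" for x
  proof -
    have "(f has_derivative frechet_derivative f (at x)) (at x)"
      using Suc.prems(1) x by (simp add: frechet_derivative_works[symmetric])
    then show ?thesis
      by (rule has_derivative_transform_within_open[OF _ assms x]) (use Suc.prems in auto)
  qed
  then have "frechet_derivative f (at x) = frechet_derivative g (at x)" if "x \<in> U" for x
    using frechet_derivative_at that by blast
  then have "Ck_on_open k U (\<lambda>x. frechet_derivative g (at x) v)" for v
    using Suc.IH[of "\<lambda>x. frechet_derivative f (at x) v" "\<lambda>x. frechet_derivative g (at x) v"] Suc.prems(1)
    by auto
  then show ?case using g' by (auto simp: differentiable_def)
qed

lemma Ck_on_open_derivI:
  assumes "\<And>x. x \<in> U \<Longrightarrow> (f has_derivative D x) (at x)" and "open U"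
    and "\<And>v. Ck_on_open k U (\<lambda>x. D x v)"
  shows "Ck_on_open (Suc k) U f"
proof -
  have "D x = frechet_derivative f (at x)" if "x \<in> U" for x
    using assms(1)[OF that] frechet_derivative_at by blast
  then have "Ck_on_open k U (\<lambda>x. frechet_derivative f (at x) v)" for v
    using Ck_on_open_cong[OF assms(2) assms(3)[of v], of "\<lambda>x. frechet_derivative f (at x) v"] by auto
  then show ?thesis using assms(1) by (auto simp: differentiable_def)
qed

lemma Ck_on_open_has_derivative:
  "Ck_on_open (Suc k) U f \<Longrightarrow> x \<in> U \<Longrightarrow> (f has_derivative frechet_derivative f (at x)) (at x)"
  by (simp add: frechet_derivative_works[symmetric])

text \<open>Differentiability of order \<open>k\<close> is a local condition, so the local extensions
  in the definition of \<open>smooth_on\<close> can be replaced by the function itself on open sets.\<close>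

lemma Ck_on_open_local:
  "(\<And>x. x \<in> U \<Longrightarrow> \<exists>V. open V \<and> x \<in> V \<and> Ck_on_open k V f) \<Longrightarrow> Ck_on_open k U f"
proof (induction k arbitrary: f)
  case 0
  then show ?case
    by (metis Ck_on_open.simps(1) continuous_at_imp_continuous_on continuous_on_eq_continuous_at)
next
  case (Suc k)
  have "f differentiable at x" if "x \<in> U" for x
    using Suc.prems[OF that] by auto
  moreover have "Ck_on_open k U (\<lambda>x. frechet_derivative f (at x) v)" for v
    by (rule Suc.IH) (use Suc.prems in fastforce)
  ultimately show ?case by simp
qed

lemma Ck_on_open_const: "Ck_on_open k U (\<lambda>x. c)"
  by (induction k arbitrary: c) auto

lemma Ck_on_open_bounded_linear:
  assumes "bounded_linear f" shows "Ck_on_open k U f"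
proof (cases k)
  case 0
  then show ?thesis using assms by (simp add: linear_continuous_on)
next
  case (Suc m)
  have "(f has_derivative f) (at x)" for x
    using assms by (rule bounded_linear_imp_has_derivative)
  then have "frechet_derivative f (at x) = f" for x
    using frechet_derivative_at by metis
  then show ?thesis using Suc assms
    by (auto simp: Ck_on_open_const bounded_linear_imp_differentiable)
qed

lemma Ck_on_open_add:
  assumes "open U"
  shows "Ck_on_open k U f \<Longrightarrow> Ck_on_open k U g \<Longrightarrow> Ck_on_open k U (\<lambda>x. f x + g x)"
proof (induction k arbitrary: f g)
  case (Suc k)
  show ?case
    by (rule Ck_on_open_derivI[where D="\<lambda>x v. frechet_derivative f (at x) v + frechet_derivative g (at x) v"])
       (use Suc assms in \<open>auto intro!: has_derivative_add Ck_on_open_has_derivative simp: frechet_derivative_works[symmetric]\<close>)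
qed (auto intro: continuous_on_add)

lemma Ck_on_open_bilinear:
  assumes "open U" and p: "bounded_bilinear p"
  shows "Ck_on_open k U f \<Longrightarrow> Ck_on_open k U g \<Longrightarrow> Ck_on_open k U (\<lambda>x. p (f x) (g x))"
proof (induction k arbitrary: f g)
  case 0
  then show ?case by (simp add: bounded_bilinear.continuous_on[OF p])
next
  case (Suc k)
  have fg: "Ck_on_open k U f" "Ck_on_open k U g"
    using Suc.prems by (auto intro: Ck_on_open_Suc_imp)
  show ?case
  proof (rule Ck_on_open_derivI[where D="\<lambda>x v. p (f x) (frechet_derivative g (at x) v) + p (frechet_derivative f (at x) v) (g x)"])
    fix x assume "x \<in> U"
    with Suc.prems have "(f has_derivative frechet_derivative f (at x)) (at x)"
      "(g has_derivative frechet_derivative g (at x)) (at x)"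
      using Ck_on_open_has_derivative by blast+
    from bounded_bilinear.FDERIV[OF p this]
    show "((\<lambda>x. p (f x) (g x)) has_derivative (\<lambda>v. p (f x) (frechet_derivative g (at x) v) + p (frechet_derivative f (at x) v) (g x))) (at x)" .
  next
    fix v
    have "Ck_on_open k U (\<lambda>x. frechet_derivative g (at x) v)" "Ck_on_open k U (\<lambda>x. frechet_derivative f (at x) v)"
      using Suc.prems by auto
    with fg show "Ck_on_open k U (\<lambda>x. p (f x) (frechet_derivative g (at x) v) + p (frechet_derivative f (at x) v) (g x))"
      by (intro Ck_on_open_add assms Suc.IH)
  qed (use assms in auto)
qed

lemma Ck_on_open_sum:
  assumes "open U" "\<And>i. i \<in> I \<Longrightarrow> Ck_on_open k U (f i)"
  shows "Ck_on_open k U (\<lambda>x. \<Sum>i\<in>I. f i x)"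
  using assms(2)
  by (induction I rule: infinite_finite_induct) (auto simp: Ck_on_open_const intro!: Ck_on_open_add assms(1))

text \<open>The chain rule $D(g \circ f)(x) v = \sum_b \langle Df(x) v, b\rangle\, Dg(f(x)) b$, with the
  inner derivative expanded in the standard basis, expresses the derivative by functions of
  one order of differentiability less, to which the induction hypothesis applies.\<close>

lemma Ck_on_open_compose:
  fixes f :: "'a::real_normed_vector \<Rightarrow> 'b::euclidean_space"
  assumes "open U" "open V"
  shows "Ck_on_open k U f \<Longrightarrow> Ck_on_open k V g \<Longrightarrow> f ` U \<subseteq> V \<Longrightarrow> Ck_on_open k U (\<lambda>x. g (f x))"
proof (induction k arbitrary: g)
  case 0
  then show ?case by (auto intro: continuous_on_compose2)
next
  case (Suc k)
  have f: "Ck_on_open k U f" using Suc.prems by (auto intro: Ck_on_open_Suc_imp)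
  show ?case
  proof (rule Ck_on_open_derivI[where D="\<lambda>x v. \<Sum>b\<in>Basis. (frechet_derivative f (at x) v \<bullet> b) *\<^sub>R frechet_derivative g (at (f x)) b"])
    fix x assume x: "x \<in> U"
    have f': "(f has_derivative frechet_derivative f (at x)) (at x)"
      using Suc.prems x Ck_on_open_has_derivative by blast
    have g': "(g has_derivative frechet_derivative g (at (f x))) (at (f x))"
      using Suc.prems x Ck_on_open_has_derivative[of k V g "f x"] by blast
    interpret g': bounded_linear "frechet_derivative g (at (f x))"
      using g' by (rule has_derivative_bounded_linear)
    have "(\<Sum>b\<in>Basis. (v \<bullet> b) *\<^sub>R frechet_derivative g (at (f x)) b) = frechet_derivative g (at (f x)) v" for v
      by (subst (2) euclidean_representation[symmetric]) (simp add: g'.sum g'.scaleR)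
    then show "((\<lambda>x. g (f x)) has_derivative (\<lambda>v. \<Sum>b\<in>Basis. (frechet_derivative f (at x) v \<bullet> b) *\<^sub>R frechet_derivative g (at (f x)) b)) (at x)"
      using has_derivative_compose[OF f' g'] by simp
  next
    fix v
    have "Ck_on_open k U (\<lambda>x. frechet_derivative g (at (f x)) b)" for b
      by (rule Suc.IH[OF f]) (use Suc.prems in auto)
    moreover have "Ck_on_open k U (\<lambda>x. frechet_derivative f (at x) v \<bullet> b)" for b
      by (rule Ck_on_open_bilinear[OF assms(1) bounded_bilinear_inner _ Ck_on_open_const]) (use Suc.prems in auto)
    ultimately show "Ck_on_open k U (\<lambda>x. \<Sum>b\<in>Basis. (frechet_derivative f (at x) v \<bullet> b) *\<^sub>R frechet_derivative g (at (f x)) b)"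
      by (intro Ck_on_open_sum assms(1) Ck_on_open_bilinear[OF assms(1) bounded_bilinear_scaleR])
  qed (use assms in auto)
qed

text \<open>The elementary functions of one variable are smooth because their derivatives are built
  from functions already treated; this is the induction step common to all of them.\<close>

lemma Ck_on_open_real_SucI:
  fixes f :: "real \<Rightarrow> real"
  assumes "open U" "\<And>x. x \<in> U \<Longrightarrow> (f has_real_derivative f' x) (at x)" "Ck_on_open k U f'"
  shows "Ck_on_open (Suc k) U f"
proof (rule Ck_on_open_derivI[where D="\<lambda>x v. f' x * v"])
  show "Ck_on_open k U (\<lambda>x. f' x * v)" for v
    by (rule Ck_on_open_bilinear[OF assms(1) bounded_bilinear_mult assms(3) Ck_on_open_const])
qed (use assms in \<open>auto simp: has_field_derivative_def\<close>)

lemma Ck_on_open_exp: "Ck_on_open k UNIV (exp :: real \<Rightarrow> real)"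
  by (induction k) (auto intro!: Ck_on_open_real_SucI DERIV_exp continuous_intros simp del: Ck_on_open.simps(2))

lemma Ck_on_open_sin_cos: "Ck_on_open k UNIV (sin :: real \<Rightarrow> real) \<and> Ck_on_open k UNIV (cos :: real \<Rightarrow> real)"
proof (induction k)
  case 0
  show ?case by (auto intro!: continuous_intros)
next
  case (Suc k)
  have "Ck_on_open k UNIV (\<lambda>x. - sin x :: real)"
    using Ck_on_open_bilinear[OF open_UNIV bounded_bilinear_mult Ck_on_open_const[of k UNIV "-1::real"] conjunct1[OF Suc]] by simp
  with Suc show ?case
    by (auto intro!: Ck_on_open_real_SucI DERIV_sin DERIV_cos simp del: Ck_on_open.simps(2))
qed

lemma Ck_on_open_inverse: "Ck_on_open k (- {0}) (inverse :: real \<Rightarrow> real)"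
proof (induction k)
  case 0
  show ?case by (auto intro!: continuous_intros)
next
  case (Suc k)
  have "Ck_on_open k (- {0}) (\<lambda>x::real. (-1) * (inverse x * inverse x))"
    by (intro Ck_on_open_bilinear[OF _ bounded_bilinear_mult] Suc Ck_on_open_const) auto
  then show ?case
    by (rule Ck_on_open_real_SucI[rotated -1])
       (auto intro!: derivative_eq_intros simp: power2_eq_square field_simps simp del: Ck_on_open.simps(2))
qed

lemma Ck_on_open_sqrt: "Ck_on_open k {0<..} sqrt"
proof (induction k)
  case 0
  show ?case by (auto intro!: continuous_intros)
next
  case (Suc k)
  have "Ck_on_open k {0<..} (\<lambda>x. inverse (sqrt x))"
    by (rule Ck_on_open_compose[OF _ _ Suc Ck_on_open_inverse]) auto
  then have "Ck_on_open k {0<..} (\<lambda>x. inverse (sqrt x) * (1/2))"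
    by (intro Ck_on_open_bilinear[OF _ bounded_bilinear_mult] Ck_on_open_const) auto
  then show ?case
    by (rule Ck_on_open_real_SucI[rotated -1]) (auto intro!: derivative_eq_intros)
qed

text \<open>The functions $x^{-n} e^{-1/x}$, extended by zero to $x \le 0$, are closed under
  differentiation up to linear combinations; hence all of them are smooth.\<close>

definition flat_exp :: "nat \<Rightarrow> real \<Rightarrow> real" where
  "flat_exp n x = (if 0 < x then exp (- (1 / x)) / x ^ n else 0)"

lemma flat_exp_limit: "((\<lambda>x::real. exp (- (1 / x)) / x ^ n) \<longlongrightarrow> 0) (at_right 0)"
proof -
  have "((\<lambda>y::real. y ^ n / exp y) \<longlongrightarrow> 0) at_top" by (rule tendsto_power_div_exp_0)
  from filterlim_compose[OF this filterlim_inverse_at_top_right]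
  show ?thesis by (simp add: exp_minus field_simps)
qed

lemma flat_exp_deriv:
  "(flat_exp n has_real_derivative (flat_exp (n + 2) x - n * flat_exp (n + 1) x)) (at x)"
proof -
  consider "x > 0" | "x < 0" | "x = 0" by linarith
  then show ?thesis
  proof cases
    case 1
    define E where "E = exp (- (1 / x))"
    have "((\<lambda>x. exp (- (1 / x))) has_real_derivative E * (1 / x\<^sup>2)) (at x)"
      unfolding E_def using 1 by (auto intro!: derivative_eq_intros simp: power2_eq_square)
    from DERIV_divide[OF this DERIV_pow[of n x]]
    have "((\<lambda>x. exp (- (1 / x)) / x ^ n) has_real_derivative
        (E * (1 / x\<^sup>2) * x ^ n - E * (n * x ^ (n - 1))) / (x ^ n * x ^ n)) (at x)"
      using 1 by (simp add: E_def)
    moreover have "(E * (1 / x\<^sup>2) * x ^ n - E * (n * x ^ (n - 1))) / (x ^ n * x ^ n)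
        = E / x ^ (n + 2) - n * (E / x ^ (n + 1))"
    proof (cases n)
      case 0
      then show ?thesis by (simp add: power2_eq_square)
    next
      case (Suc m)
      have "E * (1 / x\<^sup>2) * (x * y) - E * (real (Suc m) * y) = (E / (x * x) - real (Suc m) * (E / x)) * (x * y)" for y :: real
        using 1 by (simp add: field_simps power2_eq_square)
      then have "(E * (1 / x\<^sup>2) * (x * y) - E * (real (Suc m) * y)) / ((x * y) * (x * y)) = (E / (x * x) - real (Suc m) * (E / x)) / (x * y)" if "y \<noteq> 0" for y :: real
        using 1 that by simp
      from this[of "x ^ m"] show ?thesis using 1 Suc
        by (simp add: diff_divide_distrib power2_eq_square mult_ac)
    qed
    moreover have "E / x ^ (n + 2) - n * (E / x ^ (n + 1)) = flat_exp (n + 2) x - n * flat_exp (n + 1) x"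
      using 1 by (simp add: flat_exp_def E_def)
    ultimately have "((\<lambda>x. exp (- (1 / x)) / x ^ n) has_real_derivative (flat_exp (n + 2) x - n * flat_exp (n + 1) x)) (at x)"
      by simp
    then show ?thesis
      by (rule has_field_derivative_transform_within_open[where S="{0<..}"]) (use 1 in \<open>auto simp: flat_exp_def\<close>)
  next
    case 2
    have "((\<lambda>x. 0) has_real_derivative 0) (at x)" by simp
    then have "(flat_exp n has_real_derivative 0) (at x)"
      by (rule has_field_derivative_transform_within_open[where S="{..<0}"])
         (use 2 in \<open>simp_all add: flat_exp_def\<close>)
    then show ?thesis using 2 by (simp add: flat_exp_def)
  next
    case 3
    have "((\<lambda>h. flat_exp n h / h) \<longlongrightarrow> 0) (at_right 0)"
      by (rule Lim_transform_eventually[OF flat_exp_limit[of "Suc n"]])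
         (auto simp: eventually_at_filter flat_exp_def)
    moreover have "((\<lambda>h. flat_exp n h / h) \<longlongrightarrow> 0) (at_left 0)"
      by (rule Lim_transform_eventually[OF tendsto_const]) (auto simp: eventually_at_filter flat_exp_def)
    ultimately have "((\<lambda>h. flat_exp n h / h) \<longlongrightarrow> 0) (at 0)"
      by (simp add: filterlim_split_at)
    then show ?thesis by (simp add: 3 DERIV_def flat_exp_def)
  qed
qed

lemma Ck_on_open_flat_exp: "Ck_on_open k UNIV (flat_exp n)"
proof (induction k arbitrary: n)
  case 0
  have "continuous_on UNIV (flat_exp n)"
    by (rule continuous_at_imp_continuous_on) (blast intro: DERIV_isCont[OF flat_exp_deriv])
  then show ?case by simp
next
  case (Suc k)
  have "Ck_on_open k UNIV (\<lambda>x. flat_exp (n + 2) x + (- real n) * flat_exp (n + 1) x)"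
    by (intro Ck_on_open_add Ck_on_open_bilinear[OF _ bounded_bilinear_mult] Suc Ck_on_open_const) auto
  then have "Ck_on_open k UNIV (\<lambda>x. flat_exp (n + 2) x - n * flat_exp (n + 1) x)" by simp
  then show ?case
    by (rule Ck_on_open_real_SucI[OF open_UNIV flat_exp_deriv])
qed

lemma flat_exp_nonneg: "0 \<le> flat_exp n x"
  by (simp add: flat_exp_def)

lemma flat_exp_pos: "0 < x \<Longrightarrow> 0 < flat_exp n x"
  by (simp add: flat_exp_def)

lemma flat_exp_eq_0: "x \<le> 0 \<Longrightarrow> flat_exp n x = 0"
  by (simp add: flat_exp_def)


subsection \<open>Closure properties of \<open>smooth_on\<close>\<close>

lemma smooth_onI:
  "(\<And>x. x \<in> S \<Longrightarrow> \<exists>U F. open U \<and> x \<in> U \<and> (\<forall>k. Ck_on_open k U F) \<and> (\<forall>y\<in>U \<inter> S. F y = f y)) \<Longrightarrow> smooth_on S f"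
  by (simp add: smooth_on_def)

lemma smooth_onE:
  assumes "smooth_on S f" "x \<in> S"
  obtains U F where "open U" "x \<in> U" "\<And>k. Ck_on_open k U F" "\<And>y. y \<in> U \<Longrightarrow> y \<in> S \<Longrightarrow> F y = f y"
proof -
  from assms obtain U F where "open U \<and> x \<in> U \<and> (\<forall>k. Ck_on_open k U F) \<and> (\<forall>y\<in>U \<inter> S. F y = f y)"
    unfolding smooth_on_def by auto
  then show thesis by (intro that[of U F]) auto
qed

lemma smooth_on_subset:
  assumes "smooth_on S f" "T \<subseteq> S" shows "smooth_on T f"
proof (rule smooth_onI)
  fix x assume "x \<in> T"
  then have "x \<in> S" using assms by blast
  show "\<exists>U F. open U \<and> x \<in> U \<and> (\<forall>k. Ck_on_open k U F) \<and> (\<forall>y\<in>U \<inter> T. F y = f y)"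
  proof (rule smooth_onE[OF assms(1) \<open>x \<in> S\<close>])
    fix U F assume "open U" "x \<in> U" "\<And>k. Ck_on_open k U F" "\<And>y. y \<in> U \<Longrightarrow> y \<in> S \<Longrightarrow> F y = f y"
    then show ?thesis using assms(2) by (intro exI[of _ U] exI[of _ F]) auto
  qed
qed

lemma smooth_on_cong:
  assumes "smooth_on S f" "\<And>x. x \<in> S \<Longrightarrow> f x = g x" shows "smooth_on S g"
proof (rule smooth_onI)
  fix x assume x: "x \<in> S"
  show "\<exists>U F. open U \<and> x \<in> U \<and> (\<forall>k. Ck_on_open k U F) \<and> (\<forall>y\<in>U \<inter> S. F y = g y)"
  proof (rule smooth_onE[OF assms(1) \<open>x \<in> S\<close>])
    fix U F assume "open U" "x \<in> U" "\<And>k. Ck_on_open k U F" "\<And>y. y \<in> U \<Longrightarrow> y \<in> S \<Longrightarrow> F y = f y"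
    then show ?thesis using assms(2) by (intro exI[of _ U] exI[of _ F]) auto
  qed
qed

text \<open>Smoothness needs checking only near each point. This is how maps between surfaces are
  treated: near a point they are compositions of coordinate representations.\<close>

lemma smooth_on_local:
  assumes "\<And>x. x \<in> S \<Longrightarrow> \<exists>U. open U \<and> x \<in> U \<and> smooth_on (S \<inter> U) f"
  shows "smooth_on S f"
proof (rule smooth_onI)
  fix x assume x: "x \<in> S"
  then obtain U where U: "open U" "x \<in> U" "smooth_on (S \<inter> U) f" using assms by blast
  with x have "x \<in> S \<inter> U" by simp
  show "\<exists>U F. open U \<and> x \<in> U \<and> (\<forall>k. Ck_on_open k U F) \<and> (\<forall>y\<in>U \<inter> S. F y = f y)"
  proof (rule smooth_onE[OF U(3) \<open>x \<in> S \<inter> U\<close>])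
    fix W F assume "open W" "x \<in> W" "\<And>k. Ck_on_open k W F" "\<And>y. y \<in> W \<Longrightarrow> y \<in> S \<inter> U \<Longrightarrow> F y = f y"
    with U show ?thesis
      by (intro exI[of _ "U \<inter> W"] exI[of _ F]) (auto intro: Ck_on_open_subset)
  qed
qed

lemma Ck_on_open_imp_smooth_on: "open S \<Longrightarrow> (\<And>k. Ck_on_open k S f) \<Longrightarrow> smooth_on S f"
  unfolding smooth_on_def by auto

lemma smooth_on_imp_Ck_on_open:
  assumes "open S" "smooth_on S f" shows "Ck_on_open k S f"
proof (rule Ck_on_open_local)
  fix x assume x: "x \<in> S"
  obtain W F where W: "open W" "x \<in> W" "\<And>k. Ck_on_open k W F" "\<And>y. y \<in> W \<Longrightarrow> y \<in> S \<Longrightarrow> F y = f y"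
    by (rule smooth_onE[OF assms(2) x]) (rule that)
  have "Ck_on_open k (S \<inter> W) f"
    by (rule Ck_on_open_cong[of _ _ F]) (use W assms in \<open>auto intro: Ck_on_open_subset\<close>)
  then show "\<exists>V. open V \<and> x \<in> V \<and> Ck_on_open k V f"
    using W assms \<open>x \<in> S\<close> by (intro exI[of _ "S \<inter> W"]) auto
qed

lemma smooth_on_compose:
  fixes f :: "'a::real_normed_vector \<Rightarrow> 'b::euclidean_space"
  assumes "smooth_on T g" "smooth_on S f" "f ` S \<subseteq> T"
  shows "smooth_on S (\<lambda>x. g (f x))"
proof (rule smooth_onI)
  fix x assume x: "x \<in> S"
  obtain U F where U: "open U" "x \<in> U" "\<And>k. Ck_on_open k U F" "\<And>y. y \<in> U \<Longrightarrow> y \<in> S \<Longrightarrow> F y = f y"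
    by (rule smooth_onE[OF assms(2) x]) (rule that)
  have fx: "f x \<in> T" using x assms(3) by blast
  obtain V G where V: "open V" "f x \<in> V" "\<And>k. Ck_on_open k V G" "\<And>y. y \<in> V \<Longrightarrow> y \<in> T \<Longrightarrow> G y = g y"
    by (rule smooth_onE[OF assms(1) fx]) (rule that)
  have "continuous_on U F" using U(3) Ck_on_open_imp_continuous_on by blast
  then have "open (U \<inter> F -` V)" using U(1) V(1) by (simp add: continuous_open_preimage)
  moreover have "Ck_on_open k (U \<inter> F -` V) (\<lambda>x. G (F x))" for k
    by (rule Ck_on_open_compose[OF calculation V(1) _ V(3)]) (use U in \<open>auto intro: Ck_on_open_subset\<close>)
  ultimately show "\<exists>U F. open U \<and> x \<in> U \<and> (\<forall>k. Ck_on_open k U F) \<and> (\<forall>y\<in>U \<inter> S. F y = g (f y))"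
    using U V x assms(3)
    by (intro exI[of _ "U \<inter> F -` V"] exI[of _ "\<lambda>x. G (F x)"]) auto
qed

lemma smooth_on_const: "smooth_on S (\<lambda>x. c)"
  using Ck_on_open_const by (intro smooth_on_subset[OF Ck_on_open_imp_smooth_on[of UNIV]]) auto

lemma smooth_on_bounded_linear: "bounded_linear f \<Longrightarrow> smooth_on S f"
  using Ck_on_open_bounded_linear by (intro smooth_on_subset[OF Ck_on_open_imp_smooth_on[of UNIV]]) auto

lemma smooth_on_id: "smooth_on S (\<lambda>x. x)"
  by (intro smooth_on_bounded_linear bounded_linear_ident)

lemma smooth_on_binary:
  fixes f :: "'a::real_normed_vector \<Rightarrow> 'b::real_normed_vector" and g :: "'a \<Rightarrow> 'c::real_normed_vector"
    and p :: "'b \<Rightarrow> 'c \<Rightarrow> 'd::real_normed_vector"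
  assumes op: "\<And>(U::'a set) F G k. open U \<Longrightarrow> Ck_on_open k U F \<Longrightarrow> Ck_on_open k U G \<Longrightarrow> Ck_on_open k U (\<lambda>x. p (F x) (G x))"
    and "smooth_on S f" "smooth_on S g"
  shows "smooth_on S (\<lambda>x. p (f x) (g x))"
proof (rule smooth_onI)
  fix x assume x: "x \<in> S"
  obtain U F where U: "open U" "x \<in> U" "\<And>k. Ck_on_open k U F" "\<And>y. y \<in> U \<Longrightarrow> y \<in> S \<Longrightarrow> F y = f y"
    by (rule smooth_onE[OF assms(2) x]) (rule that)
  obtain V G where V: "open V" "x \<in> V" "\<And>k. Ck_on_open k V G" "\<And>y. y \<in> V \<Longrightarrow> y \<in> S \<Longrightarrow> G y = g y"
    by (rule smooth_onE[OF assms(3) x]) (rule that)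
  show "\<exists>U F. open U \<and> x \<in> U \<and> (\<forall>k. Ck_on_open k U F) \<and> (\<forall>y\<in>U \<inter> S. F y = p (f y) (g y))"
  proof (intro exI[of _ "U \<inter> V"] exI[of _ "\<lambda>x. p (F x) (G x)"] conjI allI)
    show "Ck_on_open k (U \<inter> V) (\<lambda>x. p (F x) (G x))" for k
    proof -
      have "Ck_on_open k (U \<inter> V) F" "Ck_on_open k (U \<inter> V) G"
        using U V by (auto intro: Ck_on_open_subset)
      then show ?thesis using op[of "U \<inter> V" k F G] U(1) V(1) by blast
    qed
  qed (use U V in auto)
qed

lemma smooth_on_add: "smooth_on S f \<Longrightarrow> smooth_on S g \<Longrightarrow> smooth_on S (\<lambda>x. f x + g x)"
  by (rule smooth_on_binary) (rule Ck_on_open_add)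

lemma smooth_on_bilinear:
  "bounded_bilinear p \<Longrightarrow> smooth_on S f \<Longrightarrow> smooth_on S g \<Longrightarrow> smooth_on S (\<lambda>x. p (f x) (g x))"
  by (rule smooth_on_binary) (rule Ck_on_open_bilinear)

lemmas smooth_on_mult = smooth_on_bilinear[OF bounded_bilinear_mult]
lemmas smooth_on_scaleR = smooth_on_bilinear[OF bounded_bilinear_scaleR]

lemma smooth_on_minus: "smooth_on S f \<Longrightarrow> smooth_on S (\<lambda>x. - f x)"
  using smooth_on_scaleR[OF smooth_on_const[of S "-1"], of f] by simp

lemma smooth_on_diff: "smooth_on S f \<Longrightarrow> smooth_on S g \<Longrightarrow> smooth_on S (\<lambda>x. f x - g x)"
  using smooth_on_add[OF _ smooth_on_minus, of S f g] by simp

lemma smooth_on_sum: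
  "(\<And>i. i \<in> I \<Longrightarrow> smooth_on S (f i)) \<Longrightarrow> smooth_on S (\<lambda>x. \<Sum>i\<in>I. f i x)"
  by (induction I rule: infinite_finite_induct) (auto simp: smooth_on_const intro!: smooth_on_add)

lemma smooth_on_linear_compose:
  fixes f :: "'a::real_normed_vector \<Rightarrow> 'b::euclidean_space"
  shows "bounded_linear g \<Longrightarrow> smooth_on S f \<Longrightarrow> smooth_on S (\<lambda>x. g (f x))"
  by (rule smooth_on_compose[OF smooth_on_bounded_linear[of g UNIV]]) auto

lemma smooth_on_vec_nth:
  fixes f :: "'a::real_normed_vector \<Rightarrow> 'b::euclidean_space ^ 'n"
  shows "smooth_on S f \<Longrightarrow> smooth_on S (\<lambda>x. f x $ i)"
  by (rule smooth_on_linear_compose[OF bounded_linear_vec_nth])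

lemma smooth_on_Pair:
  fixes f :: "'a::real_normed_vector \<Rightarrow> 'b::euclidean_space" and g :: "'a \<Rightarrow> 'c::euclidean_space"
  assumes "smooth_on S f" "smooth_on S g"
  shows "smooth_on S (\<lambda>x. (f x, g x))"
proof -
  have "smooth_on S (\<lambda>x. (f x, 0::'c))" "smooth_on S (\<lambda>x. (0::'b, g x))"
    using assms by (auto intro!: smooth_on_linear_compose[where g="\<lambda>y. (y, 0)"] smooth_on_linear_compose[where g="\<lambda>y. (0, y)"]
        bounded_linear_Pair bounded_linear_ident bounded_linear_zero)
  from smooth_on_add[OF this] show ?thesis by simp
qed

lemma smooth_on_vec_lambda:
  fixes f :: "'n::finite \<Rightarrow> 'a::real_normed_vector \<Rightarrow> real"
  assumes "\<And>i. smooth_on S (f i)"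
  shows "smooth_on S (\<lambda>x. \<chi> i. f i x)"
proof -
  have "smooth_on S (\<lambda>x. \<Sum>i\<in>UNIV. f i x *\<^sub>R (axis i 1 :: real^'n))"
    by (intro smooth_on_sum smooth_on_scaleR assms smooth_on_const)
  moreover have "(\<Sum>i\<in>UNIV. f i x *\<^sub>R (axis i 1 :: real^'n)) = (\<chi> i. f i x)" for x
    by (simp add: vec_eq_iff axis_def if_distrib cong: if_cong)
  ultimately show ?thesis by simp
qed

lemma smooth_on_real_compose:
  fixes f :: "'a::real_normed_vector \<Rightarrow> real" and h :: "real \<Rightarrow> real"
  assumes "\<And>k. Ck_on_open k T h" "open T" "smooth_on S f" "\<And>x. x \<in> S \<Longrightarrow> f x \<in> T"
  shows "smooth_on S (\<lambda>x. h (f x))"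
  using smooth_on_compose[OF Ck_on_open_imp_smooth_on[OF assms(2,1)] assms(3)] assms(4) by blast

lemma smooth_on_inverse:
  fixes f :: "'a::real_normed_vector \<Rightarrow> real"
  shows "smooth_on S f \<Longrightarrow> (\<And>x. x \<in> S \<Longrightarrow> f x \<noteq> 0) \<Longrightarrow> smooth_on S (\<lambda>x. inverse (f x))"
  by (rule smooth_on_real_compose[OF Ck_on_open_inverse]) auto

lemma smooth_on_divide:
  fixes f :: "'a::real_normed_vector \<Rightarrow> real"
  shows "smooth_on S f \<Longrightarrow> smooth_on S g \<Longrightarrow> (\<And>x. x \<in> S \<Longrightarrow> g x \<noteq> 0) \<Longrightarrow> smooth_on S (\<lambda>x. f x / g x)"
  unfolding divide_inverse by (intro smooth_on_mult smooth_on_inverse)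

lemma smooth_on_sqrt:
  "smooth_on S f \<Longrightarrow> (\<And>x. x \<in> S \<Longrightarrow> 0 < f x) \<Longrightarrow> smooth_on S (\<lambda>x. sqrt (f x))"
  by (rule smooth_on_real_compose[OF Ck_on_open_sqrt]) auto

lemma smooth_on_exp: "smooth_on S f \<Longrightarrow> smooth_on S (\<lambda>x. exp (f x :: real))"
  by (rule smooth_on_real_compose[OF Ck_on_open_exp]) auto

lemma smooth_on_sin: "smooth_on S f \<Longrightarrow> smooth_on S (\<lambda>x. sin (f x :: real))"
  by (rule smooth_on_real_compose[OF conjunct1[OF Ck_on_open_sin_cos]]) auto

lemma smooth_on_cos: "smooth_on S f \<Longrightarrow> smooth_on S (\<lambda>x. cos (f x :: real))"
  by (rule smooth_on_real_compose[OF conjunct2[OF Ck_on_open_sin_cos]]) auto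

lemma smooth_on_flat_exp: "smooth_on S f \<Longrightarrow> smooth_on S (\<lambda>x. flat_exp n (f x))"
  by (rule smooth_on_real_compose[OF Ck_on_open_flat_exp]) auto

lemma smooth_on_imp_continuous_on:
  assumes "smooth_on S f" shows "continuous_on S f"
proof -
  have "continuous (at x within S) f" if x: "x \<in> S" for x
  proof -
    obtain U F where U: "open U" "x \<in> U" "\<And>k. Ck_on_open k U F" "\<And>y. y \<in> U \<Longrightarrow> y \<in> S \<Longrightarrow> F y = f y"
      by (rule smooth_onE[OF assms x]) (rule that)
    have "isCont F x" using U Ck_on_open_imp_continuous_on continuous_on_eq_continuous_at by blast
    then have "continuous (at x within S) F" by (rule continuous_at_imp_continuous_at_within)
    moreover obtain d where "d > 0" "ball x d \<subseteq> U" using U open_contains_ball by blast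
    ultimately show ?thesis
      using U x by (auto intro!: continuous_transform_within[where f=F and \<delta>=d] simp: dist_commute subset_iff)
  qed
  then show ?thesis by (simp add: continuous_on_eq_continuous_within)
qed

lemma smooth_on_open_has_derivative:
  assumes "open S" "smooth_on S f" "x \<in> S"
  shows "(f has_derivative frechet_derivative f (at x)) (at x)"
  using smooth_on_imp_Ck_on_open[OF assms(1,2), of 1] assms(3) Ck_on_open_has_derivative by (metis One_nat_def)

lemma smooth_on_frechet_derivative:
  assumes "open S" "smooth_on S f"
  shows "smooth_on S (\<lambda>x. frechet_derivative f (at x) v)"
  using smooth_on_imp_Ck_on_open[OF assms, of "Suc _"] by (intro Ck_on_open_imp_smooth_on assms) auto


section \<open>Charts, coordinate derivatives and the area density\<close>

lemma is_chartD:
  assumes "is_chart X c"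
  shows "openin X (fst c)" and "fst c \<subseteq> topspace X" and "inj_on (snd c) (fst c)"
    and "openin (top_of_set half_plane) (chart_image c)" and "chart_image c \<subseteq> half_plane"
    and "homeomorphic_map (subtopology X (fst c)) (top_of_set (chart_image c)) (snd c)"
proof -
  show 1: "openin X (fst c)" and "openin (top_of_set half_plane) (chart_image c)"
    and 2: "homeomorphic_map (subtopology X (fst c)) (top_of_set (chart_image c)) (snd c)"
    using assms by (auto simp: is_chart_def)
  then show "chart_image c \<subseteq> half_plane" using openin_imp_subset by blast
  show 3: "fst c \<subseteq> topspace X" using 1 openin_subset by blast
  show "inj_on (snd c) (fst c)"
    using homeomorphic_imp_injective_map[OF 2] 3 by (simp add: Int_absorb1)
qed

lemma chart_inv_chart: "is_chart X c \<Longrightarrow> p \<in> fst c \<Longrightarrow> chart_inv c (snd c p) = p"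
  by (simp add: chart_inv_def is_chartD(3))

lemma chart_inv_in: "x \<in> chart_image c \<Longrightarrow> chart_inv c x \<in> fst c"
  by (simp add: chart_inv_def chart_image_def inv_into_into)

lemma chart_chart_inv: "x \<in> chart_image c \<Longrightarrow> snd c (chart_inv c x) = x"
  by (simp add: chart_inv_def chart_image_def f_inv_into_f)

lemma chart_in_image: "p \<in> fst c \<Longrightarrow> snd c p \<in> chart_image c"
  by (simp add: chart_image_def)

lemma chart_continuous_map: "is_chart X c \<Longrightarrow> continuous_map (subtopology X (fst c)) euclidean (snd c)"
  using homeomorphic_imp_continuous_map[OF is_chartD(6)] continuous_map_into_fulltopology by blast

lemma chart_image_openin:
  assumes "is_chart X c" "openin X U" "U \<subseteq> fst c"
  shows "openin (top_of_set half_plane) (snd c ` U)"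
proof -
  have "openin (subtopology X (fst c)) U"
    using assms openin_open_subtopology[OF is_chartD(1)[OF assms(1)]] by blast
  then have "openin (top_of_set (chart_image c)) (snd c ` U)"
    using homeomorphic_imp_open_map[OF is_chartD(6)[OF assms(1)]] unfolding open_map_def by blast
  then show ?thesis using is_chartD(4)[OF assms(1)] openin_trans by blast
qed

lemma chart_preimage_openin:
  assumes "is_chart X c" "open S"
  shows "openin X {p \<in> fst c. snd c p \<in> S}"
proof -
  have "openin (subtopology X (fst c)) {p \<in> topspace (subtopology X (fst c)). snd c p \<in> S}"
    using chart_continuous_map[OF assms(1)] assms(2) openin_continuous_map_preimage open_openin by blast
  then have "openin (subtopology X (fst c)) {p \<in> fst c. snd c p \<in> S}"
    using is_chartD(2)[OF assms(1)] by (simp add: Int_absorb1)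
  then show ?thesis using is_chartD(1)[OF assms(1)] openin_open_subtopology by blast
qed

lemma chart_inv_continuous_map:
  assumes "is_chart X c" shows "continuous_map (top_of_set (chart_image c)) X (chart_inv c)"
proof -
  have "openin (top_of_set (chart_image c)) {x \<in> chart_image c. chart_inv c x \<in> U}" if U: "openin X U" for U
  proof -
    have "{x \<in> chart_image c. chart_inv c x \<in> U} = snd c ` (fst c \<inter> U)"
    proof (intro set_eqI iffI)
      fix x assume "x \<in> {x \<in> chart_image c. chart_inv c x \<in> U}"
      then have "x = snd c (chart_inv c x)" "chart_inv c x \<in> fst c \<inter> U"
        by (auto simp: chart_chart_inv chart_inv_in)
      then show "x \<in> snd c ` (fst c \<inter> U)" by (rule image_eqI)
    qed (auto simp: chart_inv_chart[OF assms] chart_in_image)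
    moreover have "openin (subtopology X (fst c)) (fst c \<inter> U)"
      using U openin_subtopology_Int2 by blast
    ultimately show ?thesis
      using homeomorphic_imp_open_map[OF is_chartD(6)[OF assms]] unfolding open_map_def by metis
  qed
  moreover have "chart_inv c x \<in> topspace X" if "x \<in> chart_image c" for x
    using chart_inv_in[OF that] is_chartD(2)[OF assms] by blast
  ultimately show ?thesis by (auto simp: continuous_map_def)
qed

lemma openin_half_plane_iff:
  "openin (top_of_set half_plane) S \<longleftrightarrow> (\<exists>W. open W \<and> S = half_plane \<inter> W)"
  by (metis openin_open)

text \<open>From a point of the half-plane one can move a little in both positive coordinate
  directions, so derivatives within relatively open sets are unique, also at boundary points.\<close>

lemma half_plane_derivative_unique:
  fixes f :: "real^2 \<Rightarrow> 'b::real_normed_vector"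
  assumes S: "openin (top_of_set half_plane) S" "x \<in> S"
    and "(f has_derivative D) (at x within S)" "(f has_derivative D') (at x within S)"
  shows "D = D'"
proof (rule frechet_derivative_unique_within[OF assms(3,4)])
  fix i :: "real^2" and e :: real assume i: "i \<in> Basis" and e: "0 < e"
  obtain W where W: "open W" "S = half_plane \<inter> W" using S openin_half_plane_iff by auto
  then obtain r where r: "r > 0" "ball x r \<subseteq> W" using S open_contains_ball by blast
  define d where "d = min e r / 2"
  have d: "0 < d" "d < e" "d < r" using e r by (auto simp: d_def min_def)
  have "x + d *\<^sub>R i \<in> ball x r" using d i by (simp add: dist_norm)
  moreover have "x + d *\<^sub>R i \<in> half_plane"
    using i d S W by (auto simp: half_plane_def Basis_vec_def axis_def)
  ultimately show "\<exists>d. 0 < \<bar>d\<bar> \<and> \<bar>d\<bar> < e \<and> x + d *\<^sub>R i \<in> S"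
    using W r d by (intro exI[of _ d]) auto
qed

text \<open>A local smooth extension provides the derivative within the set, also at boundary points
  of the half-plane.\<close>

lemma smooth_on_has_derivative_within:
  assumes "smooth_on S f" "x \<in> S"
  shows "(f has_derivative frechet_derivative f (at x within S)) (at x within S)"
proof -
  obtain U F where U: "open U" "x \<in> U" "\<And>k. Ck_on_open k U F" "\<And>y. y \<in> U \<Longrightarrow> y \<in> S \<Longrightarrow> F y = f y"
    by (rule smooth_onE[OF assms]) (rule that)
  have "(F has_derivative frechet_derivative F (at x)) (at x within S)"
    using Ck_on_open_has_derivative[OF U(3) U(2)] has_derivative_at_withinI by blast
  then have "(F has_derivative frechet_derivative F (at x)) (at x within S \<inter> U)"
    by (rule has_derivative_subset) simp
  then have "(f has_derivative frechet_derivative F (at x)) (at x within S \<inter> U)"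
    by (rule has_derivative_transform[rotated 2]) (use assms U in auto)
  then have "(f has_derivative frechet_derivative F (at x)) (at x within S)"
    using at_within_nhd[OF U(2,1), of S "S \<inter> U"] by auto
  then show ?thesis by (metis differentiable_def frechet_derivative_works)
qed

lemma oriented_surfaceD:
  assumes "oriented_surface M"
  shows "Hausdorff_space (surf_top M)" and "\<And>c. c \<in> atlas M \<Longrightarrow> is_chart (surf_top M) c"
    and "points M = (\<Union>c\<in>atlas M. fst c)" and "smooth_map M M id"
    and "\<And>p c d. p \<in> points M \<Longrightarrow> c \<in> charts_at M p \<Longrightarrow> d \<in> charts_at M p \<Longrightarrow> 0 < det (matrix (local_deriv c d id p))"
  using assms unfolding oriented_surface_def smooth_map_def by (auto simp: id_def)

lemma riemannian_surface_oriented: "riemannian_surface M \<Longrightarrow> oriented_surface M"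
  by (simp add: riemannian_surface_def)

lemma charts_atD: "c \<in> charts_at M p \<Longrightarrow> c \<in> atlas M" "c \<in> charts_at M p \<Longrightarrow> p \<in> fst c"
  by (auto simp: charts_at_def)

lemma charts_atI: "c \<in> atlas M \<Longrightarrow> p \<in> fst c \<Longrightarrow> c \<in> charts_at M p"
  by (auto simp: charts_at_def)

lemma charts_at_in_points:
  assumes "oriented_surface M" "c \<in> charts_at M p" shows "p \<in> points M"
  unfolding oriented_surfaceD(3)[OF assms(1)] using charts_atD[OF assms(2)] by (rule UN_I)

lemma ex_charts_at:
  assumes "oriented_surface M" "p \<in> points M" shows "\<exists>c. c \<in> charts_at M p"
  using assms(2) unfolding oriented_surfaceD(3)[OF assms(1)] charts_at_def by blast

lemma some_charts_at: "c \<in> charts_at M p \<Longrightarrow> (SOME c. c \<in> charts_at M p) \<in> charts_at M p"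
  by (rule someI)

lemma chart_inv_charts_at: "c \<in> atlas M \<Longrightarrow> x \<in> chart_image c \<Longrightarrow> c \<in> charts_at M (chart_inv c x)"
  by (rule charts_atI[OF _ chart_inv_in])

lemma local_domI: "p \<in> fst c \<Longrightarrow> f p \<in> fst d \<Longrightarrow> snd c p \<in> local_dom c d f"
  by (auto simp: local_dom_def)

lemma local_dom_iff:
  assumes "is_chart X c"
  shows "x \<in> local_dom c d f \<longleftrightarrow> x \<in> chart_image c \<and> f (chart_inv c x) \<in> fst d"
proof
  assume "x \<in> chart_image c \<and> f (chart_inv c x) \<in> fst d"
  then have "snd c (chart_inv c x) \<in> local_dom c d f" by (intro local_domI) (auto simp: chart_inv_in)
  then show "x \<in> local_dom c d f" using \<open>x \<in> chart_image c \<and> _\<close> by (simp add: chart_chart_inv)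
qed (use assms in \<open>auto simp: local_dom_def chart_inv_chart chart_in_image\<close>)

lemma local_dom_openin:
  assumes "is_chart X c" "is_chart Y d" "continuous_map X Y f"
  shows "openin (top_of_set half_plane) (local_dom c d f)"
  unfolding local_dom_def
proof (rule chart_image_openin[OF assms(1)])
  have "openin X {p \<in> topspace X. f p \<in> fst d}"
    using assms is_chartD(1) openin_continuous_map_preimage by blast
  then have "openin X (fst c \<inter> {p \<in> topspace X. f p \<in> fst d})"
    using is_chartD(1)[OF assms(1)] by blast
  moreover have "fst c \<inter> {p \<in> topspace X. f p \<in> fst d} = {p \<in> fst c. f p \<in> fst d}"
    using is_chartD(2)[OF assms(1)] by auto
  ultimately show "openin X {p \<in> fst c. f p \<in> fst d}" by simp
qed auto

lemma smooth_mapD: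
  assumes "smooth_map M N f"
  shows "continuous_map (surf_top M) (surf_top N) f"
    and "\<And>p. p \<in> points M \<Longrightarrow> f p \<in> points N"
    and "\<And>c d. c \<in> atlas M \<Longrightarrow> d \<in> atlas N \<Longrightarrow> smooth_on (local_dom c d f) (local_rep c d f)"
  using assms continuous_map_image_subset_topspace[of "surf_top M" "surf_top N" f]
  by (auto simp: smooth_map_def)

lemma local_rep_apply: "is_chart X c \<Longrightarrow> p \<in> fst c \<Longrightarrow> local_rep c d f (snd c p) = snd d (f p)"
  by (simp add: local_rep_def chart_inv_chart)

lemma smooth_map_local_deriv:
  assumes "smooth_map M N f" "c \<in> charts_at M p" "d \<in> charts_at N (f p)"
  shows "(local_rep c d f has_derivative local_deriv c d f p) (at (snd c p) within local_dom c d f)"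
  unfolding local_deriv_def
  by (rule smooth_on_has_derivative_within[OF smooth_mapD(3)[OF assms(1)]])
     (use assms in \<open>auto dest: charts_atD intro: local_domI\<close>)

lemma local_deriv_linear:
  "smooth_map M N f \<Longrightarrow> c \<in> charts_at M p \<Longrightarrow> d \<in> charts_at N (f p) \<Longrightarrow> linear (local_deriv c d f p)"
  by (rule has_derivative_linear[OF smooth_map_local_deriv])

text \<open>The derivative in charts may be computed within any smaller relatively open set.\<close>

lemma local_deriv_eqI:
  assumes "smooth_map M N f" "c \<in> charts_at M p" "d \<in> charts_at N (f p)"
    and "openin (top_of_set half_plane) T" "snd c p \<in> T" "T \<subseteq> local_dom c d f"
    and "(local_rep c d f has_derivative D) (at (snd c p) within T)"
  shows "local_deriv c d f p = D"
  by (rule half_plane_derivative_unique[OF assms(4,5) _ assms(7)])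
     (rule has_derivative_subset[OF smooth_map_local_deriv[OF assms(1-3)] assms(6)])

lemma local_rep_compose_openin:
  assumes "oriented_surface M" "oriented_surface N" "smooth_map M N f" "smooth_map N P g"
    and "c \<in> atlas M" "d \<in> atlas N" "e \<in> atlas P" "\<And>e. e \<in> atlas P \<Longrightarrow> is_chart (surf_top P) e"
  shows "openin (top_of_set half_plane) (snd c ` {p \<in> fst c. f p \<in> fst d \<and> g (f p) \<in> fst e})"
proof (rule chart_image_openin)
  note c = oriented_surfaceD(2)[OF assms(1,5)]
  show "is_chart (surf_top M) c" by (rule c)
  have "openin (surf_top M) {p \<in> points M. f p \<in> fst d}"
    using openin_continuous_map_preimage[OF smooth_mapD(1)[OF assms(3)] is_chartD(1)[OF oriented_surfaceD(2)[OF assms(2,6)]]] .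
  moreover have "openin (surf_top M) {p \<in> points M. (g \<circ> f) p \<in> fst e}"
    using openin_continuous_map_preimage[OF continuous_map_compose[OF smooth_mapD(1)[OF assms(3)] smooth_mapD(1)[OF assms(4)]] is_chartD(1)[OF assms(8)[OF assms(7)]]] .
  ultimately have "openin (surf_top M) (fst c \<inter> ({p \<in> points M. f p \<in> fst d} \<inter> {p \<in> points M. (g \<circ> f) p \<in> fst e}))"
    using is_chartD(1)[OF c] by blast
  moreover have "fst c \<inter> ({p \<in> points M. f p \<in> fst d} \<inter> {p \<in> points M. (g \<circ> f) p \<in> fst e}) = {p \<in> fst c. f p \<in> fst d \<and> g (f p) \<in> fst e}"
    using is_chartD(2)[OF c] by auto
  ultimately show "openin (surf_top M) {p \<in> fst c. f p \<in> fst d \<and> g (f p) \<in> fst e}" by simp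
qed auto

text \<open>Near a given point a chart around the intermediate point splits the coordinate
  representation of \<open>g \<circ> f\<close> into those of \<open>f\<close> and \<open>g\<close>.\<close>

lemma smooth_map_compose:
  assumes M: "oriented_surface M" and N: "oriented_surface N" and P: "oriented_surface P"
    and f: "smooth_map M N f" and g: "smooth_map N P g"
  shows "smooth_map M P (g \<circ> f)"
  unfolding smooth_map_def
proof (intro conjI ballI)
  show "continuous_map (surf_top M) (surf_top P) (g \<circ> f)"
    by (rule continuous_map_compose[OF smooth_mapD(1)[OF f] smooth_mapD(1)[OF g]])
next
  fix c e assume ce: "c \<in> atlas M" "e \<in> atlas P"
  note C = oriented_surfaceD(2)[OF M ce(1)]
  show "smooth_on (local_dom c e (g \<circ> f)) (local_rep c e (g \<circ> f))"
  proof (rule smooth_on_local)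
    fix x assume "x \<in> local_dom c e (g \<circ> f)"
    then obtain p where p: "p \<in> fst c" "g (f p) \<in> fst e" "x = snd c p" by (auto simp: local_dom_def)
    have "p \<in> points M" using p is_chartD(2)[OF C] by blast
    then have "f p \<in> points N" by (rule smooth_mapD(2)[OF f])
    from ex_charts_at[OF N this] obtain d where d: "d \<in> atlas N" "f p \<in> fst d" by (auto simp: charts_at_def)
    let ?T = "snd c ` {p \<in> fst c. f p \<in> fst d \<and> g (f p) \<in> fst e}"
    obtain W where W: "open W" "?T = half_plane \<inter> W"
      using local_rep_compose_openin[OF M N f g ce(1) d(1) ce(2) oriented_surfaceD(2)[OF P]] openin_half_plane_iff by blast
    have sub: "local_dom c e (g \<circ> f) \<inter> W \<subseteq> ?T"
      using W is_chartD(5)[OF C] by (auto simp: local_dom_def chart_image_def)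
    have "smooth_on ?T (\<lambda>x. local_rep d e g (local_rep c d f x))"
      by (rule smooth_on_compose[OF smooth_mapD(3)[OF g d(1) ce(2)] smooth_on_subset[OF smooth_mapD(3)[OF f ce(1) d(1)]]])
         (auto simp: local_dom_def local_rep_apply[OF C])
    then have "smooth_on ?T (local_rep c e (g \<circ> f))"
      by (rule smooth_on_cong)
         (auto simp: local_rep_apply[OF C] local_rep_apply[OF oriented_surfaceD(2)[OF N d(1)]])
    then show "\<exists>U. open U \<and> x \<in> U \<and> smooth_on (local_dom c e (g \<circ> f) \<inter> U) (local_rep c e (g \<circ> f))"
      using W p d sub by (intro exI[of _ W]) (auto intro: smooth_on_subset)
  qed
qed

text \<open>The chain rule holds within the relatively open set of points that both coordinate
  representations are defined for, and derivatives within such sets are unique.\<close>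

lemma local_deriv_compose:
  assumes M: "oriented_surface M" and N: "oriented_surface N" and P: "oriented_surface P"
    and f: "smooth_map M N f" and g: "smooth_map N P g"
    and c: "c \<in> charts_at M p" and d: "d \<in> charts_at N (f p)" and e: "e \<in> charts_at P (g (f p))"
  shows "local_deriv c e (g \<circ> f) p = local_deriv d e g (f p) \<circ> local_deriv c d f p"
proof -
  note C = oriented_surfaceD(2)[OF M charts_atD(1)[OF c]]
  note D = oriented_surfaceD(2)[OF N charts_atD(1)[OF d]]
  let ?T = "snd c ` {p \<in> fst c. f p \<in> fst d \<and> g (f p) \<in> fst e}"
  have x: "snd c p \<in> ?T" using c d e by (auto simp: charts_at_def)
  have 1: "(local_rep c d f has_derivative local_deriv c d f p) (at (snd c p) within ?T)"
    by (rule has_derivative_subset[OF smooth_map_local_deriv[OF f c d]]) (auto simp: local_dom_def)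
  have sub: "local_rep c d f ` ?T \<subseteq> local_dom d e g"
    by (auto simp: local_rep_apply[OF C] local_dom_def)
  have "(local_rep d e g has_derivative local_deriv d e g (f p)) (at (local_rep c d f (snd c p)) within local_rep c d f ` ?T)"
    using has_derivative_subset[OF smooth_map_local_deriv[OF g d e] sub]
    by (simp add: local_rep_apply[OF C charts_atD(2)[OF c]])
  from diff_chain_within[OF 1 this]
  have 2: "(local_rep d e g \<circ> local_rep c d f has_derivative local_deriv d e g (f p) \<circ> local_deriv c d f p) (at (snd c p) within ?T)" .
  have "(local_rep c e (g \<circ> f) has_derivative local_deriv d e g (f p) \<circ> local_deriv c d f p) (at (snd c p) within ?T)"
    by (rule has_derivative_transform[OF x _ 2]) (auto simp: local_rep_apply[OF C] local_rep_apply[OF D])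
  moreover have "?T \<subseteq> local_dom c e (g \<circ> f)" by (auto simp: local_dom_def)
  moreover have "openin (top_of_set half_plane) ?T"
    by (rule local_rep_compose_openin[OF M N f g charts_atD(1)[OF c] charts_atD(1)[OF d] charts_atD(1)[OF e] oriented_surfaceD(2)[OF P]])
  ultimately show ?thesis
    using e by (intro local_deriv_eqI[OF smooth_map_compose[OF M N P f g] c _ _ x]) auto
qed

lemma local_deriv_id_same:
  assumes M: "oriented_surface M" and c: "c \<in> charts_at M p"
  shows "local_deriv c c id p = id"
proof -
  note C = oriented_surfaceD(2)[OF M charts_atD(1)[OF c]]
  have dom: "local_dom c c id = chart_image c" by (auto simp: local_dom_def chart_image_def)
  have "(local_rep c c id has_derivative id) (at (snd c p) within chart_image c)"
    by (rule has_derivative_transform[OF _ _ has_derivative_id[unfolded id_def[symmetric]]])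
       (use c in \<open>auto simp: local_rep_def chart_chart_inv chart_in_image charts_atD\<close>)
  then show ?thesis
    by (intro local_deriv_eqI[OF oriented_surfaceD(4)[OF M] c _ is_chartD(4)[OF C]])
       (use c dom in \<open>auto simp: chart_in_image charts_atD\<close>)
qed

lemma local_deriv_transition:
  assumes "oriented_surface M" "c \<in> charts_at M p" "d \<in> charts_at M p" "e \<in> charts_at M p"
  shows "local_deriv d e id p (local_deriv c d id p v) = local_deriv c e id p v"
  using local_deriv_compose[OF assms(1) assms(1) assms(1) oriented_surfaceD(4)[OF assms(1)] oriented_surfaceD(4)[OF assms(1)], of c p d e] assms
  by (simp add: o_def fun_eq_iff id_def)


section \<open>Tangent vectors, densities and area ratios in coordinates\<close>

lemma linear_real2:
  fixes L :: "real^2 \<Rightarrow> 'b::real_vector"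
  assumes "linear L"
  shows "L v = v $ 1 *\<^sub>R L (axis 1 1) + v $ 2 *\<^sub>R L (axis 2 1)"
proof -
  have "v = v $ 1 *\<^sub>R axis 1 1 + v $ 2 *\<^sub>R (axis 2 1 :: real^2)"
    by (simp add: vec_eq_iff forall_2 axis_def)
  then have "L v = L (v $ 1 *\<^sub>R axis 1 1 + v $ 2 *\<^sub>R axis 2 1)" by simp
  then show ?thesis by (simp add: linear_add[OF assms] linear_scale[OF assms])
qed

lemma det_matrix_real2:
  "det (matrix (L :: real^2 \<Rightarrow> real^2)) = L (axis 1 1) $ 1 * L (axis 2 1) $ 2 - L (axis 2 1) $ 1 * L (axis 1 1) $ 2"
  by (simp add: det_2 matrix_def)

definition cross2 :: "real^2 \<Rightarrow> real^2 \<Rightarrow> real" where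
  "cross2 v w = v $ 1 * w $ 2 - v $ 2 * w $ 1"

lemma cross2_linear:
  assumes "linear (L :: real^2 \<Rightarrow> real^2)"
  shows "cross2 (L v) (L w) = det (matrix L) * cross2 v w"
proof -
  have "L x $ i = x $ 1 * L (axis 1 1) $ i + x $ 2 * L (axis 2 1) $ i" for x i
    using arg_cong[OF linear_real2[OF assms, of x], of "\<lambda>y. y $ i"] by simp
  note * = this[of v] this[of w]
  show ?thesis unfolding cross2_def det_matrix_real2 * by (simp add: algebra_simps)
qed

lemma cross2_axis: "cross2 (axis 1 1) (axis 2 1) = 1"
  by (simp add: cross2_def axis_def)

text \<open>The tangent vector with coordinates \<open>w\<close> in the chart \<open>c\<close>: its components in all other
  charts are forced by the transition maps.\<close>

definition tangent_of :: "'a surface \<Rightarrow> 'a chart \<Rightarrow> 'a \<Rightarrow> real^2 \<Rightarrow> 'a tangent" where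
  "tangent_of M c p w = (\<lambda>d. if d \<in> charts_at M p then local_deriv c d id p w else 0)"

lemma coord_vector_eq: "coord_vector M c i p = tangent_of M c p (axis i 1)"
  by (simp add: coord_vector_def tangent_of_def)

lemma local_deriv_id_linear:
  "oriented_surface M \<Longrightarrow> c \<in> charts_at M p \<Longrightarrow> d \<in> charts_at M p \<Longrightarrow> linear (local_deriv c d id p)"
  by (rule local_deriv_linear[OF oriented_surfaceD(4)]) auto

lemma tangent_of_in_tangent_space:
  "oriented_surface M \<Longrightarrow> c \<in> charts_at M p \<Longrightarrow> tangent_of M c p w \<in> tangent_space M p"
  by (auto simp: tangent_space_def tangent_of_def local_deriv_transition)

lemma tangent_of_same: "oriented_surface M \<Longrightarrow> c \<in> charts_at M p \<Longrightarrow> tangent_of M c p w c = w"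
  by (simp add: tangent_of_def local_deriv_id_same)

lemma tangent_spaceD:
  assumes "v \<in> tangent_space M p"
  shows "c \<in> charts_at M p \<Longrightarrow> d \<in> charts_at M p \<Longrightarrow> v d = local_deriv c d id p (v c)"
    and "c \<notin> charts_at M p \<Longrightarrow> v c = 0"
  using assms unfolding tangent_space_def by blast+

lemma tangent_of_change:
  "oriented_surface M \<Longrightarrow> c \<in> charts_at M p \<Longrightarrow> d \<in> charts_at M p \<Longrightarrow>
     tangent_of M c p w = tangent_of M d p (local_deriv c d id p w)"
  using local_deriv_transition[of M c p d] by (auto simp: tangent_of_def)

lemma tangent_of_add:
  assumes "oriented_surface M" "c \<in> charts_at M p"
  shows "tangent_of M c p (v + w) = (\<lambda>d. tangent_of M c p v d + tangent_of M c p w d)"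
  using linear_add[OF local_deriv_id_linear[OF assms]] by (auto simp: tangent_of_def)

lemma tangent_of_scale:
  assumes "oriented_surface M" "c \<in> charts_at M p"
  shows "tangent_of M c p (r *\<^sub>R v) = (\<lambda>d. r *\<^sub>R tangent_of M c p v d)"
  using linear_scale[OF local_deriv_id_linear[OF assms]] by (auto simp: tangent_of_def)

text \<open>The Gram matrix of a positive definite form has positive determinant: for
  \<open>z = (- g\<^sub>1\<^sub>2, g\<^sub>1\<^sub>1)\<close> one has $g(z, z) = g_{11} \det g$.\<close>

lemma metric_in_coordinates:
  assumes R: "riemannian_surface M" and c: "c \<in> charts_at M p"
  shows "metric_tensor M p (tangent_of M c p v) (tangent_of M c p w) =
      v $ 1 * w $ 1 * metric_coeff M c p $ 1 $ 1 + (v $ 1 * w $ 2 + v $ 2 * w $ 1) * metric_coeff M c p $ 1 $ 2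
      + v $ 2 * w $ 2 * metric_coeff M c p $ 2 $ 2"
    and "metric_coeff M c p $ 2 $ 1 = metric_coeff M c p $ 1 $ 2"
    and "0 < det (metric_coeff M c p)"
proof -
  note M = riemannian_surface_oriented[OF R]
  note T = tangent_of_in_tangent_space[OF M c]
  have p: "p \<in> points M" using charts_at_in_points[OF M c] .
  define B where "B v w = metric_tensor M p (tangent_of M c p v) (tangent_of M c p w)" for v w
  have ax: "\<forall>u\<in>tangent_space M p. \<forall>v\<in>tangent_space M p.
        metric_tensor M p u v = metric_tensor M p v u \<and>
        (\<forall>w\<in>tangent_space M p. metric_tensor M p (\<lambda>c. u c + w c) v =
           metric_tensor M p u v + metric_tensor M p w v) \<and>
        (\<forall>r. metric_tensor M p (\<lambda>c. r *\<^sub>R u c) v = r * metric_tensor M p u v) \<and>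
        (u \<noteq> (\<lambda>_. 0) \<longrightarrow> 0 < metric_tensor M p u u)"
    using R p unfolding riemannian_surface_def by auto
  have sym: "B v w = B w v" for v w unfolding B_def using ax T by blast
  have add: "B (v + w) x = B v x + B w x" for v w x
    unfolding B_def tangent_of_add[OF M c] using ax T by blast
  have scale: "B (r *\<^sub>R v) x = r * B v x" for r v x
    unfolding B_def tangent_of_scale[OF M c] using ax T by blast
  have pos: "0 < B v v" if "v \<noteq> 0" for v
  proof -
    have "tangent_of M c p v \<noteq> (\<lambda>_. 0)" using tangent_of_same[OF M c, of v] that by metis
    then show ?thesis unfolding B_def using ax T by blast
  qed
  have G: "metric_coeff M c p $ i $ j = B (axis i 1) (axis j 1)" for i j
    by (simp add: metric_coeff_def B_def coord_vector_eq)
  have split: "v = v $ 1 *\<^sub>R axis 1 1 + v $ 2 *\<^sub>R (axis 2 1 :: real^2)" for v :: "real^2"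
    by (simp add: vec_eq_iff forall_2 axis_def)
  have left: "B v x = v $ 1 * B (axis 1 1) x + v $ 2 * B (axis 2 1) x" for v x
  proof -
    have "B v x = B (v $ 1 *\<^sub>R axis 1 1 + v $ 2 *\<^sub>R axis 2 1) x" using split[of v] by simp
    then show ?thesis by (simp only: add scale)
  qed
  have B: "B v w = v $ 1 * w $ 1 * B (axis 1 1) (axis 1 1) + (v $ 1 * w $ 2 + v $ 2 * w $ 1) * B (axis 1 1) (axis 2 1)
      + v $ 2 * w $ 2 * B (axis 2 1) (axis 2 1)" for v w
  proof -
    have right: "B x w = w $ 1 * B x (axis 1 1) + w $ 2 * B x (axis 2 1)" for x
      using left[of w x] by (simp only: sym[of w x] sym[of "axis 1 1" x] sym[of "axis 2 1" x])
    have s: "B (axis 2 1) (axis 1 1) = B (axis 1 1) (axis 2 1)" by (rule sym)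
    show ?thesis
      unfolding left[of v w] right[of "axis 1 1"] right[of "axis 2 1"] s by (simp add: algebra_simps)
  qed
  show "metric_tensor M p (tangent_of M c p v) (tangent_of M c p w) =
      v $ 1 * w $ 1 * metric_coeff M c p $ 1 $ 1 + (v $ 1 * w $ 2 + v $ 2 * w $ 1) * metric_coeff M c p $ 1 $ 2
      + v $ 2 * w $ 2 * metric_coeff M c p $ 2 $ 2"
    unfolding G B_def[symmetric] by (rule B)
  show s21: "metric_coeff M c p $ 2 $ 1 = metric_coeff M c p $ 1 $ 2" unfolding G by (rule sym)
  let ?a = "B (axis 1 1) (axis 1 1)" and ?b = "B (axis 1 1) (axis 2 1)" and ?d = "B (axis 2 1) (axis 2 1)"
  have a: "?a > 0" by (rule pos) (simp add: axis_eq_0_iff)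
  \<comment> \<open>The vector whose squared length is \<open>g\<^sub>1\<^sub>1\<close> times the determinant.\<close>
  define z :: "real^2" where "z = (\<chi> i. if i = 1 then - ?b else ?a)"
  have "z $ 2 \<noteq> 0" using a by (simp add: z_def)
  then have "z \<noteq> 0" by auto
  from pos[OF this] have "0 < ?a * (?a * ?d - ?b * ?b)"
    by (subst (asm) B) (simp add: z_def algebra_simps)
  then have "0 < ?a * ?d - ?b * ?b" using a by (simp add: zero_less_mult_iff)
  then show "0 < det (metric_coeff M c p)" by (simp add: det_2 s21) (simp add: G)
qed

definition area_density :: "'a surface \<Rightarrow> 'a chart \<Rightarrow> 'a \<Rightarrow> real" where
  "area_density M c p = sqrt (det (metric_coeff M c p))"

lemma area_density_pos: "riemannian_surface M \<Longrightarrow> c \<in> charts_at M p \<Longrightarrow> 0 < area_density M c p"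
  by (simp add: area_density_def metric_in_coordinates(3))

text \<open>The Gram matrices are congruent via the Jacobian matrix, whose determinant is positive in an
  oriented atlas; hence no absolute value appears after taking the square root.\<close>

lemma area_density_transform:
  assumes R: "riemannian_surface M" and c: "c \<in> charts_at M p" and d: "d \<in> charts_at M p"
  shows "area_density M c p = area_density M d p * det (matrix (local_deriv c d id p))"
proof -
  note M = riemannian_surface_oriented[OF R]
  let ?A = "local_deriv c d id p"
  have "metric_coeff M c p $ i $ j = metric_tensor M p (tangent_of M d p (?A (axis i 1))) (tangent_of M d p (?A (axis j 1)))" for i j
    by (simp add: metric_coeff_def coord_vector_eq tangent_of_change[OF M c d])
  note G = this[unfolded metric_in_coordinates(1)[OF R d]]
  have "det (metric_coeff M c p) = (det (matrix ?A))\<^sup>2 * det (metric_coeff M d p)"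
    unfolding det_matrix_real2 det_2[of "metric_coeff M c p"] det_2[of "metric_coeff M d p"] G metric_in_coordinates(2)[OF R d]
    by (simp add: algebra_simps power2_eq_square)
  moreover have "0 < det (matrix ?A)"
    by (rule oriented_surfaceD(5)[OF M charts_at_in_points[OF M c] c d])
  ultimately show ?thesis by (simp add: area_density_def real_sqrt_mult)
qed

text \<open>The chart chosen in the definition of the area form does not matter.\<close>

lemma area_form_eq:
  assumes R: "riemannian_surface M" and c: "c \<in> charts_at M p"
    and uv: "u \<in> tangent_space M p" "v \<in> tangent_space M p"
  shows "area_form M p u v = area_density M c p * cross2 (u c) (v c)"
proof -
  note M = riemannian_surface_oriented[OF R]
  define d where "d = (SOME c. c \<in> charts_at M p)"
  have d: "d \<in> charts_at M p" unfolding d_def by (rule some_charts_at[OF c])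
  have "u d = local_deriv c d id p (u c)" "v d = local_deriv c d id p (v c)"
    by (rule tangent_spaceD(1)[OF uv(1) c d], rule tangent_spaceD(1)[OF uv(2) c d])
  then have "cross2 (u d) (v d) = det (matrix (local_deriv c d id p)) * cross2 (u c) (v c)"
    by (simp add: cross2_linear[OF local_deriv_id_linear[OF M c d]])
  then show ?thesis
    by (simp add: area_form_def d_def[symmetric] area_density_transform[OF R c d])
       (simp add: area_density_def cross2_def)
qed

lemma area_form_coord_vectors:
  assumes "riemannian_surface M" "c \<in> charts_at M p"
  shows "area_form M p (coord_vector M c 1 p) (coord_vector M c 2 p) = area_density M c p"
  unfolding coord_vector_eq
  by (simp add: area_form_eq[OF assms] tangent_of_in_tangent_space tangent_of_same riemannian_surface_oriented assms cross2_axis)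

lemma differential_eq:
  assumes M: "oriented_surface M" and N: "oriented_surface N" and g: "smooth_map M N g"
    and c: "c \<in> charts_at M p" and d: "d \<in> charts_at N (g p)" and v: "v \<in> tangent_space M p"
  shows "differential M N g p v d = local_deriv c d g p (v c)"
    and "differential M N g p v \<in> tangent_space N (g p)"
proof -
  define e where "e = (SOME c. c \<in> charts_at M p)"
  have e: "e \<in> charts_at M p" unfolding e_def by (rule some_charts_at[OF c])
  have "v c = local_deriv e c id p (v e)" using v c e by (intro tangent_spaceD(1)[of v])
  then show "differential M N g p v d = local_deriv c d g p (v c)"
    using local_deriv_compose[OF M M N oriented_surfaceD(4)[OF M] g e _ , of c d] c d
    by (simp add: differential_def Let_def e_def[symmetric] o_def)
  show "differential M N g p v \<in> tangent_space N (g p)"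
    unfolding tangent_space_def mem_Collect_eq
  proof (intro conjI ballI allI impI)
    fix a b assume a: "a \<in> charts_at N (g p)" and b: "b \<in> charts_at N (g p)"
    have "local_deriv e b g p (v e) = local_deriv a b id (g p) (local_deriv e a g p (v e))"
      using local_deriv_compose[OF M N N g oriented_surfaceD(4)[OF N] e a] b by (simp add: o_def)
    then show "differential M N g p v b = local_deriv a b id (g p) (differential M N g p v a)"
      using a b by (simp add: differential_def Let_def e_def[symmetric])
  qed (simp add: differential_def Let_def)
qed

text \<open>In coordinates both \<open>f\<^sup>* dA\<close> and the area form of \<open>M\<close> are multiples of the standard
  alternating form, the pullback contributing the Jacobian determinant. The factor is unique since
  the area form does not vanish on coordinate vectors.\<close>

theorem area_ratio_eq:
  assumes RM: "riemannian_surface M" and RN: "riemannian_surface N" and g: "smooth_map M N g"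
    and c: "c \<in> charts_at M p" and d: "d \<in> charts_at N (g p)"
  shows "area_ratio M N g p = area_density N d (g p) * det (matrix (local_deriv c d g p)) / area_density M c p"
proof -
  note M = riemannian_surface_oriented[OF RM] and N = riemannian_surface_oriented[OF RN]
  note D = differential_eq[OF M N g c d]
  have eq: "area_form N (g p) (differential M N g p u) (differential M N g p v) =
      (area_density N d (g p) * det (matrix (local_deriv c d g p)) / area_density M c p) * area_form M p u v"
    if "u \<in> tangent_space M p" "v \<in> tangent_space M p" for u v
    using that area_density_pos[OF RM c]
    by (simp add: area_form_eq[OF RN d D(2) D(2)] area_form_eq[OF RM c] D(1) cross2_linear[OF local_deriv_linear[OF g c d]])
  show ?thesis unfolding area_ratio_def
  proof (rule the_equality)
    fix J assume "\<forall>u\<in>tangent_space M p. \<forall>v\<in>tangent_space M p.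
       area_form N (g p) (differential M N g p u) (differential M N g p v) = J * area_form M p u v"
    moreover have T: "coord_vector M c i p \<in> tangent_space M p" for i
      unfolding coord_vector_eq by (rule tangent_of_in_tangent_space[OF M c])
    ultimately have "J * area_form M p (coord_vector M c 1 p) (coord_vector M c 2 p) =
        (area_density N d (g p) * det (matrix (local_deriv c d g p)) / area_density M c p) * area_form M p (coord_vector M c 1 p) (coord_vector M c 2 p)"
      using eq[OF T T] by metis
    then show "J = area_density N d (g p) * det (matrix (local_deriv c d g p)) / area_density M c p"
      using area_density_pos[OF RM c] by (simp add: area_form_coord_vectors[OF RM c] eq_divide_eq)
  qed (use eq in blast)
qed

lemma det_matrix_compose:
  "linear (K :: real^2 \<Rightarrow> real^2) \<Longrightarrow> linear (L :: real^2 \<Rightarrow> real^2) \<Longrightarrow>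
    det (matrix (K \<circ> L)) = det (matrix K) * det (matrix L)"
  by (simp add: matrix_compose det_mul)

lemma area_ratio_compose:
  assumes RM: "riemannian_surface M" and RN: "riemannian_surface N" and RP: "riemannian_surface P"
    and f: "smooth_map M N f" and g: "smooth_map N P g" and p: "p \<in> points M"
  shows "area_ratio M P (g \<circ> f) p = area_ratio N P g (f p) * area_ratio M N f p"
proof -
  note M = riemannian_surface_oriented[OF RM] and N = riemannian_surface_oriented[OF RN] and P = riemannian_surface_oriented[OF RP]
  obtain c where c: "c \<in> charts_at M p" using ex_charts_at[OF M p] by auto
  have fp: "f p \<in> points N" by (rule smooth_mapD(2)[OF f p])
  obtain d where d: "d \<in> charts_at N (f p)" using ex_charts_at[OF N fp] by auto
  obtain e where e: "e \<in> charts_at P (g (f p))" using ex_charts_at[OF P smooth_mapD(2)[OF g fp]] by auto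
  show ?thesis
    using area_density_pos[OF RN d] e
    by (simp add: area_ratio_eq[OF RM RP smooth_map_compose[OF M N P f g] c, of e] area_ratio_eq[OF RN RP g d e]
        area_ratio_eq[OF RM RN f c d] local_deriv_compose[OF M N P f g c d e]
        det_matrix_compose[OF local_deriv_linear[OF g d e] local_deriv_linear[OF f c d]])
qed

lemma smooth_on_area_density:
  assumes R: "riemannian_surface M" and c: "c \<in> atlas M"
  shows "smooth_on (chart_image c) (\<lambda>x. area_density M c (chart_inv c x))"
  unfolding area_density_def det_2
proof (rule smooth_on_sqrt)
  have "smooth_on (chart_image c) (\<lambda>x. metric_coeff M c (chart_inv c x))"
    using R c by (simp add: riemannian_surface_def)
  then have "smooth_on (chart_image c) (\<lambda>x. metric_coeff M c (chart_inv c x) $ i $ j)" for i j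
    by (intro smooth_on_vec_nth)
  then show "smooth_on (chart_image c) (\<lambda>x. metric_coeff M c (chart_inv c x) $ 1 $ 1 * metric_coeff M c (chart_inv c x) $ 2 $ 2 -
      metric_coeff M c (chart_inv c x) $ 1 $ 2 * metric_coeff M c (chart_inv c x) $ 2 $ 1)"
    by (intro smooth_on_diff smooth_on_mult)
  fix x assume "x \<in> chart_image c"
  then have "c \<in> charts_at M (chart_inv c x)" by (rule chart_inv_charts_at[OF c])
  from metric_in_coordinates(3)[OF R this]
  show "0 < metric_coeff M c (chart_inv c x) $ 1 $ 1 * metric_coeff M c (chart_inv c x) $ 2 $ 2 -
      metric_coeff M c (chart_inv c x) $ 1 $ 2 * metric_coeff M c (chart_inv c x) $ 2 $ 1"
    by (simp add: det_2)
qed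

text \<open>For a family of maps with jointly smooth coordinate representation the area ratio is
  jointly smooth: in a local extension \<open>\<Phi>\<close> of the representation, the spatial derivatives
  are the directional derivatives of \<open>\<Phi>\<close> in the directions \<open>(0, e\<^sub>j)\<close>.\<close>

lemma smooth_on_area_ratio_family:
  fixes g :: "real \<Rightarrow> 'a \<Rightarrow> 'b"
  assumes RM: "riemannian_surface M" and RN: "riemannian_surface N"
    and c: "c \<in> atlas M" and d: "d \<in> atlas N" and g: "\<And>t. t \<in> T \<Longrightarrow> smooth_map M N (g t)"
    and sm: "smooth_on {(t, x). t \<in> T \<and> x \<in> local_dom c d (g t)} (\<lambda>(t, x). local_rep c d (g t) x)"
  shows "smooth_on {(t, x). t \<in> T \<and> x \<in> local_dom c d (g t)} (\<lambda>(t, x). area_ratio M N (g t) (chart_inv c x))"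
    (is "smooth_on ?S _")
proof (rule smooth_on_local)
  note M = riemannian_surface_oriented[OF RM] and N = riemannian_surface_oriented[OF RN]
  note C = oriented_surfaceD(2)[OF M c] and D = oriented_surfaceD(2)[OF N d]
  fix z assume z: "z \<in> ?S"
  obtain U \<Phi> where U: "open U" "z \<in> U" "\<And>k. Ck_on_open k U \<Phi>"
    "\<And>y. y \<in> U \<Longrightarrow> y \<in> ?S \<Longrightarrow> \<Phi> y = (\<lambda>(t, x). local_rep c d (g t) x) y"
    by (rule smooth_onE[OF sm z]) (rule that)
  have \<Phi>: "smooth_on U \<Phi>" by (rule Ck_on_open_imp_smooth_on[OF U(1,3)])
  define L where "L y = (\<lambda>v. frechet_derivative \<Phi> (at y) (0, v))" for y
  have L: "local_deriv c d (g t) (chart_inv c x) = L (t, x)" if tx: "(t, x) \<in> ?S \<inter> U" for t x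
  proof -
    have t: "t \<in> T" and x: "x \<in> local_dom c d (g t)" using tx by auto
    have x': "x \<in> chart_image c" "g t (chart_inv c x) \<in> fst d" using x local_dom_iff[OF C, of x d "g t"] by blast+
    define W where "W = {y. (t, y) \<in> U}"
    have "open W" unfolding W_def using open_vimage[OF U(1), of "Pair t"] by (simp add: vimage_def continuous_on_Pair)
    show ?thesis
    proof (rule local_deriv_eqI[OF g[OF t]])
      show "c \<in> charts_at M (chart_inv c x)" by (rule chart_inv_charts_at[OF c x'(1)])
      show "d \<in> charts_at N (g t (chart_inv c x))" by (rule charts_atI[OF d x'(2)])
      show "openin (top_of_set half_plane) (local_dom c d (g t) \<inter> W)"
        using local_dom_openin[OF C D smooth_mapD(1)[OF g[OF t]]] \<open>open W\<close> by (rule openin_Int_open)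
      have xW: "x \<in> local_dom c d (g t) \<inter> W" using x tx by (simp add: W_def)
      then show "snd c (chart_inv c x) \<in> local_dom c d (g t) \<inter> W"
        by (simp add: chart_chart_inv x')
      have "(\<Phi> has_derivative frechet_derivative \<Phi> (at (t, x))) (at (t, x))"
        using smooth_on_open_has_derivative[OF U(1) \<Phi>] tx by blast
      moreover have "((\<lambda>y. (t, y)) has_derivative (\<lambda>v. (0, v))) (at x)"
        by (intro has_derivative_Pair has_derivative_const has_derivative_ident)
      ultimately have "((\<lambda>y. \<Phi> (t, y)) has_derivative L (t, x)) (at x)"
        unfolding L_def using has_derivative_compose by fastforce
      then have "((\<lambda>y. \<Phi> (t, y)) has_derivative L (t, x)) (at x within local_dom c d (g t) \<inter> W)"
        by (rule has_derivative_at_withinI)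
      then have "(local_rep c d (g t) has_derivative L (t, x)) (at x within local_dom c d (g t) \<inter> W)"
        by (rule has_derivative_transform[OF xW, rotated]) (use U(4) t in \<open>auto simp: W_def\<close>)
      then show "(local_rep c d (g t) has_derivative L (t, x)) (at (snd c (chart_inv c x)) within local_dom c d (g t) \<inter> W)"
        by (simp add: chart_chart_inv x')
    qed auto
  qed
  have Lsm: "smooth_on (?S \<inter> U) (\<lambda>y. L y v)" for v
    unfolding L_def by (rule smooth_on_subset[OF smooth_on_frechet_derivative[OF U(1) \<Phi>]]) auto
  define R where "R y = area_density N d (chart_inv d ((\<lambda>(t, x). local_rep c d (g t) x) y)) * det (matrix (L y)) / area_density M c (chart_inv c (snd y))" for y
  have img: "(\<lambda>(t, x). local_rep c d (g t) x) ` (?S \<inter> U) \<subseteq> chart_image d"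
    by (auto simp: local_dom_iff[OF C] local_rep_def chart_in_image)
  have "smooth_on (?S \<inter> U) (\<lambda>y. area_density N d (chart_inv d ((\<lambda>(t, x). local_rep c d (g t) x) y)))"
    by (rule smooth_on_compose[OF smooth_on_area_density[OF RN d] smooth_on_subset[OF sm] img]) auto
  moreover have "smooth_on (?S \<inter> U) (\<lambda>y. det (matrix (L y)))"
    unfolding det_matrix_real2 by (intro smooth_on_diff smooth_on_mult smooth_on_vec_nth Lsm)
  moreover have "smooth_on (?S \<inter> U) (\<lambda>y. area_density M c (chart_inv c (snd y)))"
    by (rule smooth_on_compose[OF smooth_on_area_density[OF RM c] smooth_on_bounded_linear[OF bounded_linear_snd]])
       (auto simp: local_dom_iff[OF C])
  moreover have "area_density M c (chart_inv c (snd y)) \<noteq> 0" if "y \<in> ?S \<inter> U" for y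
  proof -
    have "snd y \<in> chart_image c" using that by (auto simp: local_dom_iff[OF C])
    then have "c \<in> charts_at M (chart_inv c (snd y))" by (rule chart_inv_charts_at[OF c])
    then show ?thesis using area_density_pos[OF RM, of c] by (metis less_irrefl)
  qed
  ultimately have "smooth_on (?S \<inter> U) R"
    unfolding R_def by (intro smooth_on_divide smooth_on_mult)
  then have "smooth_on (?S \<inter> U) (\<lambda>(t, x). area_ratio M N (g t) (chart_inv c x))"
  proof (rule smooth_on_cong)
    fix y assume y: "y \<in> ?S \<inter> U"
    obtain t x where tx: "y = (t, x)" by (cases y)
    have t: "t \<in> T" and x': "x \<in> chart_image c" "g t (chart_inv c x) \<in> fst d"
      using y tx local_dom_iff[OF C, of x d "g t"] by blast+
    have cc: "c \<in> charts_at M (chart_inv c x)" by (rule chart_inv_charts_at[OF c x'(1)])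
    have dd: "d \<in> charts_at N (g t (chart_inv c x))" by (rule charts_atI[OF d x'(2)])
    have "L (t, x) = local_deriv c d (g t) (chart_inv c x)" using L y tx by simp
    moreover have "chart_inv d (local_rep c d (g t) x) = g t (chart_inv c x)"
      by (simp add: local_rep_def chart_inv_chart[OF D] x')
    ultimately show "R y = (\<lambda>(t, x). area_ratio M N (g t) (chart_inv c x)) y"
      by (simp add: tx R_def area_ratio_eq[OF RM RN g[OF t] cc dd])
  qed
  then show "\<exists>U. open U \<and> z \<in> U \<and> smooth_on (?S \<inter> U) (\<lambda>(t, x). area_ratio M N (g t) (chart_inv c x))"
    using U(1,2) by blast
qed

text \<open>A single map is a constant family.\<close>

lemma smooth_on_area_ratio:
  assumes RM: "riemannian_surface M" and RN: "riemannian_surface N"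
    and c: "c \<in> atlas M" and d: "d \<in> atlas N" and g: "smooth_map M N g"
  shows "smooth_on (local_dom c d g) (\<lambda>x. area_ratio M N g (chart_inv c x))"
proof -
  have "smooth_on {(t, x). t \<in> (UNIV::real set) \<and> x \<in> local_dom c d g} (\<lambda>z. local_rep c d g (snd z))"
    by (rule smooth_on_compose[OF smooth_mapD(3)[OF g c d] smooth_on_bounded_linear[OF bounded_linear_snd]]) auto
  then have "smooth_on {(t, x). t \<in> (UNIV::real set) \<and> x \<in> local_dom c d g} (\<lambda>(t, x). local_rep c d g x)"
    by (simp add: case_prod_beta')
  from smooth_on_compose[OF smooth_on_area_ratio_family[OF RM RN c d g this] smooth_on_Pair[OF smooth_on_const[of _ 0] smooth_on_id]]
  show ?thesis by (auto simp: image_subset_iff)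
qed


section \<open>The area measure\<close>

definition borel_of :: "'a topology \<Rightarrow> 'a measure" where
  "borel_of X = sigma (topspace X) {U. openin X U}"

lemma openin_Pow: "{U. openin X U} \<subseteq> Pow (topspace X)"
  using openin_subset by blast

lemma space_borel_of [simp]: "space (borel_of X) = topspace X"
  by (simp add: borel_of_def space_measure_of[OF openin_Pow])

lemma sets_borel_of: "sets (borel_of X) = sigma_sets (topspace X) {U. openin X U}"
  by (simp add: borel_of_def sets_measure_of[OF openin_Pow])

lemma openin_borel_of: "openin X U \<Longrightarrow> U \<in> sets (borel_of X)"
  by (simp add: sets_borel_of sigma_sets.Basic)

lemma measurable_borel_ofI:
  assumes "\<And>x. x \<in> space M \<Longrightarrow> f x \<in> topspace X"
    and "\<And>U. openin X U \<Longrightarrow> f -` U \<inter> space M \<in> sets M"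
  shows "f \<in> measurable M (borel_of X)"
  unfolding borel_of_def by (rule measurable_measure_of[OF openin_Pow]) (use assms in auto)

lemma continuous_map_measurable:
  assumes "continuous_map X Y f" shows "f \<in> measurable (borel_of X) (borel_of Y)"
proof (rule measurable_borel_ofI)
  show "f x \<in> topspace Y" if "x \<in> space (borel_of X)" for x
    using continuous_map_image_subset_topspace[OF assms] that by auto
  fix U assume "openin Y U"
  from openin_continuous_map_preimage[OF assms this]
  have "{x \<in> topspace X. f x \<in> U} \<in> sets (borel_of X)" by (rule openin_borel_of)
  moreover have "{x \<in> topspace X. f x \<in> U} = f -` U \<inter> space (borel_of X)" by auto
  ultimately show "f -` U \<inter> space (borel_of X) \<in> sets (borel_of X)" by simp
qed

lemma continuous_map_borel_measurable:
  fixes f :: "'a \<Rightarrow> 'b::topological_space"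
  assumes "continuous_map X euclidean f" shows "f \<in> borel_measurable (borel_of X)"
proof (rule borel_measurableI)
  fix S :: "'b set" assume "open S"
  then have "openin X {x \<in> topspace X. f x \<in> S}"
    using openin_continuous_map_preimage[OF assms, of S] by simp
  moreover have "{x \<in> topspace X. f x \<in> S} = f -` S \<inter> space (borel_of X)" by auto
  ultimately show "f -` S \<inter> space (borel_of X) \<in> sets (borel_of X)" using openin_borel_of by metis
qed

lemma half_plane_closed: "closed half_plane"
  unfolding half_plane_def by (intro closed_Collect_le continuous_intros)

lemma half_plane_openin_borel:
  assumes "openin (top_of_set half_plane) S" shows "S \<in> sets borel"
proof -
  obtain W where "open W" "S = half_plane \<inter> W" using assms openin_half_plane_iff by auto
  then show ?thesis using half_plane_closed by auto
qed

lemma chart_image_borel: "is_chart X c \<Longrightarrow> chart_image c \<in> sets borel"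
  by (rule half_plane_openin_borel[OF is_chartD(4)])

lemma chart_inv_measurable:
  assumes c: "is_chart X c"
  shows "chart_inv c \<in> measurable (restrict_space borel (chart_image c)) (borel_of X)"
proof (rule measurable_borel_ofI)
  show "chart_inv c x \<in> topspace X" if "x \<in> space (restrict_space borel (chart_image c))" for x
  proof -
    have "x \<in> chart_image c" using that by (simp add: space_restrict_space)
    then show ?thesis using chart_inv_in is_chartD(2)[OF c] by blast
  qed
  fix U assume U: "openin X U"
  have "openin (top_of_set (chart_image c)) {x \<in> topspace (top_of_set (chart_image c)). chart_inv c x \<in> U}"
    by (rule openin_continuous_map_preimage[OF chart_inv_continuous_map[OF c] U])
  then obtain W where W: "open W" "{x \<in> chart_image c. chart_inv c x \<in> U} = chart_image c \<inter> W"
    by (auto simp: openin_open)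
  have "chart_inv c -` U \<inter> space (restrict_space borel (chart_image c)) = chart_image c \<inter> W"
    using W by (auto simp: space_restrict_space)
  then show "chart_inv c -` U \<inter> space (restrict_space borel (chart_image c)) \<in> sets (restrict_space borel (chart_image c))"
    using W by (auto simp: sets_restrict_space)
qed

lemma chart_image_measurable:
  assumes c: "is_chart X c" and B: "B \<in> sets (borel_of X)" "B \<subseteq> fst c"
  shows "snd c ` B \<in> sets borel" and "chart_image c \<inter> chart_inv c -` B = snd c ` B"
proof -
  show eq: "chart_image c \<inter> chart_inv c -` B = snd c ` B"
  proof (intro set_eqI iffI)
    fix x assume "x \<in> chart_image c \<inter> chart_inv c -` B"
    then have "x = snd c (chart_inv c x)" "chart_inv c x \<in> B" by (auto simp: chart_chart_inv)
    then show "x \<in> snd c ` B" by (rule image_eqI)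
  qed (use B in \<open>auto simp: chart_inv_chart[OF c] chart_in_image subset_iff\<close>)
  have "chart_inv c -` B \<inter> space (restrict_space borel (chart_image c)) \<in> sets (restrict_space borel (chart_image c))"
    by (rule measurable_sets[OF chart_inv_measurable[OF c] B(1)])
  then have "snd c ` B \<in> sets (restrict_space borel (chart_image c))"
    by (simp add: space_restrict_space eq[symmetric] Int_commute)
  then show "snd c ` B \<in> sets borel"
    using chart_image_borel[OF c] by (auto simp: sets_restrict_space)
qed

text \<open>The measure $\sqrt{\det g}\, dx$ of one chart, transported to the surface.\<close>

definition chart_measure :: "'a surface \<Rightarrow> 'a chart \<Rightarrow> 'a measure" where
  "chart_measure M c = distr (density (restrict_space lborel (chart_image c))
      (\<lambda>x. ennreal (area_density M c (chart_inv c x)))) (borel_of (surf_top M)) (chart_inv c)"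

lemma sets_chart_measure [simp]: "sets (chart_measure M c) = sets (borel_of (surf_top M))"
  by (simp add: chart_measure_def)

lemma space_chart_measure [simp]: "space (chart_measure M c) = points M"
  by (simp add: chart_measure_def)

lemma area_density_measurable:
  assumes "riemannian_surface M" "c \<in> atlas M"
  shows "(\<lambda>x. area_density M c (chart_inv c x)) \<in> borel_measurable (restrict_space borel (chart_image c))"
  by (rule borel_measurable_continuous_on_restrict[OF smooth_on_imp_continuous_on[OF smooth_on_area_density[OF assms]]])

lemma nn_integral_chart_measure:
  assumes R: "riemannian_surface M" and c: "c \<in> atlas M" and h: "h \<in> borel_measurable (borel_of (surf_top M))"
  shows "(\<integral>\<^sup>+p. h p \<partial>chart_measure M c) =
    (\<integral>\<^sup>+x. (ennreal (area_density M c (chart_inv c x)) * h (chart_inv c x)) * indicator (chart_image c) x \<partial>lborel)"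
proof -
  note C = oriented_surfaceD(2)[OF riemannian_surface_oriented[OF R] c]
  have s: "sets (restrict_space lborel (chart_image c)) = sets (restrict_space borel (chart_image c))"
    by (simp add: sets_restrict_space)
  have m1: "chart_inv c \<in> measurable (restrict_space lborel (chart_image c)) (borel_of (surf_top M))"
    using chart_inv_measurable[OF C] measurable_cong_sets[OF s refl] by blast
  have m2: "(\<lambda>x. area_density M c (chart_inv c x)) \<in> borel_measurable (restrict_space lborel (chart_image c))"
    using area_density_measurable[OF R c] measurable_cong_sets[OF s refl] by blast
  have m3: "(\<lambda>x. h (chart_inv c x)) \<in> borel_measurable (restrict_space lborel (chart_image c))"
    by (rule measurable_compose[OF m1 h])
  have "(\<integral>\<^sup>+p. h p \<partial>chart_measure M c) = (\<integral>\<^sup>+x. h (chart_inv c x) \<partial>density (restrict_space lborel (chart_image c)) (\<lambda>x. ennreal (area_density M c (chart_inv c x))))"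
    unfolding chart_measure_def by (rule nn_integral_distr) (use m1 h in simp_all)
  also have "\<dots> = (\<integral>\<^sup>+x. ennreal (area_density M c (chart_inv c x)) * h (chart_inv c x) \<partial>restrict_space lborel (chart_image c))"
    by (rule nn_integral_density) (use m2 m3 in auto)
  also have "\<dots> = (\<integral>\<^sup>+x. (ennreal (area_density M c (chart_inv c x)) * h (chart_inv c x)) * indicator (chart_image c) x \<partial>lborel)"
    by (rule nn_integral_restrict_space) (use chart_image_borel[OF C] in auto)
  finally show ?thesis .
qed

lemma emeasure_chart_measure:
  assumes R: "riemannian_surface M" and c: "c \<in> atlas M"
    and B: "B \<in> sets (borel_of (surf_top M))" "B \<subseteq> fst c"
  shows "emeasure (chart_measure M c) B =
    (\<integral>\<^sup>+x. ennreal (area_density M c (chart_inv c x)) * indicator (snd c ` B) x \<partial>lborel)"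
proof -
  note C = oriented_surfaceD(2)[OF riemannian_surface_oriented[OF R] c]
  have "emeasure (chart_measure M c) B = (\<integral>\<^sup>+p. indicator B p \<partial>chart_measure M c)"
    using B by (simp add: nn_integral_indicator)
  also have "\<dots> = (\<integral>\<^sup>+x. (ennreal (area_density M c (chart_inv c x)) * indicator B (chart_inv c x)) * indicator (chart_image c) x \<partial>lborel)"
    by (rule nn_integral_chart_measure[OF R c]) (use B in simp)
  also have "\<dots> = (\<integral>\<^sup>+x. ennreal (area_density M c (chart_inv c x)) * indicator (snd c ` B) x \<partial>lborel)"
    unfolding chart_image_measurable(2)[OF C B, symmetric]
    by (intro nn_integral_cong) (auto simp: indicator_def)
  finally show ?thesis .
qed

text \<open>The change of variables theorem is available for absolutely integrable functions. For nonnegative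
  functions it extends to infinite values, because failing to be integrable then means having
  infinite integral.\<close>

lemma nn_integral_eq_integral_or_top:
  fixes h :: "real^2 \<Rightarrow> real"
  assumes A: "A \<in> sets borel" and m: "(\<lambda>x. indicator A x *\<^sub>R h x) \<in> borel_measurable borel" and nn: "\<And>x. x \<in> A \<Longrightarrow> 0 \<le> h x"
  shows "(\<integral>\<^sup>+x. ennreal (h x) * indicator A x \<partial>lborel) =
    (if h absolutely_integrable_on A then ennreal (integral A h) else \<infinity>)"
proof -
  let ?H = "\<lambda>x. indicator A x *\<^sub>R h x"
  have m': "?H \<in> borel_measurable lborel" using m by simp
  have H: "(\<integral>\<^sup>+x. ennreal (h x) * indicator A x \<partial>lborel) = (\<integral>\<^sup>+x. ennreal (?H x) \<partial>lborel)"
    by (intro nn_integral_cong) (simp add: indicator_def)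
  have nn': "AE x in lborel. 0 \<le> ?H x" using nn by (auto simp: indicator_def)
  have iff: "h absolutely_integrable_on A \<longleftrightarrow> integrable lborel ?H"
    unfolding set_integrable_def using integrable_completion[OF m'] by simp
  show ?thesis
  proof (cases "h absolutely_integrable_on A")
    case True
    then have "integrable lborel ?H" using iff by simp
    from nn_integral_eq_integral[OF this nn']
    have "(\<integral>\<^sup>+x. ennreal (?H x) \<partial>lborel) = ennreal (integral\<^sup>L lborel ?H)" .
    also have "integral\<^sup>L lborel ?H = (LINT x:A|lebesgue. h x)"
      unfolding set_lebesgue_integral_def using integral_completion[OF m'] by simp
    also have "\<dots> = integral A h" by (rule set_lebesgue_integral_eq_integral(2)[OF True])
    finally show ?thesis using True H by simp
  next
    case False
    have "(\<integral>\<^sup>+x. ennreal (?H x) \<partial>lborel) = \<infinity>"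
    proof (rule ccontr)
      assume "(\<integral>\<^sup>+x. ennreal (?H x) \<partial>lborel) \<noteq> \<infinity>"
      then have "(\<integral>\<^sup>+x. ennreal (?H x) \<partial>lborel) < \<infinity>" by (simp add: less_top)
      from integrableI_nonneg[OF m' nn' this] show False using iff False by simp
    qed
    then show ?thesis using False H by simp
  qed
qed

text \<open>Real functions are viewed as functions into \<open>real^1\<close>, to which the vector-valued theorem applies.\<close>

lemma nn_integral_change_of_variables:
  fixes f :: "real^2 \<Rightarrow> real" and g :: "real^2 \<Rightarrow> real^2"
  assumes S: "S \<in> sets borel" and gS: "g ` S \<in> sets borel"
    and der: "\<And>x. x \<in> S \<Longrightarrow> (g has_derivative g' x) (at x within S)" and inj: "inj_on g S"
    and f: "(\<lambda>y. indicator (g ` S) y *\<^sub>R f y) \<in> borel_measurable borel" "\<And>y. y \<in> g ` S \<Longrightarrow> 0 \<le> f y"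
    and k: "\<And>x. x \<in> S \<Longrightarrow> k x = \<bar>det (matrix (g' x))\<bar> * f (g x)" "(\<lambda>x. indicator S x *\<^sub>R k x) \<in> borel_measurable borel"
  shows "(\<integral>\<^sup>+x. ennreal (k x) * indicator S x \<partial>lborel) = (\<integral>\<^sup>+y. ennreal (f y) * indicator (g ` S) y \<partial>lborel)"
proof -
  define F :: "real^2 \<Rightarrow> real^1" where "F y = vec (f y)" for y
  have SL: "S \<in> sets lebesgue" using S by auto
  let ?k = "\<lambda>x. \<bar>det (matrix (g' x))\<bar> * f (g x)"
  have abs1: "(\<lambda>x. vec (h x) :: real^1) absolutely_integrable_on A \<longleftrightarrow> h absolutely_integrable_on A"
    for h :: "real^2 \<Rightarrow> real" and A
    by (simp add: absolutely_integrable_on_1_iff)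
  have int1: "integral A (\<lambda>x. vec (h x) :: real^1) = vec (integral A h)" if "h absolutely_integrable_on A"
    for h :: "real^2 \<Rightarrow> real" and A
    by (simp add: integral_on_1_eq)
  have sc: "\<bar>det (matrix (g' x))\<bar> *\<^sub>R F (g x) = vec (?k x)" for x by (simp add: F_def vec_eq_iff)
  have iff: "(\<lambda>x. vec (?k x) :: real^1) absolutely_integrable_on S \<and> integral S (\<lambda>x. vec (?k x) :: real^1) = b \<longleftrightarrow>
      F absolutely_integrable_on g ` S \<and> integral (g ` S) F = b" for b
    using has_absolute_integral_change_of_variables[OF SL der inj, of F b] unfolding sc .
  have F: "F = (\<lambda>y. vec (f y))" by (simp add: F_def fun_eq_iff)
  have ai': "(\<lambda>x. vec (?k x) :: real^1) absolutely_integrable_on S \<longleftrightarrow> F absolutely_integrable_on g ` S"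
    using iff[of "integral S (\<lambda>x. vec (?k x) :: real^1)"] iff[of "integral (g ` S) F"] by blast
  then have ai: "?k absolutely_integrable_on S \<longleftrightarrow> f absolutely_integrable_on g ` S"
    unfolding F abs1 .
  have ie: "integral S ?k = integral (g ` S) f" if "f absolutely_integrable_on g ` S"
  proof -
    have "F absolutely_integrable_on g ` S" unfolding F abs1 by (rule that)
    then have "integral S (\<lambda>x. vec (?k x) :: real^1) = integral (g ` S) F"
      using iff[of "integral (g ` S) F"] by blast
    moreover have "?k absolutely_integrable_on S" using ai that by simp
    ultimately have "vec (integral S ?k) = (vec (integral (g ` S) f) :: real^1)"
      unfolding F by (simp only: int1[OF that] int1)
    then show ?thesis by (simp add: vec_eq_iff)
  qed
  have kS: "k absolutely_integrable_on S \<longleftrightarrow> ?k absolutely_integrable_on S"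
    by (rule set_integrable_cong) (use k in auto)
  have kI: "integral S k = integral S ?k" by (rule integral_cong) (use k in auto)
  have "0 \<le> k x" if "x \<in> S" for x using k(1)[OF that] f(2)[of "g x"] that by simp
  from nn_integral_eq_integral_or_top[OF S k(2) this] nn_integral_eq_integral_or_top[OF gS f]
  show ?thesis using ai ie kS kI by simp
qed

text \<open>Substitution by the coordinate representation of \<open>g\<close>: its Jacobian determinant is the
  area ratio times the quotient of the two densities.\<close>

lemma chart_change_of_variables:
  assumes RM: "riemannian_surface M" and RN: "riemannian_surface N" and g: "smooth_map M N g"
    and c: "c \<in> atlas M" and d: "d \<in> atlas N"
    and A: "A \<in> sets (borel_of (surf_top M))" "A \<subseteq> fst c"
    and gA: "g ` A \<in> sets (borel_of (surf_top N))" "g ` A \<subseteq> fst d"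
    and inj: "inj_on g A" and pos: "\<And>p. p \<in> A \<Longrightarrow> 0 \<le> area_ratio M N g p"
  shows "(\<integral>\<^sup>+x. ennreal (area_ratio M N g (chart_inv c x) * area_density M c (chart_inv c x)) * indicator (snd c ` A) x \<partial>lborel)
     = emeasure (chart_measure N d) (g ` A)"
proof -
  note M = riemannian_surface_oriented[OF RM] and N = riemannian_surface_oriented[OF RN]
  note C = oriented_surfaceD(2)[OF M c] and D = oriented_surfaceD(2)[OF N d]
  let ?S = "snd c ` A" and ?t = "local_rep c d g"
  have img: "?t ` ?S = snd d ` (g ` A)"
    using A by (auto simp: local_rep_apply[OF C] image_image subset_iff)
  have dom: "?S \<subseteq> local_dom c d g" using A gA by (auto simp: local_dom_def)
  have ch: "c \<in> charts_at M p" "d \<in> charts_at N (g p)" if "p \<in> A" for p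
    using that A gA c d by (auto simp: charts_at_def)
  have "(\<integral>\<^sup>+x. ennreal (area_ratio M N g (chart_inv c x) * area_density M c (chart_inv c x)) * indicator ?S x \<partial>lborel)
     = (\<integral>\<^sup>+y. ennreal (area_density N d (chart_inv d y)) * indicator (?t ` ?S) y \<partial>lborel)"
  proof (rule nn_integral_change_of_variables[where g' = "\<lambda>x. local_deriv c d g (chart_inv c x)"])
    show S: "?S \<in> sets borel" by (rule chart_image_measurable(1)[OF C A])
    show S': "?t ` ?S \<in> sets borel" unfolding img by (rule chart_image_measurable(1)[OF D gA])
    show "inj_on ?t ?S"
    proof (rule inj_onI)
      fix x y assume "x \<in> ?S" "y \<in> ?S" and eq: "?t x = ?t y"
      then obtain p q where pq: "p \<in> A" "q \<in> A" "x = snd c p" "y = snd c q" by auto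
      then have "snd d (g p) = snd d (g q)" using eq A by (auto simp: local_rep_apply[OF C] subset_iff)
      then have "g p = g q" using is_chartD(3)[OF D] gA pq by (auto simp: inj_on_def)
      then show "x = y" using inj pq by (auto simp: inj_on_def)
    qed
    fix x assume x: "x \<in> ?S"
    then obtain p where p: "p \<in> A" "x = snd c p" by auto
    have inv [simp]: "chart_inv c x = p" using p A by (auto simp: chart_inv_chart[OF C])
    have tx: "?t x = snd d (g p)" using p A by (auto simp: local_rep_apply[OF C])
    have [simp]: "chart_inv d (?t x) = g p" unfolding tx using p gA by (auto simp: chart_inv_chart[OF D])
    show "(?t has_derivative local_deriv c d g (chart_inv c x)) (at x within ?S)"
      unfolding inv using has_derivative_subset[OF smooth_map_local_deriv[OF g ch[OF p(1)]] dom] p by simp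
    have "area_density N d (g p) * det (matrix (local_deriv c d g p)) = area_ratio M N g p * area_density M c p"
      using area_density_pos[OF RM ch(1)[OF p(1)]] by (simp add: area_ratio_eq[OF RM RN g ch[OF p(1)]])
    moreover have "0 \<le> det (matrix (local_deriv c d g p))"
      using pos[OF p(1)] area_density_pos[OF RM ch(1)[OF p(1)]] area_density_pos[OF RN ch(2)[OF p(1)]]
      by (simp add: area_ratio_eq[OF RM RN g ch[OF p(1)]] zero_le_divide_iff zero_le_mult_iff)
    ultimately show "area_ratio M N g (chart_inv c x) * area_density M c (chart_inv c x) =
        \<bar>det (matrix (local_deriv c d g (chart_inv c x)))\<bar> * area_density N d (chart_inv d (?t x))"
      by (simp add: mult.commute)
  next
    fix y assume "y \<in> ?t ` ?S"
    then obtain p where "p \<in> A" "y = snd d (g p)" unfolding img by auto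
    then show "0 \<le> area_density N d (chart_inv d y)"
      using gA area_density_pos[OF RN ch(2)] by (auto simp: chart_inv_chart[OF D] image_subset_iff intro: less_imp_le)
  next
    have S: "?S \<in> sets borel" by (rule chart_image_measurable(1)[OF C A])
    have S': "?t ` ?S \<in> sets borel" unfolding img by (rule chart_image_measurable(1)[OF D gA])
    have "?t ` ?S \<subseteq> chart_image d" unfolding img using gA by (auto simp: chart_image_def)
    then show "(\<lambda>y. indicator (?t ` ?S) y *\<^sub>R area_density N d (chart_inv d y)) \<in> borel_measurable borel"
      by (intro borel_measurable_continuous_on_indicator[OF S'] smooth_on_imp_continuous_on)
         (rule smooth_on_subset[OF smooth_on_area_density[OF RN d]])
    have "?S \<subseteq> chart_image c" using A by (auto simp: chart_image_def)
    then have "smooth_on ?S (\<lambda>x. area_ratio M N g (chart_inv c x) * area_density M c (chart_inv c x))"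
      by (intro smooth_on_mult smooth_on_subset[OF smooth_on_area_density[OF RM c]]
          smooth_on_subset[OF smooth_on_area_ratio[OF RM RN c d g] dom])
    then show "(\<lambda>x. indicator ?S x *\<^sub>R (area_ratio M N g (chart_inv c x) * area_density M c (chart_inv c x))) \<in> borel_measurable borel"
      by (intro borel_measurable_continuous_on_indicator[OF S] smooth_on_imp_continuous_on)
  qed
  then show ?thesis unfolding img emeasure_chart_measure[OF RN d gA] .
qed

lemma area_ratio_id:
  assumes R: "riemannian_surface M" and p: "p \<in> points M"
  shows "area_ratio M M id p = 1"
proof -
  note M = riemannian_surface_oriented[OF R]
  obtain c where c: "c \<in> charts_at M p" using ex_charts_at[OF M p] by auto
  have "matrix id = (mat 1 :: real^2^2)" by (simp add: matrix_id_mat_1)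
  then show ?thesis
    using area_ratio_eq[OF R R oriented_surfaceD(4)[OF M] c, of c] c area_density_pos[OF R c]
    by (simp add: local_deriv_id_same[OF M c])
qed

text \<open>Substitution by a transition map, that is, by the identity in two charts, whose area ratio is one.\<close>

lemma chart_measures_agree:
  assumes R: "riemannian_surface M" and c: "c \<in> atlas M" and d: "d \<in> atlas M"
    and B: "B \<in> sets (borel_of (surf_top M))" "B \<subseteq> fst c" "B \<subseteq> fst d"
  shows "emeasure (chart_measure M c) B = emeasure (chart_measure M d) B"
proof -
  note M = riemannian_surface_oriented[OF R]
  note C = oriented_surfaceD(2)[OF M c]
  have one: "area_ratio M M id p = 1" if "p \<in> B" for p
    using area_ratio_id[OF R] that B is_chartD(2)[OF C] by blast
  have "emeasure (chart_measure M c) B =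
      (\<integral>\<^sup>+x. ennreal (area_ratio M M id (chart_inv c x) * area_density M c (chart_inv c x)) * indicator (snd c ` B) x \<partial>lborel)"
    unfolding emeasure_chart_measure[OF R c B(1,2)]
    by (intro nn_integral_cong) (use B one in \<open>auto simp: indicator_def chart_inv_chart[OF C] subset_iff\<close>)
  also have "\<dots> = emeasure (chart_measure M d) (id ` B)"
    by (rule chart_change_of_variables[OF R R oriented_surfaceD(4)[OF M] c d B(1,2)]) (use B one in auto)
  finally show ?thesis by simp
qed

text \<open>By compactness finitely many sets of the cover suffice, and any Borel set splits into disjoint
  pieces contained in them.\<close>

lemma measure_eqI_open_cover:
  assumes X: "compact_space X" and sets: "sets \<mu> = sets (borel_of X)" "sets \<nu> = sets (borel_of X)"
    and cover: "\<And>x. x \<in> topspace X \<Longrightarrow> \<exists>U\<in>\<U>. x \<in> U" and op: "\<And>U. U \<in> \<U> \<Longrightarrow> openin X U"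
    and eq: "\<And>U B. U \<in> \<U> \<Longrightarrow> B \<in> sets (borel_of X) \<Longrightarrow> B \<subseteq> U \<Longrightarrow> emeasure \<mu> B = emeasure \<nu> B"
  shows "\<mu> = \<nu>"
proof (rule measure_eqI)
  show "sets \<mu> = sets \<nu>" using sets by simp
  fix A assume A: "A \<in> sets \<mu>"
  have "\<exists>F. finite F \<and> F \<subseteq> \<U> \<and> topspace X \<subseteq> \<Union>F"
    using X op cover unfolding compact_space_alt by (metis UnionI subsetI)
  then obtain F where F: "finite F" "F \<subseteq> \<U>" "topspace X \<subseteq> \<Union>F" by auto
  have "\<forall>B\<in>sets (borel_of X). B \<subseteq> \<Union>F \<longrightarrow> emeasure \<mu> B = emeasure \<nu> B"
    using F(1,2)
  proof (induction F rule: finite_induct)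
    case empty
    then show ?case by auto
  next
    case (insert U F)
    show ?case
    proof (intro ballI impI)
      fix B assume B: "B \<in> sets (borel_of X)" "B \<subseteq> \<Union> (insert U F)"
      have U: "U \<in> sets (borel_of X)" using insert.prems op openin_borel_of by blast
      have 1: "B \<inter> U \<in> sets (borel_of X)" "B - U \<in> sets (borel_of X)" using B U by auto
      have "emeasure \<mu> (B \<inter> U) = emeasure \<nu> (B \<inter> U)" using eq[of U "B \<inter> U"] insert.prems 1 by auto
      moreover have "emeasure \<mu> (B - U) = emeasure \<nu> (B - U)" using insert.IH insert.prems 1 B by auto
      moreover have "emeasure \<mu> (B \<inter> U) + emeasure \<mu> (B - U) = emeasure \<mu> ((B \<inter> U) \<union> (B - U))"
        by (rule plus_emeasure) (use 1 sets in auto)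
      moreover have "emeasure \<nu> (B \<inter> U) + emeasure \<nu> (B - U) = emeasure \<nu> ((B \<inter> U) \<union> (B - U))"
        by (rule plus_emeasure) (use 1 sets in auto)
      moreover have "(B \<inter> U) \<union> (B - U) = B" by auto
      ultimately show "emeasure \<mu> B = emeasure \<nu> B" by simp
    qed
  qed
  moreover have "A \<subseteq> topspace X"
    using sets.sets_into_space[OF A] sets_eq_imp_space_eq[OF sets(1)] by simp
  moreover have "A \<in> sets (borel_of X)" using A sets by simp
  ultimately show "emeasure \<mu> A = emeasure \<nu> A" using F(3) by (metis order_trans)
qed

text \<open>The chart measures are glued along the disjoint pieces
  \<open>U\<^sub>i - (U\<^sub>0 \<union> \<dots> \<union> U\<^sub>i\<^sub>-\<^sub>1)\<close> of a finite subcover by chart domains.\<close>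

lemma ex_area_measure:
  assumes R: "riemannian_surface M" and K: "compact_space (surf_top M)"
  shows "\<exists>\<mu>. sets \<mu> = sets (borel_of (surf_top M)) \<and>
    (\<forall>c\<in>atlas M. \<forall>B\<in>sets (borel_of (surf_top M)). B \<subseteq> fst c \<longrightarrow> emeasure \<mu> B = emeasure (chart_measure M c) B)"
proof -
  note M = riemannian_surface_oriented[OF R]
  let ?X = "surf_top M"
  have "\<exists>F. finite F \<and> F \<subseteq> fst ` atlas M \<and> points M \<subseteq> \<Union>F"
    using K is_chartD(1)[OF oriented_surfaceD(2)[OF M]] oriented_surfaceD(3)[OF M] unfolding compact_space_alt
    by (metis (no_types, lifting) image_iff order_refl)
  then obtain F where F: "finite F" "F \<subseteq> fst ` atlas M" "points M \<subseteq> \<Union>F" by auto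
  obtain C where C: "finite C" "C \<subseteq> atlas M" "F = fst ` C" using finite_subset_image[OF F(1,2)] by auto
  obtain cs where cs: "set cs = C" using finite_list[OF C(1)] by auto
  define U where "U i = fst (cs ! i)" for i
  define D where "D = disjointed U"
  define n where "n = length cs"
  have csi: "cs ! i \<in> atlas M" if "i < n" for i using that cs C(2) nth_mem[of i cs] by (auto simp: n_def)
  have U: "U i \<in> sets (borel_of ?X)" if "i < n" for i
    unfolding U_def by (rule openin_borel_of[OF is_chartD(1)[OF oriented_surfaceD(2)[OF M csi[OF that]]]])
  have D: "D i \<in> sets (borel_of ?X)" if "i < n" for i
    unfolding D_def disjointed_def using U that by (intro sets.Diff sets.finite_UN) auto
  have DU: "D i \<subseteq> U i" for i unfolding D_def by (rule disjointed_subset)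
  have disj: "disjoint_family D" unfolding D_def by (rule disjoint_family_disjointed)
  have "(\<Union>i\<in>{0..<n}. D i) = (\<Union>i\<in>{0..<n}. U i)" unfolding D_def by (rule finite_UN_disjointed_eq)
  also have "\<dots> = \<Union>F"
  proof -
    have "x \<in> (\<Union>i\<in>{0..<n}. U i) \<longleftrightarrow> (\<exists>c\<in>set cs. x \<in> fst c)" for x
      unfolding U_def n_def Bex_def in_set_conv_nth UN_iff by (metis atLeastLessThan_iff zero_le)
    then show ?thesis unfolding C(3) cs[symmetric] by blast
  qed
  finally have cov: "points M \<subseteq> (\<Union>i\<in>{0..<n}. D i)" using F(3) by simp
  define m where "m B = (\<Sum>i\<in>{0..<n}. emeasure (chart_measure M (cs ! i)) (B \<inter> D i))" for B
  define \<mu> where "\<mu> = measure_of (points M) (sets (borel_of ?X)) m"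
  have sub: "sets (borel_of ?X) \<subseteq> Pow (points M)" using sets.space_closed[of "borel_of ?X"] by simp
  have sets\<mu>: "sets \<mu> = sets (borel_of ?X)"
    unfolding \<mu>_def using sets.sigma_sets_eq[of "borel_of ?X"] by (simp add: sets_measure_of[OF sub])
  have ca: "countably_additive (sets (borel_of ?X)) m"
  proof (rule countably_additiveI)
    fix A :: "nat \<Rightarrow> 'a set" assume A: "range A \<subseteq> sets (borel_of ?X)" "disjoint_family A"
    have "(\<Sum>j. emeasure (chart_measure M (cs ! i)) (A j \<inter> D i)) = emeasure (chart_measure M (cs ! i)) ((\<Union>j. A j) \<inter> D i)" if "i < n" for i
    proof -
      have "(\<Sum>j. emeasure (chart_measure M (cs ! i)) (A j \<inter> D i)) = emeasure (chart_measure M (cs ! i)) (\<Union>j. A j \<inter> D i)"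
        by (rule suminf_emeasure) (use A D[OF that] in \<open>auto simp: disjoint_family_on_def\<close>)
      moreover have "(\<Union>j. A j \<inter> D i) = (\<Union>j. A j) \<inter> D i" by auto
      ultimately show ?thesis by simp
    qed
    then have "(\<Sum>i\<in>{0..<n}. \<Sum>j. emeasure (chart_measure M (cs ! i)) (A j \<inter> D i)) = m (\<Union>j. A j)"
      unfolding m_def by (intro sum.cong) auto
    moreover have "(\<Sum>j. m (A j)) = (\<Sum>i\<in>{0..<n}. \<Sum>j. emeasure (chart_measure M (cs ! i)) (A j \<inter> D i))"
      unfolding m_def by (rule suminf_sum) auto
    ultimately show "(\<Sum>j. m (A j)) = m (\<Union>j. A j)" by simp
  qed
  have em: "emeasure \<mu> B = m B" if "B \<in> sets (borel_of ?X)" for B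
    unfolding \<mu>_def
  proof (rule emeasure_measure_of_sigma[OF _ _ ca that])
    show "sigma_algebra (points M) (sets (borel_of ?X))"
      using sets.sigma_algebra_axioms[of "borel_of ?X"] by simp
    show "positive (sets (borel_of ?X)) m" by (simp add: positive_def m_def)
  qed
  have "emeasure \<mu> B = emeasure (chart_measure M c) B"
    if c: "c \<in> atlas M" and B: "B \<in> sets (borel_of ?X)" "B \<subseteq> fst c" for c B
  proof -
    have "m B = (\<Sum>i\<in>{0..<n}. emeasure (chart_measure M c) (B \<inter> D i))"
      unfolding m_def
    proof (rule sum.cong[OF refl])
      fix i assume "i \<in> {0..<n}"
      then show "emeasure (chart_measure M (cs ! i)) (B \<inter> D i) = emeasure (chart_measure M c) (B \<inter> D i)"
        using DU[of i] B D[of i] by (intro chart_measures_agree[OF R csi c]) (auto simp: U_def)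
    qed
    also have "\<dots> = emeasure (chart_measure M c) (\<Union>i\<in>{0..<n}. B \<inter> D i)"
    proof (rule sum_emeasure)
      show "disjoint_family_on (\<lambda>i. B \<inter> D i) {0..<n}" using disj unfolding disjoint_family_on_def by blast
    qed (use B D in auto)
    also have "(\<Union>i\<in>{0..<n}. B \<inter> D i) = B" using cov B(1) sub by blast
    finally show ?thesis using em[OF B(1)] by simp
  qed
  then show ?thesis using sets\<mu> by blast
qed

text \<open>Existence is the gluing lemma, uniqueness the comparison of measures on the open cover by chart domains.
  The coefficient $dA(\partial_1, \partial_2)$ in the characterization is the area density of the chart.\<close>

lemma area_measure_props:
  assumes R: "riemannian_surface M" and K: "compact_space (surf_top M)"
  shows sets_area_measure: "sets (area_measure M) = sets (borel_of (surf_top M))"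
    and space_area_measure: "space (area_measure M) = points M"
    and emeasure_area_measure: "\<And>c B. c \<in> atlas M \<Longrightarrow> B \<in> sets (borel_of (surf_top M)) \<Longrightarrow> B \<subseteq> fst c \<Longrightarrow>
      emeasure (area_measure M) B = emeasure (chart_measure M c) B"
proof -
  note M = riemannian_surface_oriented[OF R]
  let ?X = "surf_top M"
  have form: "(\<integral>\<^sup>+x. ennreal (let p = chart_inv c x in area_form M p (coord_vector M c 1 p) (coord_vector M c 2 p))
      * indicator (snd c ` B) x \<partial>lborel) = emeasure (chart_measure M c) B"
    if c: "c \<in> atlas M" and B: "B \<in> sets (borel_of ?X)" "B \<subseteq> fst c" for c B
    unfolding emeasure_chart_measure[OF R c B]
  proof (rule nn_integral_cong)
    fix x
    show "ennreal (let p = chart_inv c x in area_form M p (coord_vector M c 1 p) (coord_vector M c 2 p)) * indicator (snd c ` B) x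
        = ennreal (area_density M c (chart_inv c x)) * indicator (snd c ` B) x"
    proof (cases "x \<in> snd c ` B")
      case True
      then have "x \<in> chart_image c" using B by (auto simp: chart_image_def)
      from area_form_coord_vectors[OF R chart_inv_charts_at[OF c this]] show ?thesis by (simp add: Let_def)
    qed simp
  qed
  define P where "P \<mu> \<longleftrightarrow> space \<mu> = points M \<and> sets \<mu> = sigma_sets (points M) {U. openin ?X U} \<and>
     (\<forall>c\<in>atlas M. \<forall>B\<in>sets \<mu>. B \<subseteq> fst c \<longrightarrow> emeasure \<mu> B =
          (\<integral>\<^sup>+x. ennreal (let p = chart_inv c x in area_form M p (coord_vector M c 1 p) (coord_vector M c 2 p))
                * indicator (snd c ` B) x \<partial>lborel))" for \<mu>
  have P: "P \<mu> \<longleftrightarrow> sets \<mu> = sets (borel_of ?X) \<and>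
      (\<forall>c\<in>atlas M. \<forall>B\<in>sets (borel_of ?X). B \<subseteq> fst c \<longrightarrow> emeasure \<mu> B = emeasure (chart_measure M c) B)" for \<mu>
    unfolding P_def sets_borel_of[symmetric] using form sets_eq_imp_space_eq[of \<mu> "borel_of ?X"] by auto
  have uniq: "\<mu> = \<nu>" if "P \<mu>" "P \<nu>" for \<mu> \<nu>
  proof (rule measure_eqI_open_cover[OF K, where \<U> = "fst ` atlas M"])
    show "sets \<mu> = sets (borel_of ?X)" "sets \<nu> = sets (borel_of ?X)" using that P by auto
    show "\<exists>U\<in>fst ` atlas M. x \<in> U" if "x \<in> topspace ?X" for x
      using that unfolding oriented_surfaceD(3)[OF M] by blast
    show "openin ?X U" if "U \<in> fst ` atlas M" for U
      using that is_chartD(1)[OF oriented_surfaceD(2)[OF M]] by auto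
    show "emeasure \<mu> B = emeasure \<nu> B" if "U \<in> fst ` atlas M" "B \<in> sets (borel_of ?X)" "B \<subseteq> U" for U B
      using that \<open>P \<mu>\<close> \<open>P \<nu>\<close> unfolding P by auto
  qed
  obtain \<mu> where \<mu>: "P \<mu>" using ex_area_measure[OF R K] unfolding P by blast
  have "area_measure M = (THE \<mu>. P \<mu>)" unfolding area_measure_def P_def ..
  then have "P (area_measure M)" using theI[of P, OF \<mu>] uniq \<mu> by metis
  then show 1: "sets (area_measure M) = sets (borel_of ?X)"
    and "\<And>c B. c \<in> atlas M \<Longrightarrow> B \<in> sets (borel_of ?X) \<Longrightarrow> B \<subseteq> fst c \<Longrightarrow>
      emeasure (area_measure M) B = emeasure (chart_measure M c) B"
    unfolding P by auto
  show "space (area_measure M) = points M" using sets_eq_imp_space_eq[OF 1] by simp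
qed


section \<open>Finite positive area and the pullback formula\<close>

text \<open>A property of sets that holds locally and passes to finite unions holds for a compact space. It
  yields finite area and bounds that are uniform along a flow.\<close>

lemma compact_space_induct:
  assumes X: "compact_space X" and nbhd: "\<And>x. x \<in> topspace X \<Longrightarrow> \<exists>U. openin X U \<and> x \<in> U \<and> Q U"
    and empty: "Q {}" and un: "\<And>U V. Q U \<Longrightarrow> Q V \<Longrightarrow> Q (U \<union> V)"
  shows "Q (topspace X)"
proof -
  have "\<exists>F. finite F \<and> F \<subseteq> {U. openin X U \<and> Q U} \<and> topspace X \<subseteq> \<Union>F"
    by (rule X[unfolded compact_space_alt, rule_format]) (use nbhd in auto)
  then obtain F where F: "finite F" "F \<subseteq> {U. openin X U \<and> Q U}" "topspace X \<subseteq> \<Union>F" by auto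
  have "Q (\<Union>F)" using F(1,2) by (induction F rule: finite_induct) (auto intro: empty un)
  moreover have "\<Union>F = topspace X" using F openin_subset by blast
  ultimately show ?thesis by simp
qed

lemma chart_cball:
  assumes c: "is_chart X c" and p: "p \<in> fst c"
  obtains r where "0 < r" "cball (snd c p) r \<inter> half_plane \<subseteq> chart_image c"
proof -
  obtain W where W: "open W" "chart_image c = half_plane \<inter> W" using is_chartD(4)[OF c] openin_half_plane_iff by auto
  have "snd c p \<in> W" using W chart_in_image[OF p] by auto
  then obtain r where "r > 0" "cball (snd c p) r \<subseteq> W" using W(1) open_contains_cball by blast
  then show ?thesis using W by (intro that[of r]) auto
qed

lemma finite_area_measure:
  assumes R: "riemannian_surface M" and K: "compact_space (surf_top M)"
  shows "finite_measure (area_measure M)"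
proof (rule finite_measureI)
  note M = riemannian_surface_oriented[OF R]
  let ?X = "surf_top M"
  have "points M \<in> sets (borel_of ?X) \<and> emeasure (area_measure M) (points M) < \<infinity>"
  proof (rule compact_space_induct[OF K, of "\<lambda>U. U \<in> sets (borel_of ?X) \<and> emeasure (area_measure M) U < \<infinity>"])
    fix p assume p: "p \<in> points M"
    obtain c where c: "c \<in> charts_at M p" using ex_charts_at[OF M p] by auto
    note ca = charts_atD[OF c]
    note C = oriented_surfaceD(2)[OF M ca(1)]
    obtain r where r: "0 < r" "cball (snd c p) r \<inter> half_plane \<subseteq> chart_image c" by (rule chart_cball[OF C ca(2)])
    have "compact (cball (snd c p) r \<inter> half_plane)" by (intro compact_Int_closed compact_cball half_plane_closed)
    moreover have "continuous_on (cball (snd c p) r \<inter> half_plane) (\<lambda>x. area_density M c (chart_inv c x))"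
      by (rule continuous_on_subset[OF smooth_on_imp_continuous_on[OF smooth_on_area_density[OF R ca(1)]] r(2)])
    ultimately have "bounded ((\<lambda>x. area_density M c (chart_inv c x)) ` (cball (snd c p) r \<inter> half_plane))"
      by (intro compact_imp_bounded compact_continuous_image)
    then obtain b where b: "\<forall>x\<in>cball (snd c p) r \<inter> half_plane. \<bar>area_density M c (chart_inv c x)\<bar> \<le> b"
      by (auto simp: bounded_iff)
    let ?U = "{q \<in> fst c. snd c q \<in> ball (snd c p) r}"
    have U: "openin ?X ?U" by (rule chart_preimage_openin[OF C open_ball])
    have "emeasure (area_measure M) ?U = (\<integral>\<^sup>+x. ennreal (area_density M c (chart_inv c x)) * indicator (snd c ` ?U) x \<partial>lborel)"
      using emeasure_area_measure[OF R K ca(1) openin_borel_of[OF U]] emeasure_chart_measure[OF R ca(1) openin_borel_of[OF U]] by auto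
    also have "\<dots> \<le> (\<integral>\<^sup>+x. ennreal b * indicator (cball (snd c p) r) x \<partial>lborel)"
    proof (rule nn_integral_mono)
      fix x
      show "ennreal (area_density M c (chart_inv c x)) * indicator (snd c ` ?U) x \<le> ennreal b * indicator (cball (snd c p) r) x"
      proof (cases "x \<in> snd c ` ?U")
        case True
        then have "x \<in> cball (snd c p) r \<inter> half_plane"
          using is_chartD(5)[OF C] by (auto simp: chart_image_def)
        then show ?thesis using b[rule_format, of x] by (auto simp: indicator_def intro!: ennreal_leI)
      qed simp
    qed
    also have "\<dots> = ennreal b * emeasure lborel (cball (snd c p) r)"
      by (simp add: nn_integral_cmult_indicator)
    also have "\<dots> < \<infinity>" using emeasure_lborel_cball_finite[of "snd c p" r] by (simp add: ennreal_mult_less_top)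
    finally show "\<exists>U. openin ?X U \<and> p \<in> U \<and> U \<in> sets (borel_of ?X) \<and> emeasure (area_measure M) U < \<infinity>"
      using U openin_borel_of[OF U] ca(2) r(1) by (intro exI[of _ ?U]) auto
  next
    fix U V
    assume U: "U \<in> sets (borel_of ?X) \<and> emeasure (area_measure M) U < \<infinity>"
      and V: "V \<in> sets (borel_of ?X) \<and> emeasure (area_measure M) V < \<infinity>"
    have "emeasure (area_measure M) (U \<union> V) \<le> emeasure (area_measure M) U + emeasure (area_measure M) V"
      using U V by (intro emeasure_subadditive) (auto simp: sets_area_measure[OF R K])
    also have "\<dots> < \<infinity>" using U V by simp
    finally show "U \<union> V \<in> sets (borel_of ?X) \<and> emeasure (area_measure M) (U \<union> V) < \<infinity>" using U V by auto
  qed simp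
  then show "emeasure (area_measure M) (space (area_measure M)) \<noteq> \<infinity>"
    by (simp add: space_area_measure[OF R K] less_top)
qed

lemma half_plane_contains_ball:
  assumes "openin (top_of_set half_plane) S" "x \<in> S"
  obtains y r where "0 < r" "ball y r \<subseteq> S"
proof -
  obtain W where W: "open W" "S = half_plane \<inter> W" using assms openin_half_plane_iff by auto
  then obtain r where r: "r > 0" "ball x r \<subseteq> W" using assms open_contains_ball by blast
  define y where "y = x + (r/2) *\<^sub>R axis 2 1"
  have "ball y (r/2) \<subseteq> ball x r"
  proof
    fix z assume "z \<in> ball y (r/2)"
    moreover have "dist x y = r/2" using r by (simp add: y_def dist_norm norm_axis_1)
    ultimately show "z \<in> ball x r" using dist_triangle[of x z y] by simp
  qed
  moreover have "z $ 2 \<ge> 0" if "z \<in> ball y (r/2)" for z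
  proof -
    have "\<bar>y $ 2 - z $ 2\<bar> < r/2"
      using that component_le_norm_cart[of "y - z" 2] by (simp add: dist_norm)
    moreover have "y $ 2 = x $ 2 + r/2" by (simp add: y_def axis_def)
    moreover have "0 \<le> x $ 2" using assms W by (simp add: half_plane_def)
    ultimately show ?thesis by linarith
  qed
  ultimately have "ball y (r/2) \<subseteq> S" using W r by (auto simp: half_plane_def)
  then show ?thesis using r by (intro that[of "r/2" y]) auto
qed

text \<open>The image of a chart contains a disc, possibly away from a point of the boundary, and the density is positive there.\<close>

lemma area_measure_pos:
  assumes R: "riemannian_surface M" and K: "compact_space (surf_top M)" and p: "p \<in> points M"
  shows "0 < measure (area_measure M) (points M)"
proof -
  note M = riemannian_surface_oriented[OF R]
  obtain c where c: "c \<in> charts_at M p" using ex_charts_at[OF M p] by auto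
  note ca = charts_atD[OF c]
  note C = oriented_surfaceD(2)[OF M ca(1)]
  obtain y r where r: "0 < r" "ball y r \<subseteq> chart_image c"
    by (rule half_plane_contains_ball[OF is_chartD(4)[OF C] chart_in_image[OF ca(2)]])
  let ?U = "{q \<in> fst c. snd c q \<in> ball y r}"
  have U: "?U \<in> sets (borel_of (surf_top M))" by (rule openin_borel_of[OF chart_preimage_openin[OF C open_ball]])
  have img: "snd c ` ?U = ball y r"
  proof
    show "ball y r \<subseteq> snd c ` ?U"
    proof
      fix x assume x: "x \<in> ball y r"
      then have xc: "x \<in> chart_image c" using r by auto
      then have "x = snd c (chart_inv c x)" "chart_inv c x \<in> ?U"
        using x chart_inv_in[OF xc] by (auto simp: chart_chart_inv[OF xc])
      then show "x \<in> snd c ` ?U" by (rule image_eqI)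
    qed
  qed auto
  have "emeasure (area_measure M) ?U \<noteq> 0"
  proof
    assume "emeasure (area_measure M) ?U = 0"
    then have "(\<integral>\<^sup>+x. ennreal (area_density M c (chart_inv c x)) * indicator (snd c ` ?U) x \<partial>lborel) = 0"
      using emeasure_area_measure[OF R K ca(1) U] emeasure_chart_measure[OF R ca(1) U] by auto
    then have z: "(\<integral>\<^sup>+x. ennreal (indicator (ball y r) x *\<^sub>R area_density M c (chart_inv c x)) \<partial>lborel) = 0"
      unfolding img by (subst nn_integral_cong[of _ _ "\<lambda>x. ennreal (area_density M c (chart_inv c x)) * indicator (ball y r) x"]) (auto simp: indicator_def)
    have m: "(\<lambda>x. indicator (ball y r) x *\<^sub>R area_density M c (chart_inv c x)) \<in> borel_measurable borel"
      by (intro borel_measurable_continuous_on_indicator continuous_on_subset[OF smooth_on_imp_continuous_on[OF smooth_on_area_density[OF R ca(1)]] r(2)]) auto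
    have "AE x in lborel. ennreal (indicator (ball y r) x *\<^sub>R area_density M c (chart_inv c x)) = 0"
      using z m by (subst (asm) nn_integral_0_iff_AE) auto
    then have "AE x in lborel. x \<notin> ball y r"
    proof (rule AE_mp, intro AE_I2 impI notI)
      fix x assume "ennreal (indicator (ball y r) x *\<^sub>R area_density M c (chart_inv c x)) = 0" and x: "x \<in> ball y r"
      then have "area_density M c (chart_inv c x) \<le> 0" by (simp add: ennreal_eq_0_iff)
      moreover have "c \<in> charts_at M (chart_inv c x)" using chart_inv_charts_at[OF ca(1)] x r by blast
      ultimately show False using area_density_pos[OF R] by fastforce
    qed
    then have "emeasure lborel (ball y r) = 0"
      by (subst (asm) AE_iff_measurable[of "ball y r"]) auto
    then have "measure lborel (ball y r) = 0" by (simp add: measure_def)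
    then show False using content_ball_pos[OF r(1), of y] by simp
  qed
  moreover have "emeasure (area_measure M) ?U \<le> emeasure (area_measure M) (points M)"
    using is_chartD(2)[OF C] by (intro emeasure_mono) (auto simp: sets_area_measure[OF R K] openin_borel_of)
  ultimately have "emeasure (area_measure M) (points M) \<noteq> 0" by auto
  then show ?thesis
    using finite_measure.emeasure_eq_measure[OF finite_area_measure[OF R K], of "points M"]
    by (simp add: zero_less_measure_iff)
qed

text \<open>Continuity of a function is tested in coordinates, one point at a time.\<close>

lemma continuous_map_from_charts:
  fixes u :: "'a \<Rightarrow> 'b::topological_space"
  assumes M: "oriented_surface M"
    and loc: "\<And>p. p \<in> points M \<Longrightarrow> \<exists>c S. c \<in> charts_at M p \<and> openin (top_of_set half_plane) S \<and> snd c p \<in> S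
      \<and> S \<subseteq> chart_image c \<and> continuous_on S (\<lambda>x. u (chart_inv c x))"
  shows "continuous_map (surf_top M) euclidean u"
  unfolding continuous_map_def
proof (intro conjI allI impI)
  fix W :: "'b set" assume "openin euclidean W"
  then have W: "open W" by simp
  show "openin (surf_top M) {p \<in> points M. u p \<in> W}"
  proof (subst openin_subopen, intro ballI)
    fix p assume "p \<in> {p \<in> points M. u p \<in> W}"
    then have p: "p \<in> points M" "u p \<in> W" by auto
    from loc[OF p(1)] obtain c S where c: "c \<in> charts_at M p" and S: "openin (top_of_set half_plane) S" "snd c p \<in> S"
      "S \<subseteq> chart_image c" "continuous_on S (\<lambda>x. u (chart_inv c x))" by auto
    note ca = charts_atD[OF c]
    note C = oriented_surfaceD(2)[OF M ca(1)]
    obtain V where V: "open V" "S = half_plane \<inter> V" using S(1) openin_half_plane_iff by auto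
    obtain Y where Y: "open Y" "Y \<inter> S = (\<lambda>x. u (chart_inv c x)) -` W \<inter> S"
      using S(4)[unfolded continuous_on_open_invariant, rule_format, OF W] by auto
    let ?U = "{q \<in> fst c. snd c q \<in> V \<inter> Y}"
    have "openin (surf_top M) ?U" by (rule chart_preimage_openin[OF C open_Int[OF V(1) Y(1)]])
    moreover have "snd c p \<in> Y"
    proof -
      have "snd c p \<in> (\<lambda>x. u (chart_inv c x)) -` W \<inter> S" using p S(2) ca(2) by (simp add: chart_inv_chart[OF C])
      then show ?thesis using Y by blast
    qed
    then have "p \<in> ?U" using ca S(2) V by auto
    moreover have "u q \<in> W" if q: "q \<in> ?U" for q
    proof -
      have "snd c q \<in> half_plane" using q is_chartD(5)[OF C] by (auto simp: chart_image_def)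
      then have "snd c q \<in> Y \<inter> S" using q V by auto
      then have "u (chart_inv c (snd c q)) \<in> W" using Y by blast
      then show ?thesis using q by (simp add: chart_inv_chart[OF C])
    qed
    moreover have "?U \<subseteq> points M" using is_chartD(2)[OF C] by auto
    ultimately show "\<exists>T. openin (surf_top M) T \<and> p \<in> T \<and> T \<subseteq> {p \<in> points M. u p \<in> W}"
      by (intro exI[of _ ?U]) auto
  qed
qed auto

lemma local_dom_subset: "local_dom c d f \<subseteq> chart_image c"
  by (auto simp: local_dom_def chart_image_def)

lemma continuous_map_area_ratio:
  assumes RM: "riemannian_surface M" and RN: "riemannian_surface N" and g: "smooth_map M N g"
  shows "continuous_map (surf_top M) euclidean (area_ratio M N g)"
proof (rule continuous_map_from_charts)
  note M = riemannian_surface_oriented[OF RM] and N = riemannian_surface_oriented[OF RN]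
  show "oriented_surface M" by (rule M)
  fix p assume p: "p \<in> points M"
  obtain c where c: "c \<in> charts_at M p" using ex_charts_at[OF M p] by auto
  obtain d where d: "d \<in> charts_at N (g p)" using ex_charts_at[OF N smooth_mapD(2)[OF g p]] by auto
  note ca = charts_atD[OF c] and da = charts_atD[OF d]
  show "\<exists>c S. c \<in> charts_at M p \<and> openin (top_of_set half_plane) S \<and> snd c p \<in> S
      \<and> S \<subseteq> chart_image c \<and> continuous_on S (\<lambda>x. area_ratio M N g (chart_inv c x))"
    using c local_dom_openin[OF oriented_surfaceD(2)[OF M ca(1)] oriented_surfaceD(2)[OF N da(1)] smooth_mapD(1)[OF g]]
      local_domI[OF ca(2), of g d] da(2) local_dom_subset[of c d g] smooth_on_imp_continuous_on[OF smooth_on_area_ratio[OF RM RN ca(1) da(1) g]]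
    by (intro exI[of _ c] exI[of _ "local_dom c d g"]) auto
qed

text \<open>Inside one chart domain integrals reduce to integrals over a subset of the plane.\<close>

lemma density_chart_domain:
  assumes R: "riemannian_surface M" and K: "compact_space (surf_top M)" and c: "c \<in> atlas M"
  shows "density (area_measure M) (indicator (fst c)) = density (chart_measure M c) (indicator (fst c))"
proof (rule measure_eqI)
  note C = oriented_surfaceD(2)[OF riemannian_surface_oriented[OF R] c]
  have fc: "fst c \<in> sets (borel_of (surf_top M))" by (rule openin_borel_of[OF is_chartD(1)[OF C]])
  fix A assume "A \<in> sets (density (area_measure M) (indicator (fst c)))"
  then have A: "A \<in> sets (borel_of (surf_top M))" by (simp add: sets_area_measure[OF R K])
  then have "fst c \<inter> A \<in> sets (borel_of (surf_top M))" using fc by auto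
  from emeasure_area_measure[OF R K c this]
  show "emeasure (density (area_measure M) (indicator (fst c))) A = emeasure (density (chart_measure M c) (indicator (fst c))) A"
    using A fc by (simp add: emeasure_restricted sets_area_measure[OF R K])
qed (simp add: sets_area_measure[OF R K])

lemma nn_integral_area_chart:
  assumes R: "riemannian_surface M" and K: "compact_space (surf_top M)" and c: "c \<in> atlas M"
    and h: "h \<in> borel_measurable (borel_of (surf_top M))" and z: "\<And>p. p \<in> points M \<Longrightarrow> p \<notin> fst c \<Longrightarrow> h p = 0"
  shows "(\<integral>\<^sup>+p. h p \<partial>area_measure M) = (\<integral>\<^sup>+p. h p \<partial>chart_measure M c)"
proof -
  note C = oriented_surfaceD(2)[OF riemannian_surface_oriented[OF R] c]
  have fc: "fst c \<in> sets (borel_of (surf_top M))" by (rule openin_borel_of[OF is_chartD(1)[OF C]])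
  have m: "h \<in> borel_measurable \<mu>" "fst c \<in> sets \<mu>" if "sets \<mu> = sets (borel_of (surf_top M))" for \<mu>
    using h fc that measurable_cong_sets[OF that refl] by auto
  have "(\<integral>\<^sup>+p. h p \<partial>\<mu>) = (\<integral>\<^sup>+p. h p \<partial>density \<mu> (indicator (fst c)))"
    if s: "sets \<mu> = sets (borel_of (surf_top M))" for \<mu>
  proof -
    have "(\<integral>\<^sup>+p. h p \<partial>density \<mu> (indicator (fst c))) = (\<integral>\<^sup>+p. indicator (fst c) p * h p \<partial>\<mu>)"
      by (rule nn_integral_density) (use m[OF s] in auto)
    also have "\<dots> = (\<integral>\<^sup>+p. h p \<partial>\<mu>)"
      using z sets_eq_imp_space_eq[OF s] by (intro nn_integral_cong) (auto simp: indicator_def)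
    finally show ?thesis by simp
  qed
  from this[of "area_measure M"] this[of "chart_measure M c"] show ?thesis
    by (simp add: sets_area_measure[OF R K] density_chart_domain[OF R K c])
qed

lemma integral_area_chart:
  fixes h :: "'a \<Rightarrow> real"
  assumes R: "riemannian_surface M" and K: "compact_space (surf_top M)" and c: "c \<in> atlas M"
    and h: "h \<in> borel_measurable (borel_of (surf_top M))" and z: "\<And>p. p \<in> points M \<Longrightarrow> p \<notin> fst c \<Longrightarrow> h p = 0"
  shows "(\<integral>p. h p \<partial>area_measure M) =
    (\<integral>x. indicator (chart_image c) x *\<^sub>R (area_density M c (chart_inv c x) * h (chart_inv c x)) \<partial>lborel)"
proof -
  note C = oriented_surfaceD(2)[OF riemannian_surface_oriented[OF R] c]
  have fc: "fst c \<in> sets (borel_of (surf_top M))" by (rule openin_borel_of[OF is_chartD(1)[OF C]])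
  have m: "h \<in> borel_measurable \<mu>" "fst c \<in> sets \<mu>" if "sets \<mu> = sets (borel_of (surf_top M))" for \<mu>
    using h fc that measurable_cong_sets[OF that refl] by auto
  have "(\<integral>p. h p \<partial>\<mu>) = (\<integral>p. h p \<partial>density \<mu> (indicator (fst c)))"
    if s: "sets \<mu> = sets (borel_of (surf_top M))" for \<mu>
  proof -
    have "(\<integral>p. h p \<partial>density \<mu> (\<lambda>p. ennreal (indicator (fst c) p))) = (\<integral>p. indicator (fst c) p *\<^sub>R h p \<partial>\<mu>)"
      by (rule integral_density) (use m[OF s] in auto)
    also have "\<dots> = (\<integral>p. h p \<partial>\<mu>)"
      using z sets_eq_imp_space_eq[OF s] by (intro Bochner_Integration.integral_cong) (auto simp: indicator_def)
    finally show ?thesis by (simp add: ennreal_indicator)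
  qed
  from this[of "area_measure M"] this[of "chart_measure M c"]
  have "(\<integral>p. h p \<partial>area_measure M) = (\<integral>p. h p \<partial>chart_measure M c)"
    by (simp add: sets_area_measure[OF R K] density_chart_domain[OF R K c])
  have s: "sets (restrict_space lborel (chart_image c)) = sets (restrict_space borel (chart_image c))"
    by (simp add: sets_restrict_space)
  have m1: "chart_inv c \<in> measurable (restrict_space lborel (chart_image c)) (borel_of (surf_top M))"
    using chart_inv_measurable[OF C] measurable_cong_sets[OF s refl] by blast
  have m2: "(\<lambda>x. area_density M c (chart_inv c x)) \<in> borel_measurable (restrict_space lborel (chart_image c))"
    using area_density_measurable[OF R c] measurable_cong_sets[OF s refl] by blast
  have m3: "(\<lambda>x. h (chart_inv c x)) \<in> borel_measurable (restrict_space lborel (chart_image c))"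
    by (rule measurable_compose[OF m1 h])
  have "(\<integral>p. h p \<partial>chart_measure M c) = (\<integral>x. h (chart_inv c x) \<partial>density (restrict_space lborel (chart_image c)) (\<lambda>x. ennreal (area_density M c (chart_inv c x))))"
    unfolding chart_measure_def by (rule integral_distr) (use m1 h in simp_all)
  also have "\<dots> = (\<integral>x. area_density M c (chart_inv c x) *\<^sub>R h (chart_inv c x) \<partial>restrict_space lborel (chart_image c))"
  proof (rule integral_density)
    show "AE x in restrict_space lborel (chart_image c). 0 \<le> area_density M c (chart_inv c x)"
      using area_density_pos[OF R chart_inv_charts_at[OF c]]
      by (intro AE_I2) (auto simp: space_restrict_space intro!: less_imp_le)
  qed (use m2 m3 in auto)
  also have "\<dots> = (\<integral>x. indicator (chart_image c) x *\<^sub>R (area_density M c (chart_inv c x) *\<^sub>R h (chart_inv c x)) \<partial>lborel)"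
    by (rule integral_restrict_space) (use chart_image_borel[OF C] in auto)
  finally show ?thesis using \<open>(\<integral>p. h p \<partial>area_measure M) = (\<integral>p. h p \<partial>chart_measure M c)\<close> by simp
qed

text \<open>The defining relation $f^* dA_h = J_f\, dA_g$, for measures: both sides agree on Borel sets
  lying in one chart domain whose image lies in one chart domain, by substitution.\<close>

theorem area_measure_pullback:
  assumes RM: "riemannian_surface M" and KM: "compact_space (surf_top M)"
    and RN: "riemannian_surface N" and KN: "compact_space (surf_top N)"
    and g: "smooth_map M N g" and h: "continuous_map (surf_top N) (surf_top M) h"
    and hg: "\<And>p. p \<in> points M \<Longrightarrow> h (g p) = p" and gh: "\<And>q. q \<in> points N \<Longrightarrow> g (h q) = q"
    and pos: "\<And>p. p \<in> points M \<Longrightarrow> 0 \<le> area_ratio M N g p"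
  shows "density (area_measure M) (\<lambda>p. ennreal (area_ratio M N g p)) = distr (area_measure N) (borel_of (surf_top M)) h"
proof (rule measure_eqI_open_cover[OF KM, where \<U> = "{U. \<exists>c\<in>atlas M. \<exists>d\<in>atlas N. U = {p \<in> fst c. g p \<in> fst d}}"])
  note M = riemannian_surface_oriented[OF RM] and N = riemannian_surface_oriented[OF RN]
  let ?X = "surf_top M" and ?Y = "surf_top N"
  show "sets (density (area_measure M) (\<lambda>p. ennreal (area_ratio M N g p))) = sets (borel_of ?X)"
    by (simp add: sets_area_measure[OF RM KM])
  show "sets (distr (area_measure N) (borel_of ?X) h) = sets (borel_of ?X)" by simp
  show "\<exists>U\<in>{U. \<exists>c\<in>atlas M. \<exists>d\<in>atlas N. U = {p \<in> fst c. g p \<in> fst d}}. p \<in> U" if p: "p \<in> topspace ?X" for p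
  proof -
    obtain c where c: "c \<in> charts_at M p" using ex_charts_at[OF M p] by auto
    obtain d where d: "d \<in> charts_at N (g p)" using ex_charts_at[OF N smooth_mapD(2)[OF g p]] by auto
    show ?thesis using charts_atD[OF c] charts_atD[OF d] p
      by (intro bexI[of _ "{p \<in> fst c. g p \<in> fst d}"]) auto
  qed
  show "openin ?X U" if *: "U \<in> {U. \<exists>c\<in>atlas M. \<exists>d\<in>atlas N. U = {p \<in> fst c. g p \<in> fst d}}" for U
  proof -
    obtain c d where c: "c \<in> atlas M" and d: "d \<in> atlas N" and U: "U = {p \<in> fst c. g p \<in> fst d}" using * by blast
    note C = oriented_surfaceD(2)[OF M c] and D = oriented_surfaceD(2)[OF N d]
    have "openin ?X (fst c \<inter> {p \<in> points M. g p \<in> fst d})"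
      by (intro openin_Int is_chartD(1)[OF C] openin_continuous_map_preimage[OF smooth_mapD(1)[OF g] is_chartD(1)[OF D]])
    moreover have "fst c \<inter> {p \<in> points M. g p \<in> fst d} = U" using is_chartD(2)[OF C] U by auto
    ultimately show ?thesis by simp
  qed
  have hm: "h \<in> measurable (area_measure N) (borel_of ?X)"
    using continuous_map_measurable[OF h] measurable_cong_sets[OF sets_area_measure[OF RN KN] refl] by blast
  have Jm: "area_ratio M N g \<in> borel_measurable (borel_of ?X)"
    by (rule continuous_map_borel_measurable[OF continuous_map_area_ratio[OF RM RN g]])
  have Jm': "(\<lambda>p. ennreal (area_ratio M N g p)) \<in> borel_measurable (area_measure M)"
    using measurable_compose[OF Jm measurable_ennreal] unfolding measurable_cong_sets[OF sets_area_measure[OF RM KM] refl] .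
  fix U B assume "U \<in> {U. \<exists>c\<in>atlas M. \<exists>d\<in>atlas N. U = {p \<in> fst c. g p \<in> fst d}}"
    and B: "B \<in> sets (borel_of ?X)" "B \<subseteq> U"
  then obtain c d where c: "c \<in> atlas M" and d: "d \<in> atlas N" and U: "U = {p \<in> fst c. g p \<in> fst d}" by blast
  note C = oriented_surfaceD(2)[OF M c] and D = oriented_surfaceD(2)[OF N d]
  have Bc: "B \<subseteq> fst c" "g ` B \<subseteq> fst d" "B \<subseteq> points M" using B U is_chartD(2)[OF C] by auto
  have gB: "h -` B \<inter> points N = g ` B"
  proof
    show "h -` B \<inter> points N \<subseteq> g ` B" using gh by (metis IntE image_eqI subsetI vimageE)
    show "g ` B \<subseteq> h -` B \<inter> points N" using hg smooth_mapD(2)[OF g] Bc(3) by auto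
  qed
  have gBm: "g ` B \<in> sets (borel_of ?Y)"
    using measurable_sets[OF continuous_map_measurable[OF h] B(1)] gB by simp
  have ind: "(\<lambda>p. ennreal (area_ratio M N g p) * indicator B p) \<in> borel_measurable (borel_of ?X)"
    using Jm B(1) by measurable
  have "emeasure (density (area_measure M) (\<lambda>p. ennreal (area_ratio M N g p))) B
      = (\<integral>\<^sup>+p. ennreal (area_ratio M N g p) * indicator B p \<partial>area_measure M)"
    by (rule emeasure_density) (use Jm' B(1) in \<open>auto simp: sets_area_measure[OF RM KM]\<close>)
  also have "\<dots> = (\<integral>\<^sup>+p. ennreal (area_ratio M N g p) * indicator B p \<partial>chart_measure M c)"
    by (rule nn_integral_area_chart[OF RM KM c ind]) (use Bc in \<open>auto simp: indicator_def\<close>)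
  also have "\<dots> = (\<integral>\<^sup>+x. (ennreal (area_density M c (chart_inv c x)) * (ennreal (area_ratio M N g (chart_inv c x)) * indicator B (chart_inv c x))) * indicator (chart_image c) x \<partial>lborel)"
    by (rule nn_integral_chart_measure[OF RM c ind])
  also have "\<dots> = (\<integral>\<^sup>+x. ennreal (area_ratio M N g (chart_inv c x) * area_density M c (chart_inv c x)) * indicator (snd c ` B) x \<partial>lborel)"
  proof (rule nn_integral_cong)
    fix x
    show "(ennreal (area_density M c (chart_inv c x)) * (ennreal (area_ratio M N g (chart_inv c x)) * indicator B (chart_inv c x))) * indicator (chart_image c) x
      = ennreal (area_ratio M N g (chart_inv c x) * area_density M c (chart_inv c x)) * indicator (snd c ` B) x"
    proof (cases "x \<in> snd c ` B")
      case True
      then have x: "x \<in> chart_image c" "chart_inv c x \<in> B"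
        using chart_image_measurable(2)[OF C B(1) Bc(1)] by blast+
      then have "0 \<le> area_ratio M N g (chart_inv c x)" using pos Bc by blast
      then show ?thesis using True x by (simp add: ennreal_mult'' mult.commute)
    next
      case False
      then have "x \<notin> chart_image c \<or> chart_inv c x \<notin> B"
        using chart_image_measurable(2)[OF C B(1) Bc(1)] by blast
      then show ?thesis using False by auto
    qed
  qed
  also have "\<dots> = emeasure (chart_measure N d) (g ` B)"
  proof (rule chart_change_of_variables[OF RM RN g c d B(1) Bc(1) gBm Bc(2)])
    show "inj_on g B" by (rule inj_on_inverseI[of _ h]) (use Bc(3) hg in auto)
  qed (use Bc(3) pos in auto)
  also have "\<dots> = emeasure (area_measure N) (g ` B)"
    by (rule emeasure_area_measure[OF RN KN d gBm Bc(2), symmetric])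
  also have "\<dots> = emeasure (distr (area_measure N) (borel_of ?X) h) B"
    using emeasure_distr[OF hm B(1)] gB by (simp add: space_area_measure[OF RN KN])
  finally show "emeasure (density (area_measure M) (\<lambda>p. ennreal (area_ratio M N g p))) B
      = emeasure (distr (area_measure N) (borel_of ?X) h) B" .
qed

corollary integral_pullback:
  fixes k :: "'b \<Rightarrow> real"
  assumes RM: "riemannian_surface M" and KM: "compact_space (surf_top M)"
    and RN: "riemannian_surface N" and KN: "compact_space (surf_top N)"
    and g: "smooth_map M N g" and h: "continuous_map (surf_top N) (surf_top M) h"
    and hg: "\<And>p. p \<in> points M \<Longrightarrow> h (g p) = p" and gh: "\<And>q. q \<in> points N \<Longrightarrow> g (h q) = q"
    and pos: "\<And>p. p \<in> points M \<Longrightarrow> 0 \<le> area_ratio M N g p"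
    and k: "k \<in> borel_measurable (borel_of (surf_top N))"
  shows "(\<integral>p. area_ratio M N g p * k (g p) \<partial>area_measure M) = (\<integral>q. k q \<partial>area_measure N)"
proof -
  let ?X = "surf_top M" and ?Y = "surf_top N"
  have cM: "measurable (area_measure M) borel = measurable (borel_of ?X) borel"
    by (rule measurable_cong_sets[OF sets_area_measure[OF RM KM] refl])
  have kg: "(\<lambda>p. k (g p)) \<in> borel_measurable (borel_of ?X)"
    by (rule measurable_compose[OF continuous_map_measurable[OF smooth_mapD(1)[OF g]] k])
  have hm: "h \<in> measurable (area_measure N) (borel_of ?X)"
    using continuous_map_measurable[OF h] measurable_cong_sets[OF sets_area_measure[OF RN KN] refl] by blast
  have "(\<integral>p. area_ratio M N g p *\<^sub>R k (g p) \<partial>area_measure M)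
      = (\<integral>p. k (g p) \<partial>density (area_measure M) (\<lambda>p. ennreal (area_ratio M N g p)))"
    by (rule integral_density[symmetric])
       (use kg cM pos continuous_map_borel_measurable[OF continuous_map_area_ratio[OF RM RN g]] in \<open>auto simp: space_area_measure[OF RM KM]\<close>)
  also have "\<dots> = (\<integral>p. k (g p) \<partial>distr (area_measure N) (borel_of ?X) h)"
    by (simp add: area_measure_pullback[OF RM KM RN KN g h hg gh pos])
  also have "\<dots> = (\<integral>q. k (g (h q)) \<partial>area_measure N)"
    by (rule integral_distr[OF hm kg])
  also have "\<dots> = (\<integral>q. k q \<partial>area_measure N)"
    by (rule Bochner_Integration.integral_cong) (auto simp: gh space_area_measure[OF RN KN])
  finally show ?thesis by simp
qed


section \<open>Differentiation along a flow\<close>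

lemma smooth_map_time_slice:
  assumes cont: "continuous_map (prod_topology (top_of_set T) (surf_top N)) (surf_top N) (\<lambda>(t, q). \<phi> t q)"
    and sm: "\<And>c d. c \<in> atlas N \<Longrightarrow> d \<in> atlas N \<Longrightarrow>
      smooth_on {(t, x). t \<in> T \<and> x \<in> local_dom c d (\<phi> t)} (\<lambda>(t::real, x). local_rep c d (\<phi> t) x)"
    and t: "t \<in> T"
  shows "smooth_map N N (\<phi> t)"
  unfolding smooth_map_def
proof (intro conjI ballI)
  have "continuous_map (surf_top N) (prod_topology (top_of_set T) (surf_top N)) (\<lambda>q. (t, q))"
    using t by (intro continuous_map_pairedI) auto
  from continuous_map_compose[OF this cont]
  show "continuous_map (surf_top N) (surf_top N) (\<phi> t)" by (simp add: o_def)
  fix c d assume cd: "c \<in> atlas N" "d \<in> atlas N"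
  have "smooth_on (local_dom c d (\<phi> t)) (\<lambda>x. (t, x))"
    by (rule smooth_on_Pair[OF smooth_on_const smooth_on_id])
  from smooth_on_compose[OF sm[OF cd] this] t
  show "smooth_on (local_dom c d (\<phi> t)) (local_rep c d (\<phi> t))" by (auto simp: image_subset_iff)
qed

lemma local_flowE:
  assumes N: "oriented_surface N" and flow: "local_flow N V \<phi>"
  obtains \<epsilon> where "0 < \<epsilon>"
    and "continuous_map (prod_topology (top_of_set {-\<epsilon><..<\<epsilon>}) (surf_top N)) (surf_top N) (\<lambda>(t, q). \<phi> t q)"
    and "\<And>c d. c \<in> atlas N \<Longrightarrow> d \<in> atlas N \<Longrightarrow>
      smooth_on {(t, x). t \<in> {-\<epsilon><..<\<epsilon>} \<and> x \<in> local_dom c d (\<phi> t)} (\<lambda>(t, x). local_rep c d (\<phi> t) x)"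
    and "\<And>q. q \<in> points N \<Longrightarrow> \<phi> 0 q = q"
    and "\<And>t q d. t \<in> {-\<epsilon><..<\<epsilon>} \<Longrightarrow> q \<in> points N \<Longrightarrow> d \<in> charts_at N (\<phi> t q) \<Longrightarrow>
      ((\<lambda>s. snd d (\<phi> s q)) has_vector_derivative V (\<phi> t q) d) (at t)"
    and "\<And>t. t \<in> {-\<epsilon><..<\<epsilon>} \<Longrightarrow> smooth_map N N (\<phi> t)"
proof -
  from flow obtain \<epsilon> where e: "\<epsilon> > 0"
    and cont: "continuous_map (prod_topology (top_of_set {-\<epsilon><..<\<epsilon>}) (surf_top N)) (surf_top N) (\<lambda>(t, q). \<phi> t q)"
    and sm: "\<forall>c\<in>atlas N. \<forall>d\<in>atlas N.
        smooth_on {(t, x). t \<in> {-\<epsilon><..<\<epsilon>} \<and> x \<in> local_dom c d (\<phi> t)} (\<lambda>(t, x). local_rep c d (\<phi> t) x)"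
    and init: "\<forall>q\<in>points N. \<phi> 0 q = q"
    and ode: "\<forall>t\<in>{-\<epsilon><..<\<epsilon>}. \<forall>q\<in>points N. \<forall>d\<in>charts_at N (\<phi> t q).
        ((\<lambda>s. snd d (\<phi> s q)) has_vector_derivative V (\<phi> t q) d) (at t)"
    unfolding local_flow_def by (elim exE conjE)
  have "smooth_map N N (\<phi> t)" if t: "t \<in> {-\<epsilon><..<\<epsilon>}" for t
    by (rule smooth_map_time_slice[OF cont _ t]) (use sm in auto)
  with e cont sm init ode show ?thesis by (intro that[of \<epsilon>]) auto
qed

text \<open>The area ratio at a point depends on the germ of the map only.\<close>

lemma area_ratio_cong:
  assumes RM: "riemannian_surface M" and RN: "riemannian_surface N"
    and f: "smooth_map M N f" and g: "smooth_map M N g"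
    and U: "openin (surf_top M) U" "p \<in> U" "\<And>q. q \<in> U \<Longrightarrow> f q = g q"
  shows "area_ratio M N f p = area_ratio M N g p"
proof -
  note M = riemannian_surface_oriented[OF RM] and N = riemannian_surface_oriented[OF RN]
  have p: "p \<in> points M" using U openin_subset by blast
  obtain c where c: "c \<in> charts_at M p" using ex_charts_at[OF M p] by auto
  obtain d where d: "d \<in> charts_at N (f p)" using ex_charts_at[OF N smooth_mapD(2)[OF f p]] by auto
  have fg: "f p = g p" using U by auto
  then have d': "d \<in> charts_at N (g p)" using d by simp
  note ca = charts_atD[OF c]
  note C = oriented_surfaceD(2)[OF M ca(1)] and D = oriented_surfaceD(2)[OF N charts_atD(1)[OF d]]
  let ?T = "local_dom c d f \<inter> snd c ` (fst c \<inter> U)"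
  have xT: "snd c p \<in> ?T" using ca U(2) charts_atD(2)[OF d] by (auto intro: local_domI)
  have mem: "\<exists>q. q \<in> fst c \<and> q \<in> U \<and> f q \<in> fst d \<and> x = snd c q" if x: "x \<in> ?T" for x
  proof -
    obtain q where q: "q \<in> fst c" "q \<in> U" "x = snd c q" using x by auto
    moreover have "f q \<in> fst d" using x q local_dom_iff[OF C, of x d f] by (simp add: chart_inv_chart[OF C])
    ultimately show ?thesis by auto
  qed
  have "local_deriv c d f p = local_deriv c d g p"
  proof (rule local_deriv_eqI[OF f c d _ xT])
    show "openin (top_of_set half_plane) ?T"
      by (intro openin_Int local_dom_openin[OF C D smooth_mapD(1)[OF f]] chart_image_openin[OF C] U(1) is_chartD(1)[OF C]) auto
    have "?T \<subseteq> local_dom c d g"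
    proof
      fix x assume "x \<in> ?T"
      from mem[OF this] obtain q where "q \<in> fst c" "q \<in> U" "f q \<in> fst d" "x = snd c q" by auto
      then show "x \<in> local_dom c d g" using U(3) by (auto intro: local_domI)
    qed
    from has_derivative_subset[OF smooth_map_local_deriv[OF g c d'] this]
    show "(local_rep c d f has_derivative local_deriv c d g p) (at (snd c p) within ?T)"
    proof (rule has_derivative_transform[OF xT, rotated])
      fix x assume "x \<in> ?T"
      from mem[OF this] obtain q where "q \<in> fst c" "q \<in> U" "x = snd c q" by auto
      then show "local_rep c d f x = local_rep c d g x" using U(3) by (simp add: local_rep_apply[OF C])
    qed
  qed auto
  then show ?thesis
    by (simp add: area_ratio_eq[OF RM RN f c d] area_ratio_eq[OF RM RN g c d'] fg)
qed

lemma flow_area_ratio_0: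
  assumes RN: "riemannian_surface N" and flow: "local_flow N V \<phi>" and q: "q \<in> points N"
  shows "area_ratio N N (\<phi> 0) q = 1"
proof -
  note N = riemannian_surface_oriented[OF RN]
  obtain \<epsilon> where e: "0 < \<epsilon>" "\<And>q. q \<in> points N \<Longrightarrow> \<phi> 0 q = q" "\<And>t. t \<in> {-\<epsilon><..<\<epsilon>} \<Longrightarrow> smooth_map N N (\<phi> t)"
    by (rule local_flowE[OF N flow]) (rule that)
  have "area_ratio N N (\<phi> 0) q = area_ratio N N id q"
    by (rule area_ratio_cong[OF RN RN e(3) oriented_surfaceD(4)[OF N] openin_topspace q]) (use e in auto)
  then show ?thesis using area_ratio_id[OF RN q] by simp
qed

text \<open>In coordinates the area ratio of \<open>\<phi>\<^sub>t\<close> is a smooth function \<open>A\<close> of time and place on a neighbourhood of the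
  given point at time zero; its time derivative is bounded on a compact ball. Joint continuity
  of the flow keeps \<open>\<phi>\<^sub>t q\<close> in the chart for short times and nearby \<open>q\<close>.\<close>

lemma flow_area_ratio_local:
  assumes RN: "riemannian_surface N" and flow: "local_flow N V \<phi>" and q0: "q0 \<in> points N"
  shows "\<exists>U \<delta> C. openin (surf_top N) U \<and> q0 \<in> U \<and> 0 < \<delta> \<and> 0 \<le> C \<and>
    (\<forall>q\<in>U. \<forall>t. \<bar>t\<bar> < \<delta> \<longrightarrow> \<bar>area_ratio N N (\<phi> t) q - 1\<bar> \<le> C * \<bar>t\<bar>) \<and>
    (\<forall>q\<in>U. \<exists>D. ((\<lambda>t. area_ratio N N (\<phi> t) q) has_real_derivative D) (at 0))"
proof -
  note N = riemannian_surface_oriented[OF RN]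
  let ?X = "surf_top N"
  obtain \<epsilon> where e: "0 < \<epsilon>"
    and cont: "continuous_map (prod_topology (top_of_set {-\<epsilon><..<\<epsilon>}) ?X) ?X (\<lambda>(t, q). \<phi> t q)"
    and sm: "\<And>c d. c \<in> atlas N \<Longrightarrow> d \<in> atlas N \<Longrightarrow>
      smooth_on {(t, x). t \<in> {-\<epsilon><..<\<epsilon>} \<and> x \<in> local_dom c d (\<phi> t)} (\<lambda>(t, x). local_rep c d (\<phi> t) x)"
    and init: "\<And>q. q \<in> points N \<Longrightarrow> \<phi> 0 q = q"
    and smt: "\<And>t. t \<in> {-\<epsilon><..<\<epsilon>} \<Longrightarrow> smooth_map N N (\<phi> t)"
    by (rule local_flowE[OF N flow]) (rule that)
  obtain d where d: "d \<in> charts_at N q0" using ex_charts_at[OF N q0] by auto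
  note da = charts_atD[OF d]
  note D = oriented_surfaceD(2)[OF N da(1)]
  define x0 where "x0 = snd d q0"
  define S where "S = {(t, x). t \<in> {-\<epsilon><..<\<epsilon>} \<and> x \<in> local_dom d d (\<phi> t)}"
  have aS: "smooth_on S (\<lambda>(t, x). area_ratio N N (\<phi> t) (chart_inv d x))"
    unfolding S_def by (rule smooth_on_area_ratio_family[OF RN RN da(1) da(1) smt sm[OF da(1) da(1)]])
  have z0: "(0, x0) \<in> S" using e da init[OF q0] by (auto simp: S_def x0_def intro: local_domI)
  obtain U0 A where U0: "open U0" "(0, x0) \<in> U0" "\<And>k. Ck_on_open k U0 A"
    "\<And>y. y \<in> U0 \<Longrightarrow> y \<in> S \<Longrightarrow> A y = (\<lambda>(t, x). area_ratio N N (\<phi> t) (chart_inv d x)) y"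
    by (rule smooth_onE[OF aS z0]) (rule that)
  obtain r where r: "r > 0" "cball (0, x0) r \<subseteq> U0" using U0(1,2) open_contains_cball by blast
  define B where "B y = frechet_derivative A (at y) (1, 0)" for y
  have "Ck_on_open 0 U0 B" using U0(3)[of "Suc 0"] unfolding B_def by (simp only: Ck_on_open.simps(2))
  then have "continuous_on (cball (0, x0) r) B" using r(2) continuous_on_subset by auto
  then have "bounded (B ` cball (0, x0) r)" by (intro compact_imp_bounded compact_continuous_image compact_cball)
  then obtain C where C: "\<forall>y\<in>cball (0, x0) r. \<bar>B y\<bar> \<le> C" by (auto simp: bounded_iff)
  have C0: "0 \<le> C"
  proof -
    have "(0, x0) \<in> cball (0::real, x0) r" using r by simp
    then have "\<bar>B (0, x0)\<bar> \<le> C" using C by blast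
    then show ?thesis by linarith
  qed
  have derA: "((\<lambda>s. A (s, x)) has_real_derivative B (t, x)) (at t)" if tx: "(t, x) \<in> cball (0, x0) r" for t x
  proof -
    have "(A has_derivative frechet_derivative A (at (t, x))) (at (t, x))"
      using Ck_on_open_has_derivative[OF U0(3)[of "Suc 0"]] tx r by blast
    from has_derivative_compose[OF has_derivative_Pair[OF has_derivative_ident has_derivative_const] this]
    have 1: "((\<lambda>s. A (s, x)) has_derivative (\<lambda>h. frechet_derivative A (at (t, x)) (h, 0))) (at t)" .
    have lin: "linear (frechet_derivative A (at (t, x)))"
      using \<open>(A has_derivative frechet_derivative A (at (t, x))) (at (t, x))\<close> by (rule has_derivative_linear)
    have "frechet_derivative A (at (t, x)) (h, 0) = h * B (t, x)" for h
      using linear_scale[OF lin, of h "(1, 0)"] by (simp add: B_def)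
    moreover have "(\<lambda>h. h * B (t, x)) = (*) (B (t, x))" by (simp add: fun_eq_iff mult.commute)
    ultimately show ?thesis using 1 by (simp add: has_field_derivative_def)
  qed
  have "openin (prod_topology (top_of_set {-\<epsilon><..<\<epsilon>}) ?X)
      {z \<in> topspace (prod_topology (top_of_set {-\<epsilon><..<\<epsilon>}) ?X). (\<lambda>(t, q). \<phi> t q) z \<in> fst d}"
    by (rule openin_continuous_map_preimage[OF cont is_chartD(1)[OF D]])
  moreover have "(0, q0) \<in> {z \<in> topspace (prod_topology (top_of_set {-\<epsilon><..<\<epsilon>}) ?X). (\<lambda>(t, q). \<phi> t q) z \<in> fst d}"
    using e q0 init[OF q0] da by auto
  ultimately obtain T1 V1 where TV: "openin (top_of_set {-\<epsilon><..<\<epsilon>}) T1" "openin ?X V1" "0 \<in> T1" "q0 \<in> V1"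
    "T1 \<times> V1 \<subseteq> {z \<in> topspace (prod_topology (top_of_set {-\<epsilon><..<\<epsilon>}) ?X). (\<lambda>(t, q). \<phi> t q) z \<in> fst d}"
    unfolding openin_prod_topology_alt by meson
  have "open T1" using TV(1) by (simp add: openin_open_eq)
  then obtain \<delta>1 where d1: "\<delta>1 > 0" "ball 0 \<delta>1 \<subseteq> T1" using TV(3) open_contains_ball by blast
  define \<delta> where "\<delta> = min \<delta>1 (r/2)"
  have d0: "0 < \<delta>" using d1 r by (simp add: \<delta>_def)
  define U where "U = V1 \<inter> {q \<in> fst d. snd d q \<in> ball x0 (r/2)}"
  have U: "openin ?X U" unfolding U_def by (intro openin_Int TV(2) chart_preimage_openin[OF D open_ball])
  have q0U: "q0 \<in> U" using TV(4) da r by (simp add: U_def x0_def)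
  have ball: "(t, snd d q) \<in> cball (0, x0) r" if "q \<in> U" "\<bar>t\<bar> < \<delta>" for t q
  proof -
    have "dist (0, x0) (t, snd d q) \<le> dist 0 t + dist x0 (snd d q)"
      using sqrt_sum_squares_le_sum_abs[of t "dist x0 (snd d q)"] by (simp add: dist_Pair_Pair)
    also have "\<dots> \<le> r" using that by (simp add: U_def \<delta>_def)
    finally show ?thesis by simp
  qed
  have aA: "area_ratio N N (\<phi> t) q = A (t, snd d q)" if q: "q \<in> U" and t: "\<bar>t\<bar> < \<delta>" for t q
  proof -
    have "t \<in> T1" using t d1(2) by (auto simp: \<delta>_def)
    moreover have "q \<in> V1" "q \<in> fst d" using q by (auto simp: U_def)
    ultimately have "(t, q) \<in> topspace (prod_topology (top_of_set {-\<epsilon><..<\<epsilon>}) ?X)" "\<phi> t q \<in> fst d"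
      using TV(5) by auto
    then have "(t, snd d q) \<in> S" using \<open>q \<in> fst d\<close> by (auto simp: S_def intro: local_domI)
    then show ?thesis using U0(4)[of "(t, snd d q)"] ball[OF q t] r(2) \<open>q \<in> fst d\<close> by (auto simp: chart_inv_chart[OF D])
  qed
  have one: "A (0, snd d q) = 1" if q: "q \<in> U" for q
    using aA[OF q, of 0] d0 flow_area_ratio_0[OF RN flow, of q] q openin_subset[OF U] by auto
  have "\<bar>area_ratio N N (\<phi> t) q - 1\<bar> \<le> C * \<bar>t\<bar>" if q: "q \<in> U" and t: "\<bar>t\<bar> < \<delta>" for q t
  proof -
    have "norm (A (t, snd d q) - A (0, snd d q)) \<le> C * norm (t - 0)"
    proof (rule field_differentiable_bound[of "{-\<delta><..<\<delta>}"])
      fix s assume "s \<in> {-\<delta><..<\<delta>}"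
      then have "\<bar>s\<bar> < \<delta>" by auto
      then have s: "(s, snd d q) \<in> cball (0, x0) r" by (rule ball[OF q])
      show "((\<lambda>s. A (s, snd d q)) has_field_derivative B (s, snd d q)) (at s within {-\<delta><..<\<delta>})"
        using derA[OF s] by (rule has_field_derivative_at_within)
      show "norm (B (s, snd d q)) \<le> C" using C s by auto
    qed (use t in auto)
    then show ?thesis using aA[OF q t] one[OF q] by simp
  qed
  moreover have "\<exists>D. ((\<lambda>t. area_ratio N N (\<phi> t) q) has_real_derivative D) (at 0)" if q: "q \<in> U" for q
  proof -
    have "((\<lambda>s. A (s, snd d q)) has_real_derivative B (0, snd d q)) (at 0)"
      by (rule derA) (rule ball[OF q], use d0 in simp)
    then have "((\<lambda>t. area_ratio N N (\<phi> t) q) has_real_derivative B (0, snd d q)) (at 0)"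
      by (rule has_field_derivative_transform_within_open[where S="{-\<delta><..<\<delta>}"]) (use d0 aA[OF q] in auto)
    then show ?thesis by blast
  qed
  ultimately show ?thesis using U q0U d0 C0 by (intro exI[of _ U] exI[of _ \<delta>] exI[of _ C]) auto
qed

lemma flow_area_ratio_differentiable:
  assumes "riemannian_surface N" "local_flow N V \<phi>" "q \<in> points N"
  shows "\<exists>D. ((\<lambda>t. area_ratio N N (\<phi> t) q) has_real_derivative D) (at 0)"
  using flow_area_ratio_local[OF assms] by auto

lemma flow_area_ratio_uniform:
  assumes RN: "riemannian_surface N" and KN: "compact_space (surf_top N)" and flow: "local_flow N V \<phi>"
  obtains \<delta> C where "0 < \<delta>" "0 \<le> C"
    "\<And>q t. q \<in> points N \<Longrightarrow> \<bar>t\<bar> < \<delta> \<Longrightarrow> \<bar>area_ratio N N (\<phi> t) q - 1\<bar> \<le> C * \<bar>t\<bar>"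
proof -
  have "\<exists>\<delta>>0. \<exists>C\<ge>0. \<forall>q\<in>points N. \<forall>t. \<bar>t\<bar> < \<delta> \<longrightarrow> \<bar>area_ratio N N (\<phi> t) q - 1\<bar> \<le> C * \<bar>t\<bar>"
  proof (rule compact_space_induct[OF KN])
    fix q assume "q \<in> points N"
    from flow_area_ratio_local[OF RN flow this]
    show "\<exists>U. openin (surf_top N) U \<and> q \<in> U \<and>
        (\<exists>\<delta>>0. \<exists>C\<ge>0. \<forall>q\<in>U. \<forall>t. \<bar>t\<bar> < \<delta> \<longrightarrow> \<bar>area_ratio N N (\<phi> t) q - 1\<bar> \<le> C * \<bar>t\<bar>)" by meson
  next
    show "\<exists>\<delta>>0. \<exists>C\<ge>0. \<forall>q\<in>{}. \<forall>t. \<bar>t\<bar> < \<delta> \<longrightarrow> \<bar>area_ratio N N (\<phi> t) q - 1\<bar> \<le> C * \<bar>t\<bar>"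
      by (intro exI[of _ 1] exI[of _ 0]) auto
  next
    fix U V :: "'a set"
    assume "\<exists>\<delta>>0. \<exists>C\<ge>0. \<forall>q\<in>U. \<forall>t. \<bar>t\<bar> < \<delta> \<longrightarrow> \<bar>area_ratio N N (\<phi> t) q - 1\<bar> \<le> C * \<bar>t\<bar>"
    then obtain a A where a: "a > 0" "A \<ge> 0" "\<forall>q\<in>U. \<forall>t. \<bar>t\<bar> < a \<longrightarrow> \<bar>area_ratio N N (\<phi> t) q - 1\<bar> \<le> A * \<bar>t\<bar>" by auto
    assume "\<exists>\<delta>>0. \<exists>C\<ge>0. \<forall>q\<in>V. \<forall>t. \<bar>t\<bar> < \<delta> \<longrightarrow> \<bar>area_ratio N N (\<phi> t) q - 1\<bar> \<le> C * \<bar>t\<bar>"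
    then obtain b B where b: "b > 0" "B \<ge> 0" "\<forall>q\<in>V. \<forall>t. \<bar>t\<bar> < b \<longrightarrow> \<bar>area_ratio N N (\<phi> t) q - 1\<bar> \<le> B * \<bar>t\<bar>" by auto
    have "\<bar>area_ratio N N (\<phi> t) q - 1\<bar> \<le> max A B * \<bar>t\<bar>" if q: "q \<in> U \<union> V" and t: "\<bar>t\<bar> < min a b" for q t
    proof -
      have "\<bar>area_ratio N N (\<phi> t) q - 1\<bar> \<le> A * \<bar>t\<bar> \<or> \<bar>area_ratio N N (\<phi> t) q - 1\<bar> \<le> B * \<bar>t\<bar>"
        using q t a(3) b(3) by auto
      moreover have "A * \<bar>t\<bar> \<le> max A B * \<bar>t\<bar>" "B * \<bar>t\<bar> \<le> max A B * \<bar>t\<bar>" by (auto intro: mult_right_mono)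
      ultimately show ?thesis by linarith
    qed
    then show "\<exists>\<delta>>0. \<exists>C\<ge>0. \<forall>q\<in>U \<union> V. \<forall>t. \<bar>t\<bar> < \<delta> \<longrightarrow> \<bar>area_ratio N N (\<phi> t) q - 1\<bar> \<le> C * \<bar>t\<bar>"
      using a b by (intro exI[of _ "min a b"] exI[of _ "max A B"] conjI) auto
  qed
  then obtain \<delta> C where "0 < \<delta>" "0 \<le> C" "\<forall>q\<in>points N. \<forall>t. \<bar>t\<bar> < \<delta> \<longrightarrow> \<bar>area_ratio N N (\<phi> t) q - 1\<bar> \<le> C * \<bar>t\<bar>" by auto
  then show ?thesis by (intro that[of \<delta> C]) auto
qed

text \<open>Differentiation under the integral: a Lipschitz bound in the parameter, uniform over a
  finite measure space, dominates the difference quotients.\<close>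

lemma has_real_derivative_integral:
  fixes b :: "real \<Rightarrow> 'a \<Rightarrow> real"
  assumes fin: "finite_measure \<mu>" and d: "0 < \<delta>"
    and m: "\<And>t. \<bar>t\<bar> < \<delta> \<Longrightarrow> b t \<in> borel_measurable \<mu>" and i0: "integrable \<mu> (b 0)"
    and lip: "\<And>t p. \<bar>t\<bar> < \<delta> \<Longrightarrow> p \<in> space \<mu> \<Longrightarrow> \<bar>b t p - b 0 p\<bar> \<le> C * \<bar>t\<bar>"
    and der: "\<And>p. p \<in> space \<mu> \<Longrightarrow> ((\<lambda>t. b t p) has_real_derivative D p) (at 0)"
  shows "((\<lambda>t. \<integral>p. b t p \<partial>\<mu>) has_real_derivative (\<integral>p. D p \<partial>\<mu>)) (at 0)"
proof -
  interpret finite_measure \<mu> by (rule fin)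
  have idiff: "integrable \<mu> (\<lambda>p. b t p - b 0 p)" if t: "\<bar>t\<bar> < \<delta>" for t
    using lip[OF t] m[OF t] i0 by (intro integrable_const_bound[of _ "C * \<bar>t\<bar>"] AE_I2) auto
  have it: "integrable \<mu> (b t)" if t: "\<bar>t\<bar> < \<delta>" for t
    using Bochner_Integration.integrable_add[OF idiff[OF t] i0] by simp
  show ?thesis
    unfolding DERIV_def tendsto_at_iff_sequentially
  proof (intro allI impI)
    fix X :: "nat \<Rightarrow> real" assume X0: "\<forall>i. X i \<in> UNIV - {0}" and X: "X \<longlonglongrightarrow> 0"
    have "eventually (\<lambda>i. \<bar>X i\<bar> < \<delta>) sequentially"
      using tendstoD[OF X d] by (simp add: dist_real_def)
    then obtain n where n: "\<And>i. i \<ge> n \<Longrightarrow> \<bar>X i\<bar> < \<delta>" by (auto simp: eventually_sequentially)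
    define Y where "Y i = X (i + n)" for i
    have Y: "Y i \<noteq> 0" "\<bar>Y i\<bar> < \<delta>" for i using X0 n by (auto simp: Y_def)
    have Yl: "Y \<longlonglongrightarrow> 0" unfolding Y_def using X by (rule LIMSEQ_ignore_initial_segment)
    define s where "s i p = (b (Y i) p - b 0 p) / Y i" for i p
    have sm: "s i \<in> borel_measurable \<mu>" for i unfolding s_def using m[OF Y(2)] i0 by measurable
    have lim: "(\<lambda>i. s i p) \<longlonglongrightarrow> D p" if p: "p \<in> space \<mu>" for p
    proof -
      have "((\<lambda>h. (b (0 + h) p - b 0 p) / h) \<longlongrightarrow> D p) (at 0)" using der[OF p] by (simp add: DERIV_def)
      then have "((\<lambda>h. (b (0 + h) p - b 0 p) / h) \<circ> Y) \<longlonglongrightarrow> D p"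
        unfolding tendsto_at_iff_sequentially using Y Yl by blast
      then show ?thesis by (simp add: o_def s_def)
    qed
    have Dm: "D \<in> borel_measurable \<mu>" by (rule borel_measurable_LIMSEQ_real[OF lim sm])
    have bd: "norm (s i p) \<le> C" if p: "p \<in> space \<mu>" for i p
      using lip[OF Y(2) p] Y(1) by (simp add: s_def field_simps)
    have "(\<lambda>i. \<integral>p. s i p \<partial>\<mu>) \<longlonglongrightarrow> (\<integral>p. D p \<partial>\<mu>)"
      by (rule integral_dominated_convergence[OF Dm sm, of "\<lambda>_. C"]) (use lim bd in auto)
    moreover have "(\<integral>p. s i p \<partial>\<mu>) = ((\<integral>p. b (0 + Y i) p \<partial>\<mu>) - (\<integral>p. b 0 p \<partial>\<mu>)) / Y i" for i
      unfolding s_def using it[OF Y(2)] i0 by simp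
    ultimately have "(\<lambda>i. ((\<integral>p. b (0 + Y i) p \<partial>\<mu>) - (\<integral>p. b 0 p \<partial>\<mu>)) / Y i) \<longlonglongrightarrow> (\<integral>p. D p \<partial>\<mu>)" by simp
    then show "((\<lambda>h. ((\<integral>p. b (0 + h) p \<partial>\<mu>) - (\<integral>p. b 0 p \<partial>\<mu>)) / h) \<circ> X) \<longlonglongrightarrow> (\<integral>p. D p \<partial>\<mu>)"
      unfolding Y_def o_def by (rule LIMSEQ_offset[where k=n])
  qed
qed

lemma continuous_map_bounded:
  fixes u :: "'a \<Rightarrow> real"
  assumes "compact_space X" "continuous_map X euclidean u"
  obtains K where "0 \<le> K" "\<And>p. p \<in> topspace X \<Longrightarrow> \<bar>u p\<bar> \<le> K"
proof -
  have "compact (u ` topspace X)"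
    using image_compactin[OF _ assms(2)] assms(1) by (metis compact_space_def compactin_euclidean_iff)
  then obtain K where K: "\<forall>y\<in>u ` topspace X. norm y \<le> K" using compact_imp_bounded bounded_iff by blast
  then have "\<bar>u p\<bar> \<le> max K 0" if "p \<in> topspace X" for p using that by fastforce
  then show ?thesis by (intro that[of "max K 0"]) auto
qed

text \<open>Since $J_{\phi_t \circ f} = (J_{\phi_t} \circ f)\, J_f$ and $J_{\phi_0} = 1$, the integrands
  $J_{\phi_t \circ f}^2$ and $J_{\phi_t \circ f}$ have the derivatives $2 J_f^2\, (D \circ f)$ and
  $J_f\, (D \circ f)$ at time zero, where $D$ is that of $J_{\phi_t}$. Compactness makes
  the difference quotients uniformly bounded.\<close>

theorem variation_formulas:
  assumes RM: "riemannian_surface M" and KM: "compact_space (surf_top M)"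
    and RN: "riemannian_surface N" and KN: "compact_space (surf_top N)"
    and f: "smooth_map M N f" and flow: "local_flow N V \<phi>"
    and D: "\<And>q. q \<in> points N \<Longrightarrow> ((\<lambda>t. area_ratio N N (\<phi> t) q) has_real_derivative D q) (at 0)"
  shows "((\<lambda>t. stretch_energy M N (\<phi> t \<circ> f)) has_real_derivative
      (\<integral>p. 2 * (area_ratio M N f p)\<^sup>2 * D (f p) \<partial>area_measure M)) (at 0)"
    and "((\<lambda>t. \<integral>p. area_ratio M N (\<phi> t \<circ> f) p \<partial>area_measure M) has_real_derivative
      (\<integral>p. area_ratio M N f p * D (f p) \<partial>area_measure M)) (at 0)"
proof -
  note M = riemannian_surface_oriented[OF RM] and N = riemannian_surface_oriented[OF RN]
  let ?\<mu> = "area_measure M"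
  obtain \<epsilon> where e: "0 < \<epsilon>" "\<And>t. t \<in> {-\<epsilon><..<\<epsilon>} \<Longrightarrow> smooth_map N N (\<phi> t)"
    by (rule local_flowE[OF N flow]) (rule that)
  obtain \<delta>0 C where d0: "0 < \<delta>0" and C: "0 \<le> C"
    and lip: "\<And>q t. q \<in> points N \<Longrightarrow> \<bar>t\<bar> < \<delta>0 \<Longrightarrow> \<bar>area_ratio N N (\<phi> t) q - 1\<bar> \<le> C * \<bar>t\<bar>"
    by (rule flow_area_ratio_uniform[OF RN KN flow]) (rule that)
  \<comment> \<open>Times below one keep \<open>J + 1\<close> bounded by \<open>C + 2\<close> for the area ratio \<open>J\<close> of the flow.\<close>
  define \<delta> where "\<delta> = min 1 (min \<epsilon> \<delta>0)"
  have d: "0 < \<delta>" using d0 e by (simp add: \<delta>_def)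
  obtain K where K: "0 \<le> K" "\<And>p. p \<in> points M \<Longrightarrow> \<bar>area_ratio M N f p\<bar> \<le> K"
    by (rule continuous_map_bounded[OF KM continuous_map_area_ratio[OF RM RN f]]) (rule that)
  define a where "a t p = area_ratio N N (\<phi> t) (f p)" for t p
  define J where "J p = area_ratio M N f p" for p
  have a0: "a 0 p = 1" if p: "p \<in> points M" for p
    unfolding a_def by (rule flow_area_ratio_0[OF RN flow smooth_mapD(2)[OF f p]])
  have alip: "\<bar>a t p - 1\<bar> \<le> C * \<bar>t\<bar>" if p: "p \<in> points M" and t: "\<bar>t\<bar> < \<delta>" for t p
    unfolding a_def by (rule lip[OF smooth_mapD(2)[OF f p]]) (use t in \<open>simp add: \<delta>_def\<close>)
  have ader: "((\<lambda>t. a t p) has_real_derivative D (f p)) (at 0)" if p: "p \<in> points M" for p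
    unfolding a_def by (rule D[OF smooth_mapD(2)[OF f p]])
  have sm: "smooth_map M N (\<phi> t \<circ> f)" if "\<bar>t\<bar> < \<delta>" for t
    by (rule smooth_map_compose[OF M N N f e(2)]) (use that in \<open>auto simp: \<delta>_def\<close>)
  have comp: "area_ratio M N (\<phi> t \<circ> f) p = a t p * J p" if "\<bar>t\<bar> < \<delta>" "p \<in> points M" for t p
    unfolding a_def J_def by (rule area_ratio_compose[OF RM RN RN f e(2) that(2)]) (use that in \<open>auto simp: \<delta>_def\<close>)
  have cM: "measurable ?\<mu> borel = measurable (borel_of (surf_top M)) borel"
    by (rule measurable_cong_sets[OF sets_area_measure[OF RM KM] refl])
  have meas: "area_ratio M N (\<phi> t \<circ> f) \<in> borel_measurable ?\<mu>" if "\<bar>t\<bar> < \<delta>" for t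
    unfolding cM by (rule continuous_map_borel_measurable[OF continuous_map_area_ratio[OF RM RN sm[OF that]]])
  have sp: "space ?\<mu> = points M" by (rule space_area_measure[OF RM KM])
  have fin: "finite_measure ?\<mu>" by (rule finite_area_measure[OF RM KM])
  interpret finite_measure ?\<mu> by (rule fin)
  have 0: "\<bar>0::real\<bar> < \<delta>" using d by simp
  have JK: "\<bar>J p\<bar> \<le> K" if "p \<in> points M" for p using K(2)[OF that] by (simp add: J_def)
  have b0: "\<bar>area_ratio M N (\<phi> 0 \<circ> f) p\<bar> \<le> K" if p: "p \<in> points M" for p
    using JK[OF p] a0[OF p] comp[OF 0 p] by simp
  have i1: "integrable ?\<mu> (area_ratio M N (\<phi> 0 \<circ> f))"
    by (rule integrable_const_bound[of _ K]) (use b0 sp meas[OF 0] in auto)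
  have i2: "integrable ?\<mu> (\<lambda>p. (area_ratio M N (\<phi> 0 \<circ> f) p)\<^sup>2)"
  proof (rule integrable_const_bound[of _ "K\<^sup>2"])
    show "AE p in ?\<mu>. norm ((area_ratio M N (\<phi> 0 \<circ> f) p)\<^sup>2) \<le> K\<^sup>2"
      using b0 sp by (intro AE_I2) (simp add: power2_le_iff_abs_le K(1))
  qed (use meas[OF 0] in measurable)
  show "((\<lambda>t. \<integral>p. area_ratio M N (\<phi> t \<circ> f) p \<partial>?\<mu>) has_real_derivative
      (\<integral>p. area_ratio M N f p * D (f p) \<partial>?\<mu>)) (at 0)"
  proof (rule has_real_derivative_integral[where b = "\<lambda>t. area_ratio M N (\<phi> t \<circ> f)" and C = "C * K", OF fin d meas i1])
    fix t p assume t: "\<bar>t\<bar> < \<delta>" and "p \<in> space ?\<mu>"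
    then have p: "p \<in> points M" by (simp add: sp)
    have "\<bar>a t p * J p - a 0 p * J p\<bar> = \<bar>a t p - 1\<bar> * \<bar>J p\<bar>"
      by (simp add: a0[OF p] abs_mult[symmetric] left_diff_distrib)
    also have "\<dots> \<le> (C * \<bar>t\<bar>) * K" by (intro mult_mono alip[OF p t] JK[OF p]) (auto simp: C)
    finally show "\<bar>area_ratio M N (\<phi> t \<circ> f) p - area_ratio M N (\<phi> 0 \<circ> f) p\<bar> \<le> C * K * \<bar>t\<bar>"
      by (simp add: comp[OF t p] comp[OF 0 p] mult_ac)
  next
    fix p assume "p \<in> space ?\<mu>"
    then have p: "p \<in> points M" by (simp add: sp)
    have "((\<lambda>t. a t p * J p) has_real_derivative D (f p) * J p) (at 0)"
      by (rule DERIV_cmult_right[OF ader[OF p]])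
    then have "((\<lambda>t. area_ratio M N (\<phi> t \<circ> f) p) has_real_derivative D (f p) * J p) (at 0)"
      by (rule has_field_derivative_transform_within_open[where S="{-\<delta><..<\<delta>}"]) (use d comp[OF _ p] in auto)
    then show "((\<lambda>t. area_ratio M N (\<phi> t \<circ> f) p) has_real_derivative area_ratio M N f p * D (f p)) (at 0)"
      by (simp add: J_def mult.commute)
  qed
  show "((\<lambda>t. stretch_energy M N (\<phi> t \<circ> f)) has_real_derivative
      (\<integral>p. 2 * (area_ratio M N f p)\<^sup>2 * D (f p) \<partial>?\<mu>)) (at 0)"
    unfolding stretch_energy_def surface_integral_def
  proof (rule has_real_derivative_integral[where b = "\<lambda>t p. (area_ratio M N (\<phi> t \<circ> f) p)\<^sup>2" and C = "C * (C + 2) * K\<^sup>2", OF fin d _ i2])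
    show "(\<lambda>p. (area_ratio M N (\<phi> t \<circ> f) p)\<^sup>2) \<in> borel_measurable ?\<mu>" if "\<bar>t\<bar> < \<delta>" for t
      using meas[OF that] by measurable
    fix t p assume t: "\<bar>t\<bar> < \<delta>" and "p \<in> space ?\<mu>"
    then have p: "p \<in> points M" by (simp add: sp)
    have "\<bar>a t p + 1\<bar> \<le> C + 2"
    proof -
      have "C * \<bar>t\<bar> \<le> C" using t C by (simp add: \<delta>_def mult_left_le)
      then show ?thesis using alip[OF p t] by linarith
    qed
    have "\<bar>(a t p * J p)\<^sup>2 - (a 0 p * J p)\<^sup>2\<bar> = (\<bar>a t p - 1\<bar> * \<bar>a t p + 1\<bar>) * (J p)\<^sup>2"
    proof -
      have "(a t p * J p)\<^sup>2 - (a 0 p * J p)\<^sup>2 = ((a t p - 1) * (a t p + 1)) * (J p)\<^sup>2"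
        by (simp add: a0[OF p] power2_eq_square algebra_simps)
      then show ?thesis by (simp add: abs_mult)
    qed
    also have "\<dots> \<le> ((C * \<bar>t\<bar>) * (C + 2)) * K\<^sup>2"
    proof (intro mult_mono alip[OF p t] \<open>\<bar>a t p + 1\<bar> \<le> C + 2\<close>)
      show "(J p)\<^sup>2 \<le> K\<^sup>2" using JK[OF p] by (simp add: power2_le_iff_abs_le K(1))
    qed (auto simp: C)
    finally show "\<bar>(area_ratio M N (\<phi> t \<circ> f) p)\<^sup>2 - (area_ratio M N (\<phi> 0 \<circ> f) p)\<^sup>2\<bar> \<le> C * (C + 2) * K\<^sup>2 * \<bar>t\<bar>"
      by (simp add: comp[OF t p] comp[OF 0 p] mult_ac)
  next
    fix p assume "p \<in> space ?\<mu>"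
    then have p: "p \<in> points M" by (simp add: sp)
    have "((\<lambda>t. (a t p * J p)\<^sup>2) has_real_derivative 2 * (J p)\<^sup>2 * D (f p)) (at 0)"
      using ader[OF p] by (auto intro!: derivative_eq_intros simp: a0[OF p] power2_eq_square)
    then have "((\<lambda>t. (area_ratio M N (\<phi> t \<circ> f) p)\<^sup>2) has_real_derivative 2 * (J p)\<^sup>2 * D (f p)) (at 0)"
      by (rule has_field_derivative_transform_within_open[where S="{-\<delta><..<\<delta>}"]) (use d comp[OF _ p] in auto)
    then show "((\<lambda>t. (area_ratio M N (\<phi> t \<circ> f) p)\<^sup>2) has_real_derivative 2 * (area_ratio M N f p)\<^sup>2 * D (f p)) (at 0)"
      by (simp add: J_def)
  qed
qed


section \<open>Area-preserving maps are critical\<close>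

text \<open>The two partial derivatives are bounded on a compact disc, which bounds the operator norm of the derivative.\<close>

lemma smooth_locally_lipschitz:
  fixes F :: "real^2 \<Rightarrow> real^2"
  assumes U: "open U" "x0 \<in> U" and F: "smooth_on U F"
  obtains r L where "0 < r" "0 \<le> L" "cball x0 r \<subseteq> U"
    "\<And>x y. x \<in> cball x0 r \<Longrightarrow> y \<in> cball x0 r \<Longrightarrow> norm (F x - F y) \<le> L * norm (x - y)"
proof -
  obtain r where r: "r > 0" "cball x0 r \<subseteq> U" using U open_contains_cball by blast
  define F' where "F' x = frechet_derivative F (at x)" for x
  have "\<exists>C. \<forall>x\<in>cball x0 r. norm (F' x b) \<le> C" for b
  proof -
    have "continuous_on (cball x0 r) (\<lambda>x. F' x b)"
      unfolding F'_def
      by (rule continuous_on_subset[OF smooth_on_imp_continuous_on[OF smooth_on_frechet_derivative[OF U(1) F]] r(2)])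
    then have "bounded ((\<lambda>x. F' x b) ` cball x0 r)" by (intro compact_imp_bounded compact_continuous_image compact_cball)
    then show ?thesis by (auto simp: bounded_iff)
  qed
  then obtain C where C: "\<forall>b. \<forall>x\<in>cball x0 r. norm (F' x b) \<le> C b" by metis
  define L where "L = \<bar>C (axis 1 1)\<bar> + \<bar>C (axis 2 1)\<bar>"
  have der: "(F has_derivative F' x) (at x)" if "x \<in> cball x0 r" for x
    unfolding F'_def using smooth_on_open_has_derivative[OF U(1) F] that r(2) by blast
  have "norm (F x - F y) \<le> L * norm (x - y)" if xy: "x \<in> cball x0 r" "y \<in> cball x0 r" for x y
  proof (rule differentiable_bound[OF convex_cball[of x0 r] _ _ xy])
    fix z assume z: "z \<in> cball x0 r"
    show "(F has_derivative F' z) (at z within cball x0 r)" using der[OF z] by (rule has_derivative_at_withinI)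
    show "onorm (F' z) \<le> L"
    proof (rule onorm_le)
      fix v
      have "norm (F' z v) = norm (v $ 1 *\<^sub>R F' z (axis 1 1) + v $ 2 *\<^sub>R F' z (axis 2 1))"
        using linear_real2[OF has_derivative_linear[OF der[OF z]], of v] by simp
      also have "\<dots> \<le> \<bar>v $ 1\<bar> * norm (F' z (axis 1 1)) + \<bar>v $ 2\<bar> * norm (F' z (axis 2 1))"
        by (rule norm_triangle_le) simp
      also have "\<dots> \<le> norm v * \<bar>C (axis 1 1)\<bar> + norm v * \<bar>C (axis 2 1)\<bar>"
      proof (intro add_mono mult_mono)
        show "norm (F' z (axis 1 1)) \<le> \<bar>C (axis 1 1)\<bar>" using C[rule_format, OF z, of "axis 1 1"] by linarith
        show "norm (F' z (axis 2 1)) \<le> \<bar>C (axis 2 1)\<bar>" using C[rule_format, OF z, of "axis 2 1"] by linarith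
      qed (auto simp: component_le_norm_cart)
      finally show "norm (F' z v) \<le> L * norm v" by (simp add: L_def algebra_simps)
    qed
  qed
  then show ?thesis using r by (intro that[of r L]) (auto simp: L_def)
qed

lemma has_vector_derivative_norm_bound:
  fixes u :: "real \<Rightarrow> 'a::real_normed_vector"
  assumes "\<And>s. s \<in> {a..b} \<Longrightarrow> (u has_vector_derivative u' s) (at s)" "\<And>s. s \<in> {a..b} \<Longrightarrow> norm (u' s) \<le> B"
    and "s \<in> {a..b}" "t \<in> {a..b}"
  shows "norm (u s - u t) \<le> B * \<bar>s - t\<bar>"
proof -
  have "norm (u s - u t) \<le> B * norm (s - t)"
  proof (rule differentiable_bound[of "{a..b}" u "\<lambda>s h. h *\<^sub>R u' s"])
    fix z assume z: "z \<in> {a..b}"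
    show "(u has_derivative (\<lambda>h. h *\<^sub>R u' z)) (at z within {a..b})"
      using assms(1)[OF z] unfolding has_vector_derivative_def by (rule has_derivative_at_withinI)
    show "onorm (\<lambda>h. h *\<^sub>R u' z) \<le> B"
    proof (rule onorm_le)
      fix h
      show "norm (h *\<^sub>R u' z) \<le> B * norm h"
        using mult_left_mono[OF assms(2)[OF z], of "\<bar>h\<bar>"] by (simp add: mult.commute)
    qed
  qed (use assms in auto)
  then show ?thesis by simp
qed

text \<open>In a chart both curves solve the same differential equation with a locally Lipschitz right-hand
  side, so on a short interval the maximum \<open>m\<close> of their distance satisfies \<open>m \<le> m / 2\<close>.\<close>

lemma integral_curves_agree_locally:
  assumes N: "oriented_surface N" and V: "smooth_vector_field N V" and I: "open I" "t \<in> I"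
    and cont: "continuous_map (top_of_set I) (surf_top N) \<gamma>" "continuous_map (top_of_set I) (surf_top N) \<eta>"
    and ode: "\<And>s d. s \<in> I \<Longrightarrow> d \<in> charts_at N (\<gamma> s) \<Longrightarrow> ((\<lambda>s. snd d (\<gamma> s)) has_vector_derivative V (\<gamma> s) d) (at s)"
      "\<And>s d. s \<in> I \<Longrightarrow> d \<in> charts_at N (\<eta> s) \<Longrightarrow> ((\<lambda>s. snd d (\<eta> s)) has_vector_derivative V (\<eta> s) d) (at s)"
    and eq: "\<gamma> t = \<eta> t"
  shows "\<exists>h>0. \<forall>s. \<bar>s - t\<bar> \<le> h \<longrightarrow> s \<in> I \<and> \<gamma> s = \<eta> s"
proof -
  let ?X = "surf_top N"
  have "\<gamma> t \<in> points N" using continuous_map_image_subset_topspace[OF cont(1)] I by auto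
  then obtain d where d: "d \<in> charts_at N (\<gamma> t)" using ex_charts_at[OF N] by blast
  note da = charts_atD[OF d]
  note D = oriented_surfaceD(2)[OF N da(1)]
  define x0 where "x0 = snd d (\<gamma> t)"
  have x0: "x0 \<in> chart_image d" unfolding x0_def by (rule chart_in_image[OF da(2)])
  have smV: "smooth_on (chart_image d) (\<lambda>x. V (chart_inv d x) d)" using V da by (simp add: smooth_vector_field_def)
  obtain U F where U: "open U" "x0 \<in> U" "\<And>k. Ck_on_open k U F"
    "\<And>y. y \<in> U \<Longrightarrow> y \<in> chart_image d \<Longrightarrow> F y = V (chart_inv d y) d"
    by (rule smooth_onE[OF smV x0]) (rule that)
  obtain r L where rL: "0 < r" "0 \<le> L" "cball x0 r \<subseteq> U"
    "\<And>x y. x \<in> cball x0 r \<Longrightarrow> y \<in> cball x0 r \<Longrightarrow> norm (F x - F y) \<le> L * norm (x - y)"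
    by (rule smooth_locally_lipschitz[OF U(1,2) Ck_on_open_imp_smooth_on[OF U(1,3)]]) (rule that)
  let ?B = "{q \<in> fst d. snd d q \<in> ball x0 r}"
  have B: "openin ?X ?B" by (rule chart_preimage_openin[OF D open_ball])
  have opn: "\<exists>e>0. \<forall>s. \<bar>s - t\<bar> < e \<longrightarrow> s \<in> I \<and> \<kappa> s \<in> ?B"
    if \<kappa>: "continuous_map (top_of_set I) ?X \<kappa>" "\<kappa> t = \<gamma> t" for \<kappa>
  proof -
    have "openin (top_of_set I) {s \<in> topspace (top_of_set I). \<kappa> s \<in> ?B}"
      by (rule openin_continuous_map_preimage[OF \<kappa>(1) B])
    then have "open {s \<in> I. \<kappa> s \<in> ?B}" using openin_open_eq[OF I(1)] by auto
    moreover have "t \<in> {s \<in> I. \<kappa> s \<in> ?B}" using I \<kappa>(2) da rL(1) by (simp add: x0_def)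
    ultimately obtain e where "e > 0" "ball t e \<subseteq> {s \<in> I. \<kappa> s \<in> ?B}" using open_contains_ball by blast
    then show ?thesis by (intro exI[of _ e]) (auto simp: dist_real_def abs_minus_commute subset_iff)
  qed
  obtain e1 where e1: "e1 > 0" "\<forall>s. \<bar>s - t\<bar> < e1 \<longrightarrow> s \<in> I \<and> \<gamma> s \<in> ?B" using opn[OF cont(1)] by auto
  obtain e2 where e2: "e2 > 0" "\<forall>s. \<bar>s - t\<bar> < e2 \<longrightarrow> s \<in> I \<and> \<eta> s \<in> ?B" using opn[OF cont(2)] eq by auto
  \<comment> \<open>On a half-length \<open>h\<close> with \<open>L h \<le> 1 / 2\<close> the mean value bound becomes a contraction.\<close>
  define h where "h = min (min e1 e2 / 2) (1 / (2 * (L + 1)))"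
  have h0: "0 < h" using e1 e2 rL(2) by (simp add: h_def)
  have hL: "L * h \<le> 1 / 2"
  proof -
    have "L * h \<le> L * (1 / (2 * (L + 1)))" using rL(2) by (intro mult_left_mono) (auto simp: h_def)
    also have "\<dots> \<le> 1 / 2" using rL(2) by (simp add: field_simps)
    finally show ?thesis .
  qed
  define x where "x s = snd d (\<gamma> s)" for s
  define y where "y s = snd d (\<eta> s)" for s
  have near: "s \<in> I \<and> \<gamma> s \<in> ?B \<and> \<eta> s \<in> ?B" if "s \<in> {t-h..t+h}" for s
  proof -
    have "\<bar>s - t\<bar> \<le> h" using that by auto
    moreover have "h < e1" "h < e2" using e1 e2 by (auto simp: h_def min_def)
    ultimately show ?thesis using e1(2) e2(2) by auto
  qed
  have FV: "F (snd d q) = V q d" if "q \<in> ?B" for q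
  proof -
    have q: "q \<in> fst d" "snd d q \<in> cball x0 r" using that by auto
    then have "snd d q \<in> U" using rL(3) by auto
    from U(4)[OF this chart_in_image[OF q(1)]] show ?thesis by (simp add: chart_inv_chart[OF D q(1)])
  qed
  have der: "((\<lambda>s. x s - y s) has_vector_derivative (F (x s) - F (y s))) (at s)" if s: "s \<in> {t-h..t+h}" for s
  proof (rule has_vector_derivative_diff)
    note n = near[OF s]
    show "(x has_vector_derivative F (x s)) (at s)"
      using ode(1)[of s d] n da(1) FV[of "\<gamma> s"] unfolding x_def by (simp add: charts_at_def)
    show "(y has_vector_derivative F (y s)) (at s)"
      using ode(2)[of s d] n da(1) FV[of "\<eta> s"] unfolding y_def by (simp add: charts_at_def)
  qed
  have "continuous_on {t-h..t+h} (\<lambda>s. norm (x s - y s))"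
    by (intro continuous_on_norm continuous_at_imp_continuous_on ballI has_vector_derivative_continuous) (rule der)
  then have "\<exists>s0\<in>{t-h..t+h}. \<forall>s\<in>{t-h..t+h}. norm (x s - y s) \<le> norm (x s0 - y s0)"
    by (rule continuous_attains_sup[OF compact_Icc, rotated]) (use h0 in auto)
  then obtain s0 where s0: "s0 \<in> {t-h..t+h}" "\<forall>s\<in>{t-h..t+h}. norm (x s - y s) \<le> norm (x s0 - y s0)"
    by blast
  define m where "m = norm (x s0 - y s0)"
  have xb: "x s \<in> cball x0 r" "y s \<in> cball x0 r" if "s \<in> {t-h..t+h}" for s
    using near[OF that] by (auto simp: x_def y_def)
  have "norm ((x s0 - y s0) - (x t - y t)) \<le> (L * m) * \<bar>s0 - t\<bar>"
  proof (rule has_vector_derivative_norm_bound[OF der _ s0(1)])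
    fix s assume s: "s \<in> {t-h..t+h}"
    have "norm (F (x s) - F (y s)) \<le> L * norm (x s - y s)" by (rule rL(4)[OF xb[OF s]])
    also have "\<dots> \<le> L * m" unfolding m_def using s0(2) s rL(2) by (intro mult_left_mono) auto
    finally show "norm (F (x s) - F (y s)) \<le> L * m" .
  qed (use h0 in auto)
  also have "\<dots> \<le> (L * m) * h" using s0(1) rL(2) by (intro mult_left_mono) (auto simp: m_def)
  also have "\<dots> = (L * h) * m" by simp
  also have "\<dots> \<le> 1 / 2 * m" by (rule mult_right_mono[OF hL]) (simp add: m_def)
  finally have "m \<le> 1 / 2 * m" by (simp add: m_def x_def y_def eq)
  then have m0: "m \<le> 0" by simp
  have "\<gamma> s = \<eta> s" if s: "s \<in> {t-h..t+h}" for s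
  proof -
    have "norm (x s - y s) \<le> 0" using s0(2) s m0 by (auto simp: m_def)
    then have "snd d (\<gamma> s) = snd d (\<eta> s)" by (simp add: x_def y_def)
    then show ?thesis using near[OF s] is_chartD(3)[OF D] by (auto simp: inj_on_def)
  qed
  moreover have "s \<in> {t-h..t+h}" if "\<bar>s - t\<bar> \<le> h" for s using that by (simp add: abs_le_iff)
  ultimately show ?thesis using h0 near by (intro exI[of _ h]) blast
qed

text \<open>The set of times at which the curves agree is closed in a Hausdorff space, and open by the local statement.\<close>

lemma integral_curves_agree:
  assumes N: "oriented_surface N" and V: "smooth_vector_field N V" and I: "open I" "connected I" "t0 \<in> I"
    and cont: "continuous_map (top_of_set I) (surf_top N) \<gamma>" "continuous_map (top_of_set I) (surf_top N) \<eta>"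
    and ode: "\<And>s d. s \<in> I \<Longrightarrow> d \<in> charts_at N (\<gamma> s) \<Longrightarrow> ((\<lambda>s. snd d (\<gamma> s)) has_vector_derivative V (\<gamma> s) d) (at s)"
      "\<And>s d. s \<in> I \<Longrightarrow> d \<in> charts_at N (\<eta> s) \<Longrightarrow> ((\<lambda>s. snd d (\<eta> s)) has_vector_derivative V (\<eta> s) d) (at s)"
    and eq: "\<gamma> t0 = \<eta> t0" and t: "t \<in> I"
  shows "\<gamma> t = \<eta> t"
proof -
  let ?Z = "{s \<in> I. \<gamma> s = \<eta> s}"
  have "closedin (top_of_set I) {s \<in> topspace (top_of_set I). \<gamma> s = \<eta> s}"
    by (rule closedin_continuous_maps_eq[OF oriented_surfaceD(1)[OF N] cont])
  then have "closedin (top_of_set I) ?Z" by simp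
  moreover have "open ?Z"
    unfolding open_contains_ball
  proof
    fix s assume s: "s \<in> ?Z"
    then have "s \<in> I" "\<gamma> s = \<eta> s" by auto
    from integral_curves_agree_locally[OF N V I(1) this(1) cont ode this(2)]
    obtain h where "h > 0" "\<forall>s'. \<bar>s' - s\<bar> \<le> h \<longrightarrow> s' \<in> I \<and> \<gamma> s' = \<eta> s'" by auto
    then show "\<exists>e>0. ball s e \<subseteq> ?Z"
      by (intro exI[of _ h]) (auto simp: dist_real_def abs_minus_commute)
  qed
  then have "openin (top_of_set I) ?Z" using openin_open_eq[OF I(1)] by auto
  ultimately have "?Z = {} \<or> ?Z = I" using I(2) unfolding connected_clopen by auto
  then show ?thesis using eq I(3) t by blast
qed

text \<open>Both \<open>s \<mapsto> \<phi>\<^sub>s (\<phi>\<^sub>-\<^sub>t q)\<close> and \<open>s \<mapsto> \<phi>\<^sub>s\<^sub>-\<^sub>t q\<close> are integral curves through \<open>\<phi>\<^sub>-\<^sub>t q\<close> at time zero.\<close>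

lemma local_flow_inverse:
  assumes N: "oriented_surface N" and V: "smooth_vector_field N V" and flow: "local_flow N V \<phi>"
  obtains \<epsilon> where "0 < \<epsilon>" "\<And>t q. \<bar>t\<bar> < \<epsilon> \<Longrightarrow> q \<in> points N \<Longrightarrow> \<phi> t (\<phi> (- t) q) = q"
    "\<And>t. \<bar>t\<bar> < \<epsilon> \<Longrightarrow> smooth_map N N (\<phi> t)"
proof -
  let ?X = "surf_top N"
  obtain \<epsilon> where e: "0 < \<epsilon>"
    and cont: "continuous_map (prod_topology (top_of_set {-\<epsilon><..<\<epsilon>}) ?X) ?X (\<lambda>(t, q). \<phi> t q)"
    and init: "\<And>q. q \<in> points N \<Longrightarrow> \<phi> 0 q = q"
    and ode: "\<And>t q d. t \<in> {-\<epsilon><..<\<epsilon>} \<Longrightarrow> q \<in> points N \<Longrightarrow> d \<in> charts_at N (\<phi> t q) \<Longrightarrow>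
      ((\<lambda>s. snd d (\<phi> s q)) has_vector_derivative V (\<phi> t q) d) (at t)"
    and smt: "\<And>t. t \<in> {-\<epsilon><..<\<epsilon>} \<Longrightarrow> smooth_map N N (\<phi> t)"
    by (rule local_flowE[OF N flow]) (rule that)
  have curve: "continuous_map (top_of_set I) ?X (\<lambda>s. \<phi> (s - r) q)"
    if q: "q \<in> points N" and I: "\<And>s. s \<in> I \<Longrightarrow> s - r \<in> {-\<epsilon><..<\<epsilon>}" for q I r
  proof -
    have "continuous_map (top_of_set I) (top_of_set {-\<epsilon><..<\<epsilon>}) (\<lambda>s. s - r)"
      using I by (auto simp: continuous_map_in_subtopology image_subset_iff intro!: continuous_intros)
    then have "continuous_map (top_of_set I) (prod_topology (top_of_set {-\<epsilon><..<\<epsilon>}) ?X) (\<lambda>s. (s - r, q))"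
      using q by (intro continuous_map_pairedI) auto
    from continuous_map_compose[OF this cont] show ?thesis by (simp add: o_def)
  qed
  have shift: "((\<lambda>s. snd d (\<phi> (s - r) q)) has_vector_derivative V (\<phi> (s - r) q) d) (at s)"
    if q: "q \<in> points N" and s: "s - r \<in> {-\<epsilon><..<\<epsilon>}" and d: "d \<in> charts_at N (\<phi> (s - r) q)" for q r s d
  proof -
    have "((\<lambda>s. s - r) has_vector_derivative 1) (at s)" by (auto intro!: derivative_eq_intros)
    from vector_diff_chain_at[OF this ode[OF s q d]] show ?thesis by (simp add: o_def)
  qed
  have "\<phi> t (\<phi> (- t) q) = q" if t: "\<bar>t\<bar> < \<epsilon>" and q: "q \<in> points N" for t q
  proof -
    define I where "I = {max (- \<epsilon>) (t - \<epsilon>)<..<min \<epsilon> (t + \<epsilon>)}"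
    have I: "open I" "connected I" "0 \<in> I" "t \<in> I" using t e by (auto simp: I_def)
    have I1: "s - 0 \<in> {-\<epsilon><..<\<epsilon>}" and I2: "s - t \<in> {-\<epsilon><..<\<epsilon>}" if "s \<in> I" for s using that by (auto simp: I_def)
    have q': "\<phi> (- t) q \<in> points N" by (rule smooth_mapD(2)[OF smt q]) (use t in auto)
    have "\<phi> (t - 0) (\<phi> (- t) q) = \<phi> (t - t) q"
    proof (rule integral_curves_agree[where \<gamma> = "\<lambda>s. \<phi> (s - 0) (\<phi> (- t) q)" and \<eta> = "\<lambda>s. \<phi> (s - t) q",
          OF N V I(1-3) _ _ _ _ _ I(4)])
      show "continuous_map (top_of_set I) ?X (\<lambda>s. \<phi> (s - 0) (\<phi> (- t) q))" by (rule curve[OF q' I1])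
      show "continuous_map (top_of_set I) ?X (\<lambda>s. \<phi> (s - t) q)" by (rule curve[OF q I2])
      show "((\<lambda>s. snd d (\<phi> (s - 0) (\<phi> (- t) q))) has_vector_derivative V (\<phi> (s - 0) (\<phi> (- t) q)) d) (at s)"
        if "s \<in> I" "d \<in> charts_at N (\<phi> (s - 0) (\<phi> (- t) q))" for s d by (rule shift[OF q' I1[OF that(1)] that(2)])
      show "((\<lambda>s. snd d (\<phi> (s - t) q)) has_vector_derivative V (\<phi> (s - t) q) d) (at s)"
        if "s \<in> I" "d \<in> charts_at N (\<phi> (s - t) q)" for s d by (rule shift[OF q I2[OF that(1)] that(2)])
      show "\<phi> (0 - 0) (\<phi> (- t) q) = \<phi> (0 - t) q" using init[OF q'] by simp
    qed
    then show ?thesis using init[OF q] by simp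
  qed
  moreover have "smooth_map N N (\<phi> t)" if "\<bar>t\<bar> < \<epsilon>" for t
    by (rule smt) (use that in \<open>simp add: abs_less_iff\<close>)
  ultimately show ?thesis using e by (intro that[of \<epsilon>]) auto
qed

lemma diffeomorphismD:
  assumes "orientation_preserving_diffeomorphism M N f"
  shows "smooth_map M N f" and "smooth_map N M (inv_into (points M) f)"
    and "\<And>p. p \<in> points M \<Longrightarrow> inv_into (points M) f (f p) = p"
    and "\<And>q. q \<in> points N \<Longrightarrow> f (inv_into (points M) f q) = q"
    and "\<And>p c d. p \<in> points M \<Longrightarrow> c \<in> charts_at M p \<Longrightarrow> d \<in> charts_at N (f p) \<Longrightarrow> 0 < det (matrix (local_deriv c d f p))"
proof -
  from assms have b: "bij_betw f (points M) (points N)" and *: "smooth_map M N f" "smooth_map N M (inv_into (points M) f)"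
    "\<forall>p\<in>points M. \<forall>c\<in>charts_at M p. \<forall>d\<in>charts_at N (f p). 0 < det (matrix (local_deriv c d f p))"
    unfolding orientation_preserving_diffeomorphism_def by blast+
  show "smooth_map M N f" "smooth_map N M (inv_into (points M) f)" by (rule *)+
  show "\<And>p. p \<in> points M \<Longrightarrow> inv_into (points M) f (f p) = p" by (rule bij_betw_inv_into_left[OF b])
  show "\<And>q. q \<in> points N \<Longrightarrow> f (inv_into (points M) f q) = q" by (rule bij_betw_inv_into_right[OF b])
  show "\<And>p c d. p \<in> points M \<Longrightarrow> c \<in> charts_at M p \<Longrightarrow> d \<in> charts_at N (f p) \<Longrightarrow> 0 < det (matrix (local_deriv c d f p))"
    using *(3) by blast
qed

text \<open>The Jacobian determinant of an orientation-preserving map is positive in the charts of the atlas.\<close>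

lemma diffeomorphism_area_ratio_pos:
  assumes RM: "riemannian_surface M" and RN: "riemannian_surface N"
    and f: "orientation_preserving_diffeomorphism M N f" and p: "p \<in> points M"
  shows "0 < area_ratio M N f p"
proof -
  note M = riemannian_surface_oriented[OF RM] and N = riemannian_surface_oriented[OF RN]
  note f' = diffeomorphismD[OF f]
  obtain c where c: "c \<in> charts_at M p" using ex_charts_at[OF M p] by auto
  obtain d where d: "d \<in> charts_at N (f p)" using ex_charts_at[OF N smooth_mapD(2)[OF f'(1) p]] by auto
  show ?thesis
    using area_density_pos[OF RM c] area_density_pos[OF RN d] f'(5)[OF p c d]
    by (simp add: area_ratio_eq[OF RM RN f'(1) c d])
qed

text \<open>If $J_f = 1$, then the first variation is $2 \int D \circ f$, which is twice the derivative of the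
  total area $\int J_{\phi_t \circ f} = |\mathcal N|$ of the image. The latter does not depend on \<open>t\<close>,
  as \<open>\<phi>\<^sub>t\<close> is a diffeomorphism with positive area ratio for small \<open>t\<close>.\<close>

theorem area_preserving_imp_critical:
  assumes RM: "riemannian_surface M" and KM: "compact_space (surf_top M)"
    and RN: "riemannian_surface N" and KN: "compact_space (surf_top N)"
    and f: "orientation_preserving_diffeomorphism M N f"
    and J: "\<And>p. p \<in> points M \<Longrightarrow> area_ratio M N f p = 1"
    and V: "smooth_vector_field N V" and flow: "local_flow N V \<phi>"
  shows "((\<lambda>t. stretch_energy M N (\<phi> t \<circ> f)) has_real_derivative 0) (at 0)"
proof -
  note M = riemannian_surface_oriented[OF RM] and N = riemannian_surface_oriented[OF RN]
  note f' = diffeomorphismD[OF f]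
  let ?h = "inv_into (points M) f"
  have "\<forall>q. \<exists>D. q \<in> points N \<longrightarrow> ((\<lambda>t. area_ratio N N (\<phi> t) q) has_real_derivative D) (at 0)"
    using flow_area_ratio_differentiable[OF RN flow] by blast
  then obtain D where D: "\<And>q. q \<in> points N \<Longrightarrow> ((\<lambda>t. area_ratio N N (\<phi> t) q) has_real_derivative D q) (at 0)" by metis
  note var = variation_formulas[OF RM KM RN KN f'(1) flow D]
  obtain \<epsilon> where e: "0 < \<epsilon>" "\<And>t q. \<bar>t\<bar> < \<epsilon> \<Longrightarrow> q \<in> points N \<Longrightarrow> \<phi> t (\<phi> (- t) q) = q"
    "\<And>t. \<bar>t\<bar> < \<epsilon> \<Longrightarrow> smooth_map N N (\<phi> t)"
    by (rule local_flow_inverse[OF N V flow]) (rule that)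
  obtain \<delta> C where d: "0 < \<delta>" "0 \<le> C"
    "\<And>q t. q \<in> points N \<Longrightarrow> \<bar>t\<bar> < \<delta> \<Longrightarrow> \<bar>area_ratio N N (\<phi> t) q - 1\<bar> \<le> C * \<bar>t\<bar>"
    by (rule flow_area_ratio_uniform[OF RN KN flow]) (rule that)
  \<comment> \<open>For \<open>|t| < \<eta>\<close> the area ratio of \<open>\<phi>\<^sub>t\<close> differs from one by less than one, hence is positive.\<close>
  define \<eta> where "\<eta> = min (min \<epsilon> \<delta>) (1 / (C + 1))"
  have \<eta>: "0 < \<eta>" using e d by (simp add: \<eta>_def)
  have const: "(\<integral>p. area_ratio M N (\<phi> t \<circ> f) p \<partial>area_measure M) = (\<integral>q. 1 \<partial>area_measure N)" if t: "\<bar>t\<bar> < \<eta>" for t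
  proof -
    have te: "\<bar>t\<bar> < \<epsilon>" "\<bar>- t\<bar> < \<epsilon>" "\<bar>t\<bar> < \<delta>" using t by (auto simp: \<eta>_def)
    have sm: "smooth_map M N (\<phi> t \<circ> f)" by (rule smooth_map_compose[OF M N N f'(1) e(3)[OF te(1)]])
    have Ct: "C * \<bar>t\<bar> < 1"
    proof -
      have "\<bar>t\<bar> < 1 / (C + 1)" using t by (simp add: \<eta>_def)
      then have "(C + 1) * \<bar>t\<bar> < 1" using d(2) by (simp add: field_simps)
      then show ?thesis by (simp add: algebra_simps)
    qed
    have "(\<integral>p. area_ratio M N (\<phi> t \<circ> f) p * 1 \<partial>area_measure M) = (\<integral>q. 1 \<partial>area_measure N)"
    proof (rule integral_pullback[OF RM KM RN KN sm, where h = "?h \<circ> \<phi> (- t)"])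
      show "continuous_map (surf_top N) (surf_top M) (?h \<circ> \<phi> (- t))"
        by (rule continuous_map_compose[OF smooth_mapD(1)[OF e(3)[OF te(2)]] smooth_mapD(1)[OF f'(2)]])
      fix p assume p: "p \<in> points M"
      have fp: "f p \<in> points N" by (rule smooth_mapD(2)[OF f'(1) p])
      show "(?h \<circ> \<phi> (- t)) ((\<phi> t \<circ> f) p) = p"
        using e(2)[OF te(2) fp] f'(3)[OF p] by simp
      have "\<bar>area_ratio N N (\<phi> t) (f p) - 1\<bar> < 1" using d(3)[OF fp te(3)] Ct by linarith
      then show "0 \<le> area_ratio M N (\<phi> t \<circ> f) p"
        by (simp add: area_ratio_compose[OF RM RN RN f'(1) e(3)[OF te(1)] p] J[OF p])
    next
      fix q assume q: "q \<in> points N"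
      have "\<phi> (- t) q \<in> points N" by (rule smooth_mapD(2)[OF e(3)[OF te(2)] q])
      then show "(\<phi> t \<circ> f) ((?h \<circ> \<phi> (- t)) q) = q" using e(2)[OF te(1) q] f'(4) by simp
    qed auto
    then show ?thesis by simp
  qed
  have "((\<lambda>t. \<integral>q. 1 \<partial>area_measure N) has_real_derivative 0) (at 0)" by simp
  then have "((\<lambda>t. \<integral>p. area_ratio M N (\<phi> t \<circ> f) p \<partial>area_measure M) has_real_derivative 0) (at 0)"
    by (rule has_field_derivative_transform_within_open[where S="{-\<eta><..<\<eta>}"]) (use \<eta> const in auto)
  from DERIV_unique[OF var(2) this]
  have z: "(\<integral>p. area_ratio M N f p * D (f p) \<partial>area_measure M) = 0" by simp
  have "(\<integral>p. 2 * (area_ratio M N f p)\<^sup>2 * D (f p) \<partial>area_measure M) = (\<integral>p. 2 * (area_ratio M N f p * D (f p)) \<partial>area_measure M)"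
    by (rule Bochner_Integration.integral_cong) (auto simp: J space_area_measure[OF RM KM])
  also have "\<dots> = 0" using z by simp
  finally show ?thesis using var(1) by simp
qed


section \<open>Integration by parts in the plane\<close>

text \<open>The mean value theorem, applied first in direction \<open>a\<close> to a difference in direction \<open>b\<close> and then in
  direction \<open>b\<close> to the derivative along \<open>a\<close>.\<close>

lemma mixed_difference_mean_value:
  fixes g :: "real^2 \<Rightarrow> real"
  assumes h: "0 < h" and box: "\<And>s t. 0 \<le> s \<Longrightarrow> s \<le> h \<Longrightarrow> 0 \<le> t \<Longrightarrow> t \<le> h \<Longrightarrow> x + s *\<^sub>R a + t *\<^sub>R b \<in> U"
    and g: "\<And>z. z \<in> U \<Longrightarrow> (g has_derivative g' z) (at z)"
    and g1: "\<And>z. z \<in> U \<Longrightarrow> ((\<lambda>z. g' z a) has_derivative g'' z) (at z)"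
  shows "\<exists>s t. 0 \<le> s \<and> s \<le> h \<and> 0 \<le> t \<and> t \<le> h \<and>
    g (x + h *\<^sub>R a + h *\<^sub>R b) - g (x + h *\<^sub>R a) - (g (x + h *\<^sub>R b) - g x) = h * (h * g'' (x + s *\<^sub>R a + t *\<^sub>R b) b)"
proof -
  have dir: "((\<lambda>s. k (y + s *\<^sub>R v)) has_real_derivative k' v) (at s)" if "(k has_derivative k') (at (y + s *\<^sub>R v))"
    for k :: "real^2 \<Rightarrow> real" and k' y v s
  proof -
    have "((\<lambda>s. y + s *\<^sub>R v) has_derivative (\<lambda>h. h *\<^sub>R v)) (at s)" by (auto intro!: derivative_eq_intros)
    from has_derivative_compose[OF this that]
    have "((\<lambda>s. k (y + s *\<^sub>R v)) has_derivative (\<lambda>h. k' (h *\<^sub>R v))) (at s)" .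
    moreover have "(\<lambda>h. k' (h *\<^sub>R v)) = (*) (k' v)"
      using linear_scale[OF has_derivative_linear[OF that]] by (simp add: fun_eq_iff mult.commute)
    ultimately show ?thesis by (simp add: has_field_derivative_def)
  qed
  define F where "F s = g ((x + h *\<^sub>R b) + s *\<^sub>R a) - g (x + s *\<^sub>R a)" for s
  have "\<exists>s. 0 < s \<and> s < h \<and> F h - F 0 = (h - 0) * (g' ((x + h *\<^sub>R b) + s *\<^sub>R a) a - g' (x + s *\<^sub>R a) a)"
  proof (rule MVT2[OF h])
    fix s :: real assume s: "0 \<le> s" "s \<le> h"
    have m: "x + h *\<^sub>R b + s *\<^sub>R a \<in> U" "x + s *\<^sub>R a \<in> U"
      using box[of s h] box[of s 0] s h by (auto simp: add_ac)
    show "(F has_real_derivative (g' ((x + h *\<^sub>R b) + s *\<^sub>R a) a - g' (x + s *\<^sub>R a) a)) (at s)"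
      unfolding F_def by (intro DERIV_diff dir g m)
  qed
  then obtain s where s: "0 < s" "s < h" "F h - F 0 = h * (g' ((x + h *\<^sub>R b) + s *\<^sub>R a) a - g' (x + s *\<^sub>R a) a)" by auto
  have "\<exists>t. 0 < t \<and> t < h \<and> g' ((x + s *\<^sub>R a) + h *\<^sub>R b) a - g' ((x + s *\<^sub>R a) + 0 *\<^sub>R b) a = (h - 0) * g'' ((x + s *\<^sub>R a) + t *\<^sub>R b) b"
  proof (rule MVT2[OF h])
    fix t :: real assume t: "0 \<le> t" "t \<le> h"
    have "x + s *\<^sub>R a + t *\<^sub>R b \<in> U" using box[of s t] s t by auto
    from dir[OF g1[OF this]]
    show "((\<lambda>t. g' ((x + s *\<^sub>R a) + t *\<^sub>R b) a) has_real_derivative g'' ((x + s *\<^sub>R a) + t *\<^sub>R b) b) (at t)" .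
  qed
  then obtain t where t: "0 < t" "t < h" "g' ((x + s *\<^sub>R a) + h *\<^sub>R b) a - g' (x + s *\<^sub>R a) a = h * g'' ((x + s *\<^sub>R a) + t *\<^sub>R b) b" by auto
  have "F h - F 0 = h * (h * g'' (x + s *\<^sub>R a + t *\<^sub>R b) b)"
    using s(3) t(3) by (simp add: add_ac)
  then show ?thesis using s t by (intro exI[of _ s] exI[of _ t]) (auto simp: F_def add_ac)
qed

text \<open>The mixed difference is symmetric in the two directions, so the two mixed second derivatives take equal values
  at points arbitrarily close to \<open>x\<close>, and they are continuous.\<close>

lemma symmetric_second_derivative:
  fixes g :: "real^2 \<Rightarrow> real"
  assumes U: "open U" and g: "smooth_on U g" and x: "x \<in> U"
  shows "frechet_derivative (\<lambda>z. frechet_derivative g (at z) a) (at x) b = frechet_derivative (\<lambda>z. frechet_derivative g (at z) b) (at x) a"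
proof -
  define G where "G a b z = frechet_derivative (\<lambda>z. frechet_derivative g (at z) a) (at z) b" for a b z
  have sm1: "smooth_on U (\<lambda>z. frechet_derivative g (at z) v)" for v by (rule smooth_on_frechet_derivative[OF U g])
  have cont: "continuous_on U (G a b)" for a b
    unfolding G_def by (rule smooth_on_imp_continuous_on[OF smooth_on_frechet_derivative[OF U sm1]])
  have der: "(g has_derivative frechet_derivative g (at z)) (at z)" if "z \<in> U" for z
    by (rule smooth_on_open_has_derivative[OF U g that])
  have der1: "((\<lambda>z. frechet_derivative g (at z) v) has_derivative (\<lambda>w. G v w z)) (at z)" if "z \<in> U" for z v
    unfolding G_def by (rule smooth_on_open_has_derivative[OF U sm1 that])
  have "\<bar>G a b x - G b a x\<bar> \<le> e" if e: "e > 0" for e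
  proof -
    have "continuous (at x) (G a b)" "continuous (at x) (G b a)"
      using cont U x by (auto simp: continuous_on_eq_continuous_at)
    then obtain d1 d2 where d: "d1 > 0" "\<And>z. dist z x < d1 \<Longrightarrow> dist (G a b z) (G a b x) < e/2"
      "d2 > 0" "\<And>z. dist z x < d2 \<Longrightarrow> dist (G b a z) (G b a x) < e/2"
      using e unfolding continuous_at_eps_delta dist_norm[symmetric] by (metis half_gt_zero)
    obtain d3 where d3: "d3 > 0" "ball x d3 \<subseteq> U" using U x open_contains_ball by blast
    define d where "d = min (min d1 d2) d3"
    define h where "h = d / (2 * (norm a + norm b + 1))"
    have d0: "d > 0" using d d3 by (simp add: d_def)
    have h: "h > 0" using d0 norm_ge_zero[of a] norm_ge_zero[of b] by (simp add: h_def add_nonneg_pos)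
    have hh: "h * (norm a + norm b) < d"
    proof -
      have "h * (norm a + norm b) \<le> h * (norm a + norm b + 1)" using h by simp
      also have "\<dots> = d / 2" using norm_ge_zero[of a] norm_ge_zero[of b] by (simp add: h_def field_simps add_nonneg_eq_0_iff)
      also have "\<dots> < d" using d0 by simp
      finally show ?thesis .
    qed
    have near: "dist (x + s *\<^sub>R v + t *\<^sub>R w) x < d"
      if "0 \<le> s" "s \<le> h" "0 \<le> t" "t \<le> h" "norm v + norm w = norm a + norm b" for s t v w
    proof -
      have "dist (x + s *\<^sub>R v + t *\<^sub>R w) x = norm (s *\<^sub>R v + t *\<^sub>R w)" by (simp add: dist_norm)
      also have "\<dots> \<le> s * norm v + t * norm w" using that by (intro norm_triangle_le) auto
      also have "\<dots> \<le> h * norm v + h * norm w" using that by (intro add_mono mult_right_mono) auto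
      also have "\<dots> < d" using hh that(5) by (simp add: distrib_left[symmetric])
      finally show ?thesis .
    qed
    have inU: "z \<in> U" if "dist z x < d" for z using that d3(2) by (auto simp: d_def dist_commute)
    obtain s t where st: "0 \<le> s" "s \<le> h" "0 \<le> t" "t \<le> h"
      "g (x + h *\<^sub>R a + h *\<^sub>R b) - g (x + h *\<^sub>R a) - (g (x + h *\<^sub>R b) - g x) = h * (h * G a b (x + s *\<^sub>R a + t *\<^sub>R b))"
      using mixed_difference_mean_value[OF h inU[OF near] der der1, of a b] by auto
    obtain s' t' where st': "0 \<le> s'" "s' \<le> h" "0 \<le> t'" "t' \<le> h"
      "g (x + h *\<^sub>R b + h *\<^sub>R a) - g (x + h *\<^sub>R b) - (g (x + h *\<^sub>R a) - g x) = h * (h * G b a (x + s' *\<^sub>R b + t' *\<^sub>R a))"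
      using mixed_difference_mean_value[OF h inU[OF near] der der1, of b a] by auto
    have "h * (h * G a b (x + s *\<^sub>R a + t *\<^sub>R b)) = h * (h * G b a (x + s' *\<^sub>R b + t' *\<^sub>R a))"
    proof -
      have c: "x + h *\<^sub>R b + h *\<^sub>R a = x + h *\<^sub>R a + h *\<^sub>R b" by (simp add: add_ac)
      show ?thesis using st(5) st'(5) unfolding c by linarith
    qed
    then have eq: "G a b (x + s *\<^sub>R a + t *\<^sub>R b) = G b a (x + s' *\<^sub>R b + t' *\<^sub>R a)" using h by simp
    have "dist (G a b (x + s *\<^sub>R a + t *\<^sub>R b)) (G a b x) < e/2"
      by (rule d(2)) (use near[OF st(1-4), of a b] in \<open>simp add: d_def\<close>)
    moreover have "dist (G b a (x + s' *\<^sub>R b + t' *\<^sub>R a)) (G b a x) < e/2"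
      by (rule d(4)) (use near[OF st'(1-4), of b a] in \<open>simp add: d_def\<close>)
    ultimately show ?thesis unfolding eq dist_real_def by linarith
  qed
  then have "\<bar>G a b x - G b a x\<bar> \<le> 0" by (rule field_le_epsilon) simp
  then show ?thesis by (simp add: G_def)
qed

text \<open>Differentiating the constant function \<open>t \<mapsto> \<integral> G (x + t v) dx\<close> at zero under the integral.\<close>

lemma integral_directional_derivative_zero:
  fixes G :: "real^2 \<Rightarrow> real"
  assumes G: "smooth_on UNIV G" and supp: "\<And>x. x \<notin> cball x0 R \<Longrightarrow> G x = 0"
  shows "(\<integral>x. frechet_derivative G (at x) v \<partial>lborel) = 0"
    and "integrable lborel (\<lambda>x. frechet_derivative G (at x) v)"
proof -
  \<comment> \<open>All translates by \<open>t v\<close> with \<open>|t| < 1\<close> are supported in this ball, which has finite measure.\<close>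
  define B where "B = cball x0 (R + norm v)"
  define \<mu> where "\<mu> = restrict_space (lborel :: (real^2) measure) B"
  have Bs: "B \<in> sets lborel" by (simp add: B_def)
  have sp: "space \<mu> = B" by (simp add: \<mu>_def space_restrict_space)
  have fin: "finite_measure \<mu>"
  proof (rule finite_measureI)
    have "emeasure \<mu> B = emeasure lborel B"
      unfolding \<mu>_def by (rule emeasure_restrict_space) (use Bs in auto)
    then show "emeasure \<mu> (space \<mu>) \<noteq> \<infinity>" unfolding sp using emeasure_lborel_cball_finite[of x0 "R + norm v"] by (simp add: B_def)
  qed
  define G' where "G' x = frechet_derivative G (at x) v" for x
  have der: "(G has_derivative frechet_derivative G (at x)) (at x)" for x
    by (rule smooth_on_open_has_derivative[OF open_UNIV G]) simp
  have derv: "((\<lambda>t. G (x + t *\<^sub>R v)) has_real_derivative G' (x + t *\<^sub>R v)) (at t)" for x t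
  proof -
    have "((\<lambda>t. x + t *\<^sub>R v) has_derivative (\<lambda>h. h *\<^sub>R v)) (at t)" by (auto intro!: derivative_eq_intros)
    from has_derivative_compose[OF this der]
    have "((\<lambda>t. G (x + t *\<^sub>R v)) has_derivative (\<lambda>h. frechet_derivative G (at (x + t *\<^sub>R v)) (h *\<^sub>R v))) (at t)" .
    moreover have "(\<lambda>h. frechet_derivative G (at (x + t *\<^sub>R v)) (h *\<^sub>R v)) = (*) (G' (x + t *\<^sub>R v))"
      using linear_scale[OF has_derivative_linear[OF der]] by (simp add: fun_eq_iff mult.commute G'_def)
    ultimately show ?thesis by (simp add: has_field_derivative_def)
  qed
  have contG: "continuous_on UNIV G" by (rule smooth_on_imp_continuous_on[OF G])
  have contG': "continuous_on UNIV G'"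
    unfolding G'_def by (rule smooth_on_imp_continuous_on[OF smooth_on_frechet_derivative[OF open_UNIV G]])
  have G'0: "G' x = 0" if "x \<notin> cball x0 R" for x
  proof -
    have "((\<lambda>x. 0) has_derivative (\<lambda>v. 0::real)) (at x)" by simp
    then have "(G has_derivative (\<lambda>v. 0)) (at x)"
      by (rule has_derivative_transform_within_open[of _ _ _ _ "- cball x0 R"]) (use that supp in auto)
    then have "frechet_derivative G (at x) = (\<lambda>v. 0)" using frechet_derivative_at by metis
    then show ?thesis by (simp add: G'_def)
  qed
  have "bounded (G' ` cball x0 R)"
    by (intro compact_imp_bounded compact_continuous_image continuous_on_subset[OF contG']) auto
  then obtain C where C: "\<forall>x\<in>cball x0 R. \<bar>G' x\<bar> \<le> C" by (auto simp: bounded_iff)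
  have C': "\<bar>G' x\<bar> \<le> \<bar>C\<bar>" for x using C G'0[of x] by (cases "x \<in> cball x0 R") fastforce+
  have Gm: "(\<lambda>x. G (x + t *\<^sub>R v)) \<in> borel_measurable lborel" for t
  proof -
    have "continuous_on UNIV (\<lambda>x. G (x + t *\<^sub>R v))"
      by (intro continuous_on_compose2[OF contG] continuous_intros) auto
    from borel_measurable_continuous_onI[OF this] show ?thesis by simp
  qed
  have G'm: "G' \<in> borel_measurable lborel"
    using borel_measurable_continuous_onI[OF contG'] by simp
  have Gm': "(\<lambda>x. G (x + t *\<^sub>R v)) \<in> borel_measurable \<mu>" for t
    unfolding \<mu>_def by (rule measurable_restrict_space1[OF Gm])
  interpret finite_measure \<mu> by (rule fin)
  have "bounded (G ` cball x0 R)"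
    by (intro compact_imp_bounded compact_continuous_image continuous_on_subset[OF contG]) auto
  then obtain K where K: "\<forall>x\<in>cball x0 R. \<bar>G x\<bar> \<le> K" by (auto simp: bounded_iff)
  have K': "\<bar>G x\<bar> \<le> \<bar>K\<bar>" for x using K supp[of x] by (cases "x \<in> cball x0 R") fastforce+
  have deriv: "((\<lambda>t. \<integral>x. G (x + t *\<^sub>R v) \<partial>\<mu>) has_real_derivative (\<integral>x. G' x \<partial>\<mu>)) (at 0)"
  proof (rule has_real_derivative_integral[where b = "\<lambda>t x. G (x + t *\<^sub>R v)" and C = "\<bar>C\<bar>", OF fin zero_less_one Gm'])
    show "integrable \<mu> (\<lambda>x. G (x + 0 *\<^sub>R v))"
      by (rule integrable_const_bound[of _ "\<bar>K\<bar>"]) (use K' Gm'[of 0] in auto)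
    show "\<bar>G (x + t *\<^sub>R v) - G (x + 0 *\<^sub>R v)\<bar> \<le> \<bar>C\<bar> * \<bar>t\<bar>" for t x
    proof -
      have "norm (G (x + t *\<^sub>R v) - G (x + 0 *\<^sub>R v)) \<le> \<bar>C\<bar> * norm (t - 0)"
        by (rule field_differentiable_bound[of UNIV "\<lambda>t. G (x + t *\<^sub>R v)" "\<lambda>t. G' (x + t *\<^sub>R v)"])
           (use derv C' in auto)
      then show ?thesis by simp
    qed
    show "((\<lambda>t. G (x + t *\<^sub>R v)) has_real_derivative G' x) (at 0)" for x using derv[of x 0] by simp
  qed
  have const: "(\<integral>x. G (x + t *\<^sub>R v) \<partial>\<mu>) = (\<integral>x. G x \<partial>lborel)" if t: "\<bar>t\<bar> < 1" for t
  proof -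
    have "(\<integral>x. G (x + t *\<^sub>R v) \<partial>\<mu>) = (\<integral>x. indicator B x *\<^sub>R G (x + t *\<^sub>R v) \<partial>lborel)"
      unfolding \<mu>_def by (rule integral_restrict_space) (use Bs in auto)
    also have "\<dots> = (\<integral>x. G (x + t *\<^sub>R v) \<partial>lborel)"
    proof (rule Bochner_Integration.integral_cong[OF refl])
      fix x
      show "indicator B x *\<^sub>R G (x + t *\<^sub>R v) = G (x + t *\<^sub>R v)"
      proof (cases "x \<in> B")
        case False
        have "dist x0 x \<le> dist x0 (x + t *\<^sub>R v) + norm (t *\<^sub>R v)"
          using dist_triangle[of x0 x "x + t *\<^sub>R v"] by (simp add: dist_norm)
        moreover have "norm (t *\<^sub>R v) \<le> norm v" using t by (simp add: mult_left_le_one_le)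
        ultimately have "x + t *\<^sub>R v \<notin> cball x0 R" using False by (simp add: B_def)
        then show ?thesis using supp by simp
      qed simp
    qed
    also have "\<dots> = (\<integral>x. G (t *\<^sub>R v + x) \<partial>lborel)" by (simp add: add.commute)
    also have "\<dots> = (\<integral>x. G x \<partial>distr lborel borel ((+) (t *\<^sub>R v)))"
      by (rule integral_distr[symmetric]) (use borel_measurable_continuous_onI[OF contG] in auto)
    also have "\<dots> = (\<integral>x. G x \<partial>lborel)" by (simp add: lborel_distr_plus)
    finally show ?thesis .
  qed
  have "((\<lambda>t. \<integral>x. G x \<partial>lborel) has_real_derivative 0) (at 0)" by simp
  then have "((\<lambda>t. \<integral>x. G (x + t *\<^sub>R v) \<partial>\<mu>) has_real_derivative 0) (at 0)"
  proof (rule has_field_derivative_transform_within_open[where S = "{-1<..<1}"])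
    fix t :: real assume "t \<in> {-1<..<1}"
    then have "\<bar>t\<bar> < 1" by auto
    from const[OF this] show "(\<integral>x. G x \<partial>lborel) = (\<integral>x. G (x + t *\<^sub>R v) \<partial>\<mu>)" by simp
  qed simp_all
  from DERIV_unique[OF deriv this] have z: "(\<integral>x. G' x \<partial>\<mu>) = 0" .
  have ind: "indicator B x *\<^sub>R G' x = G' x" for x
  proof (cases "x \<in> B")
    case False
    then have "x \<notin> cball x0 R" using norm_ge_zero[of v] unfolding B_def mem_cball by linarith
    then show ?thesis using False by (simp add: G'0)
  qed simp
  have "(\<integral>x. G' x \<partial>\<mu>) = (\<integral>x. indicator B x *\<^sub>R G' x \<partial>lborel)"
    unfolding \<mu>_def by (rule integral_restrict_space) (use Bs in auto)
  then have "(\<integral>x. G' x \<partial>lborel) = 0" using z by (simp only: ind)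
  then show "(\<integral>x. frechet_derivative G (at x) v \<partial>lborel) = 0" by (simp add: G'_def)
  have "integrable \<mu> G'"
    by (rule integrable_const_bound[of _ "\<bar>C\<bar>"])
       (use C' in \<open>auto simp: \<mu>_def intro: measurable_restrict_space1[OF G'm]\<close>)
  then have "integrable lborel (\<lambda>x. indicator B x *\<^sub>R G' x)"
    unfolding \<mu>_def using integrable_restrict_space[of B lborel G'] Bs by simp
  then have "integrable lborel (\<lambda>x. G' x)" by (simp only: ind)
  then show "integrable lborel (\<lambda>x. frechet_derivative G (at x) v)" by (simp add: G'_def)
qed

abbreviation partial :: "2 \<Rightarrow> (real^2 \<Rightarrow> real) \<Rightarrow> real^2 \<Rightarrow> real" where
  "partial k u x \<equiv> frechet_derivative u (at x) (axis k 1)"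

text \<open>A factor supported in a closed subset of the open set \<open>B\<close> makes the extension by zero smooth.\<close>

lemma smooth_on_cutoff:
  fixes G K :: "real^2 \<Rightarrow> real"
  assumes B: "open B" and E: "closed E" "E \<subseteq> B" and G: "smooth_on B G" and K: "smooth_on UNIV K"
    and z: "\<And>x. x \<notin> E \<Longrightarrow> K x = 0"
  shows "smooth_on UNIV (\<lambda>x. indicator B x * (G x * K x))"
proof (rule smooth_on_local)
  fix x
  show "\<exists>U. open U \<and> x \<in> U \<and> smooth_on (UNIV \<inter> U) (\<lambda>x. indicator B x * (G x * K x))"
  proof (cases "x \<in> B")
    case True
    have "smooth_on B (\<lambda>x. G x * K x)" by (intro smooth_on_mult G smooth_on_subset[OF K]) auto
    then have "smooth_on B (\<lambda>x. indicator B x * (G x * K x))" by (rule smooth_on_cong) simp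
    then show ?thesis using True B by (intro exI[of _ B]) auto
  next
    case False
    have "smooth_on (- E) (\<lambda>x. indicator B x * (G x * K x))"
      by (rule smooth_on_cong[OF smooth_on_const[of _ 0]]) (use z in auto)
    then show ?thesis using False E by (intro exI[of _ "- E"]) auto
  qed
qed

text \<open>Stokes' theorem for the compactly supported one-form \<open>u K dw\<close>.\<close>

lemma green_identity:
  fixes u w K :: "real^2 \<Rightarrow> real"
  assumes B: "open B" and E: "closed E" "E \<subseteq> B" "E \<subseteq> cball x0 R"
    and u: "smooth_on B u" and w: "smooth_on B w" and K: "smooth_on UNIV K" and z: "\<And>x. x \<notin> E \<Longrightarrow> K x = 0"
  shows "(\<integral>x. indicator B x * (u x * (partial 1 w x * partial 2 K x - partial 2 w x * partial 1 K x)) \<partial>lborel)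
     = (\<integral>x. indicator B x * ((partial 1 u x * partial 2 w x - partial 2 u x * partial 1 w x) * K x) \<partial>lborel)"
    and "integrable lborel (\<lambda>x. indicator B x * ((partial 1 u x * partial 2 w x - partial 2 u x * partial 1 w x) * K x))"
    and "continuous_on UNIV (\<lambda>x. indicator B x * ((partial 1 u x * partial 2 w x - partial 2 u x * partial 1 w x) * K x))"
proof -
  define G where "G k x = indicator B x * ((u x * partial k w x) * K x)" for k x
  have wk: "smooth_on B (\<lambda>x. partial k w x)" for k by (rule smooth_on_frechet_derivative[OF B w])
  have G: "smooth_on UNIV (G k)" for k
    unfolding G_def by (intro smooth_on_cutoff[OF B E(1,2)] smooth_on_mult u wk K z)
  have Gz: "G k x = 0" if "x \<notin> cball x0 R" for k x
  proof -
    have "K x = 0" using z E(3) that by blast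
    then show ?thesis by (simp add: G_def)
  qed
  note int = integral_directional_derivative_zero[OF G Gz]
  have K0: "frechet_derivative K (at x) v = 0" if "x \<notin> E" for x v
  proof -
    have "((\<lambda>x. 0) has_derivative (\<lambda>v. 0::real)) (at x)" by simp
    then have "(K has_derivative (\<lambda>v. 0)) (at x)"
      by (rule has_derivative_transform_within_open[of _ _ _ _ "- E"]) (use that E z in auto)
    then show ?thesis using frechet_derivative_at by metis
  qed
  have dG: "partial l (G k) x = indicator B x * (u x * partial k w x * partial l K x
      + (partial l u x * partial k w x + u x * frechet_derivative (\<lambda>x. partial k w x) (at x) (axis l 1)) * K x)" for k l x
  proof (cases "x \<in> B")
    case True
    have du: "(u has_derivative frechet_derivative u (at x)) (at x)" by (rule smooth_on_open_has_derivative[OF B u True])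
    have dw: "((\<lambda>x. partial k w x) has_derivative frechet_derivative (\<lambda>x. partial k w x) (at x)) (at x)"
      by (rule smooth_on_open_has_derivative[OF B wk True])
    have dK: "(K has_derivative frechet_derivative K (at x)) (at x)" by (rule smooth_on_open_has_derivative[OF open_UNIV K]) simp
    have "((\<lambda>x. u x * partial k w x * K x) has_derivative
        (\<lambda>h. u x * partial k w x * frechet_derivative K (at x) h +
          (u x * frechet_derivative (\<lambda>x. partial k w x) (at x) h + frechet_derivative u (at x) h * partial k w x) * K x)) (at x)"
      by (rule has_derivative_mult[OF has_derivative_mult[OF du dw] dK])
    then have "(G k has_derivative
        (\<lambda>h. u x * partial k w x * frechet_derivative K (at x) h +
          (u x * frechet_derivative (\<lambda>x. partial k w x) (at x) h + frechet_derivative u (at x) h * partial k w x) * K x)) (at x)"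
      by (rule has_derivative_transform_within_open[OF _ B True]) (simp add: G_def)
    from frechet_derivative_at[OF this, symmetric] show ?thesis using True by (simp add: algebra_simps)
  next
    case False
    have "((\<lambda>x. 0) has_derivative (\<lambda>v. 0::real)) (at x)" by simp
    then have "(G k has_derivative (\<lambda>v. 0)) (at x)"
      by (rule has_derivative_transform_within_open[of _ _ _ _ "- E"]) (use False E z in \<open>auto simp: G_def\<close>)
    from frechet_derivative_at[OF this, symmetric] show ?thesis using False by simp
  qed
  let ?L = "\<lambda>x. indicator B x * (u x * (partial 1 w x * partial 2 K x - partial 2 w x * partial 1 K x))"
  let ?R = "\<lambda>x. indicator B x * ((partial 1 u x * partial 2 w x - partial 2 u x * partial 1 w x) * K x)"
  have uw: "smooth_on UNIV (\<lambda>x. indicator B x * ((partial 1 u x * partial 2 w x - partial 2 u x * partial 1 w x) * K x))"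
    by (intro smooth_on_cutoff[OF B E(1,2)] smooth_on_diff smooth_on_mult smooth_on_frechet_derivative[OF B u] wk K z)
  have Rint: "integrable lborel ?R"
  proof -
    have "integrable lborel (\<lambda>x. indicator (cball x0 R) x *\<^sub>R ?R x)"
      by (rule borel_integrable_compact[OF compact_cball continuous_on_subset[OF smooth_on_imp_continuous_on[OF uw]]]) simp
    moreover have "(\<lambda>x. indicator (cball x0 R) x *\<^sub>R ?R x) = ?R"
    proof
      fix x show "indicator (cball x0 R) x *\<^sub>R ?R x = ?R x"
      proof (cases "x \<in> cball x0 R")
        case False
        then have "K x = 0" using z E(3) by blast
        then show ?thesis by simp
      qed simp
    qed
    ultimately show ?thesis by simp
  qed
  have id: "?L x = (partial 2 (G 1) x - partial 1 (G 2) x) + ?R x" for x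
  proof (cases "x \<in> B")
    case True
    from symmetric_second_derivative[OF B w True, of "axis 1 1" "axis 2 1"] show ?thesis
      unfolding dG by (simp add: algebra_simps)
  qed (simp add: dG)
  have "(\<integral>x. ?L x \<partial>lborel) = (\<integral>x. (partial 2 (G 1) x - partial 1 (G 2) x) + ?R x \<partial>lborel)"
    unfolding id ..
  also have "\<dots> = (\<integral>x. partial 2 (G 1) x - partial 1 (G 2) x \<partial>lborel) + (\<integral>x. ?R x \<partial>lborel)"
    by (intro Bochner_Integration.integral_add Bochner_Integration.integrable_diff int(2) Rint)
  also have "(\<integral>x. partial 2 (G 1) x - partial 1 (G 2) x \<partial>lborel) = 0"
    using int by (subst Bochner_Integration.integral_diff) auto
  finally show "(\<integral>x. ?L x \<partial>lborel) = (\<integral>x. ?R x \<partial>lborel)" by simp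
  show "integrable lborel ?R" by (rule Rint)
  show "continuous_on UNIV ?R" by (rule smooth_on_imp_continuous_on[OF uw])
qed


section \<open>Explicit compactly supported flows in the plane\<close>

text \<open>A shear-like stretching with Jacobian determinant \<open>exp (\<beta> x\<^sub>i)\<close> and an area-preserving rotation
  about the origin whose angle depends on the radius only and vanishes outside the disc of radius \<open>r\<close>.\<close>

definition stretch :: "real \<Rightarrow> 2 \<Rightarrow> real^2 \<Rightarrow> real^2" where
  "stretch \<beta> i x = (\<chi> k. if k = i then x $ k else x $ k * exp (\<beta> * x $ i))"

definition sq_radius :: "real^2 \<Rightarrow> real" where
  "sq_radius y = (y $ 1)\<^sup>2 + (y $ 2)\<^sup>2"

definition twist :: "real \<Rightarrow> real \<Rightarrow> real^2 \<Rightarrow> real^2" where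
  "twist r t y = (let \<theta> = t * flat_exp 2 (r\<^sup>2 - sq_radius y) in
     \<chi> k. if k = 1 then cos \<theta> * y $ 1 - sin \<theta> * y $ 2 else sin \<theta> * y $ 1 + cos \<theta> * y $ 2)"

definition swirl :: "real \<Rightarrow> 2 \<Rightarrow> real^2 \<Rightarrow> real \<Rightarrow> real \<Rightarrow> real^2 \<Rightarrow> real^2" where
  "swirl \<beta> i x0 r t x = x0 + stretch (- \<beta>) i (twist r t (stretch \<beta> i (x - x0)))"

definition bump :: "real \<Rightarrow> 2 \<Rightarrow> real^2 \<Rightarrow> real \<Rightarrow> real^2 \<Rightarrow> real" where
  "bump \<beta> i x0 r x = flat_exp 0 (r\<^sup>2 - sq_radius (stretch \<beta> i (x - x0)))"

definition swirl_support :: "real \<Rightarrow> 2 \<Rightarrow> real^2 \<Rightarrow> real \<Rightarrow> (real^2) set" where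
  "swirl_support \<beta> i x0 r = {x. sq_radius (stretch \<beta> i (x - x0)) \<le> r\<^sup>2}"

lemma stretch_inverse: "stretch (- \<beta>) i (stretch \<beta> i x) = x" "stretch \<beta> i (stretch (- \<beta>) i x) = x"
  by (auto simp: stretch_def vec_eq_iff mult.assoc exp_minus)

lemma stretch_nth_same: "stretch \<beta> i x $ i = x $ i"
  by (simp add: stretch_def)

lemma sq_radius_twist: "sq_radius (twist r t y) = sq_radius y"
proof -
  have "(c * a - s * b)\<^sup>2 + (s * a + c * b)\<^sup>2 = (s\<^sup>2 + c\<^sup>2) * (a\<^sup>2 + b\<^sup>2)" for a b c s :: real
    by (simp add: power2_eq_square algebra_simps)
  then show ?thesis by (simp add: twist_def sq_radius_def Let_def)
qed

lemma twist_add: "twist r s (twist r t y) = twist r (s + t) y"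
proof -
  define k where "k = flat_exp 2 (r\<^sup>2 - sq_radius y)"
  have "twist r s (twist r t y) = (\<chi> j. if j = 1 then cos (s * k) * twist r t y $ 1 - sin (s * k) * twist r t y $ 2
      else sin (s * k) * twist r t y $ 1 + cos (s * k) * twist r t y $ 2)"
    by (subst twist_def) (simp only: sq_radius_twist k_def[symmetric] Let_def)
  then show ?thesis
    by (simp add: twist_def Let_def k_def[symmetric] vec_eq_iff forall_2 distrib_right cos_add sin_add algebra_simps)
qed

lemma twist_outside: "r\<^sup>2 \<le> sq_radius y \<Longrightarrow> twist r t y = y"
  by (simp add: twist_def flat_exp_eq_0 vec_eq_iff forall_2)

lemma twist_0: "twist r 0 y = y"
  by (simp add: twist_def vec_eq_iff forall_2)

lemma swirl_add: "swirl \<beta> i x0 r s (swirl \<beta> i x0 r t x) = swirl \<beta> i x0 r (s + t) x"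
  by (simp add: swirl_def stretch_inverse twist_add)

lemma swirl_0: "swirl \<beta> i x0 r 0 x = x"
  by (simp add: swirl_def stretch_inverse twist_0)

text \<open>The swirl moves only points of the compact set \<open>swirl_support\<close> and maps this set to itself, so that it can be
  transplanted to a surface by one chart.\<close>

lemma swirl_outside: "x \<notin> swirl_support \<beta> i x0 r \<Longrightarrow> swirl \<beta> i x0 r t x = x"
  by (simp add: swirl_def swirl_support_def twist_outside stretch_inverse)

lemma swirl_in_support: "x \<in> swirl_support \<beta> i x0 r \<Longrightarrow> swirl \<beta> i x0 r t x \<in> swirl_support \<beta> i x0 r"
  by (simp add: swirl_def swirl_support_def stretch_inverse sq_radius_twist)

lemma bump_outside: "x \<notin> swirl_support \<beta> i x0 r \<Longrightarrow> bump \<beta> i x0 r x = 0"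
  by (simp add: bump_def swirl_support_def flat_exp_eq_0)

lemma bump_nonneg: "0 \<le> bump \<beta> i x0 r x"
  by (simp add: bump_def flat_exp_nonneg)

lemma bump_center_pos: "0 < r \<Longrightarrow> 0 < bump \<beta> i x0 r x0"
  by (simp add: bump_def flat_exp_pos sq_radius_def stretch_def)

lemma smooth_on_stretch:
  assumes "smooth_on S f"
  shows "smooth_on S (\<lambda>z. stretch \<beta> i (f z))"
  unfolding stretch_def
proof (rule smooth_on_vec_lambda)
  fix k
  have "smooth_on S (\<lambda>z. f z $ k * exp (\<beta> * f z $ i))"
    by (intro smooth_on_mult smooth_on_exp smooth_on_vec_nth assms smooth_on_const)
  then show "smooth_on S (\<lambda>z. if k = i then f z $ k else f z $ k * exp (\<beta> * f z $ i))"
    using smooth_on_vec_nth[OF assms, of k] by (cases "k = i") simp_all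
qed

lemma smooth_on_sq_radius: "smooth_on S f \<Longrightarrow> smooth_on S (\<lambda>z. sq_radius (f z))"
  unfolding sq_radius_def power2_eq_square by (intro smooth_on_add smooth_on_mult smooth_on_vec_nth)

lemma smooth_on_twist:
  assumes t: "smooth_on S t" and f: "smooth_on S f"
  shows "smooth_on S (\<lambda>z. twist r (t z) (f z))"
  unfolding twist_def Let_def
proof (rule smooth_on_vec_lambda)
  fix k :: 2
  have th: "smooth_on S (\<lambda>z. t z * flat_exp 2 (r\<^sup>2 - sq_radius (f z)))"
    by (intro smooth_on_mult smooth_on_flat_exp smooth_on_diff smooth_on_const smooth_on_sq_radius t f)
  show "smooth_on S (\<lambda>z. if k = 1 then cos (t z * flat_exp 2 (r\<^sup>2 - sq_radius (f z))) * f z $ 1 - sin (t z * flat_exp 2 (r\<^sup>2 - sq_radius (f z))) * f z $ 2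
     else sin (t z * flat_exp 2 (r\<^sup>2 - sq_radius (f z))) * f z $ 1 + cos (t z * flat_exp 2 (r\<^sup>2 - sq_radius (f z))) * f z $ 2)"
    by (cases "k = 1")
       (simp_all add: smooth_on_diff smooth_on_add smooth_on_mult smooth_on_sin smooth_on_cos smooth_on_vec_nth th f)
qed

lemma smooth_on_swirl: "smooth_on S (\<lambda>(t, x). swirl \<beta> i x0 r t x)"
proof -
  have "smooth_on S (\<lambda>z. swirl \<beta> i x0 r (fst z) (snd z))"
    unfolding swirl_def
    by (intro smooth_on_add smooth_on_const smooth_on_stretch smooth_on_twist smooth_on_diff
        smooth_on_bounded_linear bounded_linear_fst bounded_linear_snd)
  then show ?thesis by (simp add: case_prod_beta')
qed

lemma smooth_on_bump: "smooth_on S (bump \<beta> i x0 r)"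
proof -
  have "smooth_on S (\<lambda>x. bump \<beta> i x0 r x)"
    unfolding bump_def
    by (intro smooth_on_flat_exp smooth_on_diff smooth_on_const smooth_on_sq_radius smooth_on_stretch smooth_on_id)
  then show ?thesis by simp
qed

lemma closed_swirl_support: "closed (swirl_support \<beta> i x0 r)"
proof -
  have "continuous_on UNIV (\<lambda>x. sq_radius (stretch \<beta> i (x - x0)))"
    by (intro smooth_on_imp_continuous_on smooth_on_sq_radius smooth_on_stretch smooth_on_diff smooth_on_id smooth_on_const)
  then show ?thesis unfolding swirl_support_def by (intro closed_Collect_le continuous_on_const)
qed

text \<open>The support shrinks to its centre, as the stretching is a homeomorphism fixing the origin.\<close>

lemma swirl_support_small:
  assumes "0 < R"
  obtains r where "0 < r" "swirl_support \<beta> i x0 r \<subseteq> ball x0 R"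
proof -
  have "continuous_on UNIV (stretch (- \<beta>) i)"
    using smooth_on_imp_continuous_on[OF smooth_on_stretch[OF smooth_on_id]] by simp
  then have "isCont (stretch (- \<beta>) i) 0" by (simp add: continuous_on_eq_continuous_at)
  then obtain d where d: "d > 0" "\<And>y. dist y 0 < d \<Longrightarrow> dist (stretch (- \<beta>) i y) (stretch (- \<beta>) i 0) < R"
    using assms unfolding continuous_at_eps_delta dist_norm[symmetric] by (metis dist_norm)
  have z: "stretch (- \<beta>) i 0 = 0" by (simp add: stretch_def vec_eq_iff)
  have "swirl_support \<beta> i x0 (d/2) \<subseteq> ball x0 R"
  proof
    fix x assume "x \<in> swirl_support \<beta> i x0 (d/2)"
    then have le: "sq_radius (stretch \<beta> i (x - x0)) \<le> (d/2)\<^sup>2" by (simp add: swirl_support_def)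
    have "norm (stretch \<beta> i (x - x0)) = sqrt (sq_radius (stretch \<beta> i (x - x0)))"
      by (simp add: norm_vec_def L2_set_def sum_2 sq_radius_def)
    also have "\<dots> \<le> sqrt ((d/2)\<^sup>2)" using le by (rule real_sqrt_le_mono)
    also have "\<dots> < d" using d by simp
    finally have "dist (stretch (- \<beta>) i (stretch \<beta> i (x - x0))) 0 < R" using d(2)[of "stretch \<beta> i (x - x0)"] z by simp
    then show "x \<in> ball x0 R" by (simp add: stretch_inverse dist_norm norm_minus_commute)
  qed
  then show ?thesis using d by (intro that[of "d/2"]) auto
qed

lemma has_derivative_vecI:
  fixes f :: "'a::real_normed_vector \<Rightarrow> real^'n"
  assumes "\<And>k. ((\<lambda>x. f x $ k) has_derivative (\<lambda>h. f' h $ k)) (at a)"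
  shows "(f has_derivative f') (at a)"
  unfolding has_derivative_componentwise_within[of f f' a UNIV]
  using assms by (auto simp: Basis_vec_def inner_axis)

lemma stretch_has_derivative:
  "\<exists>L. (stretch \<beta> i has_derivative L) (at x) \<and> det (matrix L) = exp (\<beta> * x $ i)"
proof -
  define L where "L = (\<lambda>h::real^2. \<chi> k. if k = i then h $ k else (h $ k + \<beta> * x $ k * h $ i) * exp (\<beta> * x $ i))"
  have "(stretch \<beta> i has_derivative L) (at x)"
  proof (rule has_derivative_vecI)
    fix k
    have nth: "((\<lambda>x::real^2. x $ k) has_derivative (\<lambda>h. h $ k)) (at x)" for k
      by (rule bounded_linear_imp_has_derivative[OF bounded_linear_vec_nth])
    show "((\<lambda>x. stretch \<beta> i x $ k) has_derivative (\<lambda>h. L h $ k)) (at x)"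
    proof (cases "k = i")
      case False
      have "((\<lambda>x::real^2. x $ k * exp (\<beta> * x $ i)) has_derivative (\<lambda>h. x $ k * (exp (\<beta> * x $ i) * (\<beta> * h $ i)) + h $ k * exp (\<beta> * x $ i))) (at x)"
        by (intro has_derivative_mult nth has_derivative_compose[OF has_derivative_mult_right[OF nth, of \<beta> i] DERIV_exp[THEN has_field_derivative_imp_has_derivative]])
      moreover have "(\<lambda>h. x $ k * (exp (\<beta> * x $ i) * (\<beta> * h $ i)) + h $ k * exp (\<beta> * x $ i)) = (\<lambda>h. L h $ k)"
        using False by (simp add: L_def fun_eq_iff algebra_simps)
      moreover have "(\<lambda>x::real^2. x $ k * exp (\<beta> * x $ i)) = (\<lambda>x. stretch \<beta> i x $ k)"
        using False by (simp add: stretch_def fun_eq_iff)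
      ultimately show ?thesis by simp
    qed (simp add: stretch_def L_def nth)
  qed
  moreover have "det (matrix L) = exp (\<beta> * x $ i)"
    using exhaust_2[of i] by (auto simp: det_matrix_real2 L_def axis_def)
  ultimately show ?thesis by blast
qed

text \<open>The angle has a radial gradient, so the variation of the angle displaces points tangentially to the
  circles only: the rank-one correction to the rotation matrix does not change its determinant.\<close>

lemma twist_has_derivative:
  "\<exists>L. (twist r t has_derivative L) (at y) \<and> det (matrix L) = 1"
proof -
  define a where "a = y $ 1"
  define b where "b = y $ 2"
  define \<theta> where "\<theta> y = t * flat_exp 2 (r\<^sup>2 - sq_radius y)" for y
  define m where "m = t * (flat_exp 4 (r\<^sup>2 - sq_radius y) - 2 * flat_exp 3 (r\<^sup>2 - sq_radius y)) * (-2)"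
  define d where "d h = m * (a * h $ 1 + b * h $ 2)" for h :: "real^2"
  have nth: "((\<lambda>x::real^2. x $ k) has_derivative (\<lambda>h. h $ k)) (at y)" for k
    by (rule bounded_linear_imp_has_derivative[OF bounded_linear_vec_nth])
  have sq: "((\<lambda>y. r\<^sup>2 - sq_radius y) has_derivative (\<lambda>h. - (2 * (a * h $ 1 + b * h $ 2)))) (at y)"
  proof -
    have "((\<lambda>y::real^2. r\<^sup>2 - (y $ 1 * y $ 1 + y $ 2 * y $ 2)) has_derivative
        (\<lambda>h. 0 - ((y $ 1 * h $ 1 + h $ 1 * y $ 1) + (y $ 2 * h $ 2 + h $ 2 * y $ 2)))) (at y)"
      by (intro has_derivative_diff has_derivative_const has_derivative_add has_derivative_mult nth)
    moreover have "(\<lambda>h::real^2. 0 - ((y $ 1 * h $ 1 + h $ 1 * y $ 1) + (y $ 2 * h $ 2 + h $ 2 * y $ 2))) = (\<lambda>h. - (2 * (a * h $ 1 + b * h $ 2)))"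
      by (simp add: fun_eq_iff a_def b_def algebra_simps)
    ultimately show ?thesis by (simp add: sq_radius_def power2_eq_square)
  qed
  have "((\<lambda>y. flat_exp 2 (r\<^sup>2 - sq_radius y)) has_derivative
      (\<lambda>h. (flat_exp 4 (r\<^sup>2 - sq_radius y) - 2 * flat_exp 3 (r\<^sup>2 - sq_radius y)) * (- (2 * (a * h $ 1 + b * h $ 2))))) (at y)"
    using has_derivative_compose[OF sq flat_exp_deriv[of 2 "r\<^sup>2 - sq_radius y", THEN has_field_derivative_imp_has_derivative]] by simp
  from has_derivative_mult_right[OF this, of t]
  have "(\<theta> has_derivative (\<lambda>h. t * ((flat_exp 4 (r\<^sup>2 - sq_radius y) - 2 * flat_exp 3 (r\<^sup>2 - sq_radius y)) * (- (2 * (a * h $ 1 + b * h $ 2)))))) (at y)"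
    by (simp only: \<theta>_def[abs_def])
  moreover have "(\<lambda>h. t * ((flat_exp 4 (r\<^sup>2 - sq_radius y) - 2 * flat_exp 3 (r\<^sup>2 - sq_radius y)) * (- (2 * (a * h $ 1 + b * h $ 2))))) = d"
    by (simp add: d_def m_def fun_eq_iff algebra_simps)
  ultimately have th: "(\<theta> has_derivative d) (at y)" by simp
  have co: "((\<lambda>y. cos (\<theta> y)) has_derivative (\<lambda>h. - sin (\<theta> y) * d h)) (at y)"
    by (rule has_derivative_compose[OF th DERIV_cos[THEN has_field_derivative_imp_has_derivative]])
  have si: "((\<lambda>y. sin (\<theta> y)) has_derivative (\<lambda>h. cos (\<theta> y) * d h)) (at y)"
    by (rule has_derivative_compose[OF th DERIV_sin[THEN has_field_derivative_imp_has_derivative]])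
  define C where "C = cos (\<theta> y)"
  define S where "S = sin (\<theta> y)"
  have CS: "C * C + S * S = 1" using sin_cos_squared_add2[of "\<theta> y"] by (simp add: C_def S_def power2_eq_square add.commute)
  define L where "L = (\<lambda>h::real^2. \<chi> k::2. if k = 1 then C * h $ 1 - S * h $ 2 - (S * a + C * b) * d h
      else S * h $ 1 + C * h $ 2 + (C * a - S * b) * d h)"
  have "(twist r t has_derivative L) (at y)"
  proof (rule has_derivative_vecI)
    fix k :: 2
    consider "k = 1" | "k = 2" using exhaust_2 by blast
    then show "((\<lambda>x. twist r t x $ k) has_derivative (\<lambda>h. L h $ k)) (at y)"
    proof cases
      case 1
      have "((\<lambda>y. cos (\<theta> y) * y $ 1 - sin (\<theta> y) * y $ 2) has_derivative
          (\<lambda>h. (cos (\<theta> y) * h $ 1 + - sin (\<theta> y) * d h * y $ 1) - (sin (\<theta> y) * h $ 2 + cos (\<theta> y) * d h * y $ 2))) (at y)"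
        by (intro has_derivative_diff has_derivative_mult co si nth)
      moreover have "(\<lambda>h. (cos (\<theta> y) * h $ 1 + - sin (\<theta> y) * d h * y $ 1) - (sin (\<theta> y) * h $ 2 + cos (\<theta> y) * d h * y $ 2)) = (\<lambda>h. L h $ k)"
        by (simp add: 1 L_def C_def S_def a_def b_def fun_eq_iff algebra_simps)
      moreover have "(\<lambda>y. cos (\<theta> y) * y $ 1 - sin (\<theta> y) * y $ 2) = (\<lambda>x. twist r t x $ k)"
        by (simp add: 1 twist_def \<theta>_def Let_def fun_eq_iff)
      ultimately show ?thesis by simp
    next
      case 2
      have "((\<lambda>y. sin (\<theta> y) * y $ 1 + cos (\<theta> y) * y $ 2) has_derivative
          (\<lambda>h. (sin (\<theta> y) * h $ 1 + cos (\<theta> y) * d h * y $ 1) + (cos (\<theta> y) * h $ 2 + - sin (\<theta> y) * d h * y $ 2))) (at y)"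
        by (intro has_derivative_add has_derivative_mult co si nth)
      moreover have "(\<lambda>h. (sin (\<theta> y) * h $ 1 + cos (\<theta> y) * d h * y $ 1) + (cos (\<theta> y) * h $ 2 + - sin (\<theta> y) * d h * y $ 2)) = (\<lambda>h. L h $ k)"
        by (simp add: 2 L_def C_def S_def a_def b_def fun_eq_iff algebra_simps)
      moreover have "(\<lambda>y. sin (\<theta> y) * y $ 1 + cos (\<theta> y) * y $ 2) = (\<lambda>x. twist r t x $ k)"
        by (simp add: 2 twist_def \<theta>_def Let_def fun_eq_iff)
      ultimately show ?thesis by simp
    qed
  qed
  moreover have "det (matrix L) = 1"
  proof -
    have "det (matrix L) = (C - (S * a + C * b) * (m * a)) * (C + (C * a - S * b) * (m * b))
        - (- S - (S * a + C * b) * (m * b)) * (S + (C * a - S * b) * (m * a))"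
      by (simp add: det_matrix_real2 L_def d_def axis_def)
    also have "\<dots> = (C * C + S * S)" by (simp add: algebra_simps)
    finally show ?thesis by (simp add: CS)
  qed
  ultimately show ?thesis by blast
qed

text \<open>With \<open>\<sigma>(x) = exp (\<beta> (x\<^sub>i - x0\<^sub>i))\<close>, the swirl preserves the area form \<open>\<sigma> dx\<close>.\<close>

lemma swirl_has_derivative:
  "\<exists>L. (swirl \<beta> i x0 r t has_derivative L) (at x) \<and>
     det (matrix L) = exp (\<beta> * (x $ i - x0 $ i)) / exp (\<beta> * (swirl \<beta> i x0 r t x $ i - x0 $ i))"
proof -
  define y where "y = stretch \<beta> i (x - x0)"
  define y' where "y' = twist r t y"
  obtain A where A: "(stretch \<beta> i has_derivative A) (at (x - x0))" "det (matrix A) = exp (\<beta> * (x - x0) $ i)"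
    using stretch_has_derivative by blast
  obtain P where P: "(twist r t has_derivative P) (at y)" "det (matrix P) = 1" using twist_has_derivative by blast
  obtain B where B: "(stretch (- \<beta>) i has_derivative B) (at y')" "det (matrix B) = exp (- \<beta> * y' $ i)"
    using stretch_has_derivative by blast
  have "((\<lambda>x. x - x0) has_derivative (\<lambda>h. h)) (at x)" by (auto intro!: derivative_eq_intros)
  from has_derivative_compose[OF this A(1)]
  have "((\<lambda>x. stretch \<beta> i (x - x0)) has_derivative A) (at x)" .
  from has_derivative_compose[OF this P(1)[unfolded y_def]]
  have "((\<lambda>x. twist r t (stretch \<beta> i (x - x0))) has_derivative (\<lambda>h. P (A h))) (at x)" .
  from has_derivative_compose[OF this B(1)[unfolded y'_def y_def]]
  have "((\<lambda>x. stretch (- \<beta>) i (twist r t (stretch \<beta> i (x - x0)))) has_derivative (\<lambda>h. B (P (A h)))) (at x)" .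
  from has_derivative_add[OF has_derivative_const[of x0] this]
  have "(swirl \<beta> i x0 r t has_derivative (B \<circ> (P \<circ> A))) (at x)" by (simp add: swirl_def[abs_def] o_def)
  moreover have "det (matrix (B \<circ> (P \<circ> A))) = exp (- \<beta> * y' $ i) * (1 * exp (\<beta> * (x - x0) $ i))"
    using A P B has_derivative_linear[OF A(1)] has_derivative_linear[OF P(1)] has_derivative_linear[OF B(1)]
    by (simp add: det_matrix_compose linear_compose del: o_assoc)
  moreover have "y' $ i = swirl \<beta> i x0 r t x $ i - x0 $ i"
    by (simp add: swirl_def y'_def y_def stretch_nth_same)
  ultimately show ?thesis
    by (intro exI[of _ "B \<circ> (P \<circ> A)"]) (simp add: exp_minus divide_inverse mult.commute)
qed

text \<open>The swirl is the Hamiltonian flow of half the bump function with respect to \<open>\<sigma> dx\<close>.\<close>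

lemma swirl_hamiltonian:
  obtains v K1 K2 where "((\<lambda>t. swirl \<beta> i x0 r t x) has_vector_derivative v) (at 0)"
    and "(bump \<beta> i x0 r has_derivative (\<lambda>h. K1 * h $ 1 + K2 * h $ 2)) (at x)"
    and "exp (\<beta> * (x $ i - x0 $ i)) * v $ 1 = K2 / 2" and "exp (\<beta> * (x $ i - x0 $ i)) * v $ 2 = - K1 / 2"
proof -
  define a where "a = x $ 1 - x0 $ 1"
  define b where "b = x $ 2 - x0 $ 2"
  define q where "q = sq_radius (stretch \<beta> i (x - x0))"
  define k where "k = flat_exp 2 (r\<^sup>2 - q)"
  have nth: "((\<lambda>x::real^2. x $ k - x0 $ k) has_derivative (\<lambda>h. h $ k)) (at x)" for k
    using has_derivative_diff[OF bounded_linear_imp_has_derivative[OF bounded_linear_vec_nth] has_derivative_const] by simp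
  have fl: "(flat_exp 0 has_derivative (\<lambda>h. k * h)) (at (r\<^sup>2 - q))"
    using flat_exp_deriv[of 0 "r\<^sup>2 - q"] by (simp add: has_field_derivative_def k_def numeral_2_eq_2)
  have vecI: "(f has_vector_derivative v) (at 0)"
    if "((\<lambda>t. f t $ 1) has_real_derivative v $ 1) (at 0)" "((\<lambda>t. f t $ 2) has_real_derivative v $ 2) (at 0)"
    for f :: "real \<Rightarrow> real^2" and v
    unfolding has_vector_derivative_def
  proof (rule has_derivative_vecI)
    fix j :: 2
    have "(\<lambda>h. (h *\<^sub>R v) $ j) = (*) (v $ j)" by (simp add: fun_eq_iff mult.commute)
    then show "((\<lambda>t. f t $ j) has_derivative (\<lambda>h. (h *\<^sub>R v) $ j)) (at 0)"
      using exhaust_2[of j] that by (auto simp: has_field_derivative_def)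
  qed
  consider (1) "i = 1" | (2) "i = 2" using exhaust_2 by blast
  then show thesis
  proof cases
    case 1
    define e where "e = exp (\<beta> * a)"
    have e: "e > 0" by (simp add: e_def)
    have q: "q = a * a + (b * e) * (b * e)"
      by (simp add: q_def 1 sq_radius_def stretch_def a_def b_def e_def power2_eq_square)
    define v :: "real^2" where "v = (\<chi> j. if j = 1 then - (k * (b * e)) else k * a / e + \<beta> * b * (k * (b * e)))"
    have c1: "swirl \<beta> i x0 r t x $ 1 = x0 $ 1 + (cos (t * k) * a - sin (t * k) * (b * e))" for t
      by (simp add: 1 swirl_def stretch_def twist_def Let_def) (simp add: a_def b_def e_def k_def q_def 1 stretch_def)
    have c2: "swirl \<beta> i x0 r t x $ 2 = x0 $ 2 + (sin (t * k) * a + cos (t * k) * (b * e)) * exp (- \<beta> * (cos (t * k) * a - sin (t * k) * (b * e)))" for t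
      by (simp add: 1 swirl_def stretch_def twist_def Let_def) (simp add: a_def b_def e_def k_def q_def 1 stretch_def)
    have sw: "((\<lambda>t. swirl \<beta> i x0 r t x) has_vector_derivative v) (at 0)"
    proof (rule vecI)
      show "((\<lambda>t. swirl \<beta> i x0 r t x $ 1) has_real_derivative v $ 1) (at 0)"
        unfolding c1 by (auto intro!: derivative_eq_intros simp: v_def)
      have ex: "exp (- (\<beta> * a)) = 1 / e" by (simp add: e_def exp_minus divide_inverse)
      show "((\<lambda>t. swirl \<beta> i x0 r t x $ 2) has_real_derivative v $ 2) (at 0)"
        unfolding c2 using e by (auto intro!: derivative_eq_intros simp: v_def ex field_simps)
    qed
    define K1 where "K1 = - (k * (2 * a + 2 * \<beta> * (b * e) * (b * e)))"
    define K2 where "K2 = - (k * (2 * (b * e) * e))"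
    have Q: "((\<lambda>x. r\<^sup>2 - sq_radius (stretch \<beta> i (x - x0))) has_derivative
        (\<lambda>h. - ((2 * a + 2 * \<beta> * (b * e) * (b * e)) * h $ 1 + (2 * (b * e) * e) * h $ 2))) (at x)"
    proof -
      have E: "((\<lambda>x::real^2. exp (\<beta> * (x $ 1 - x0 $ 1))) has_derivative (\<lambda>h. e * (\<beta> * h $ 1))) (at x)"
        using has_derivative_compose[OF has_derivative_mult_right[OF nth, of \<beta> 1] DERIV_exp[THEN has_field_derivative_imp_has_derivative]]
        by (simp add: e_def a_def)
      have P: "((\<lambda>x::real^2. (x $ 2 - x0 $ 2) * exp (\<beta> * (x $ 1 - x0 $ 1))) has_derivative (\<lambda>h. b * (e * (\<beta> * h $ 1)) + h $ 2 * e)) (at x)"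
        using has_derivative_mult[OF nth E, of 2] by (simp add: e_def a_def b_def)
      have "((\<lambda>x::real^2. r\<^sup>2 - ((x $ 1 - x0 $ 1) * (x $ 1 - x0 $ 1) + ((x $ 2 - x0 $ 2) * exp (\<beta> * (x $ 1 - x0 $ 1))) * ((x $ 2 - x0 $ 2) * exp (\<beta> * (x $ 1 - x0 $ 1))))) has_derivative
          (\<lambda>h. 0 - ((a * h $ 1 + h $ 1 * a) + ((b * e) * (b * (e * (\<beta> * h $ 1)) + h $ 2 * e) + (b * (e * (\<beta> * h $ 1)) + h $ 2 * e) * (b * e))))) (at x)"
        using has_derivative_diff[OF has_derivative_const has_derivative_add[OF has_derivative_mult[OF nth nth, of 1 1] has_derivative_mult[OF P P]], of "r\<^sup>2"]
        by (simp add: e_def a_def b_def)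
      then show ?thesis
        by (simp add: 1 sq_radius_def stretch_def power2_eq_square algebra_simps)
    qed
    have b1: "(bump \<beta> i x0 r has_derivative (\<lambda>h. k * - ((2 * a + 2 * \<beta> * (b * e) * (b * e)) * h $ 1 + (2 * (b * e) * e) * h $ 2))) (at x)"
      using has_derivative_compose[OF Q, of "flat_exp 0" "\<lambda>h. k * h"] fl by (simp add: bump_def[abs_def] q_def)
    have b2: "(\<lambda>h::real^2. k * - ((2 * a + 2 * \<beta> * (b * e) * (b * e)) * h $ 1 + (2 * (b * e) * e) * h $ 2)) = (\<lambda>h. K1 * h $ 1 + K2 * h $ 2)"
      by (simp add: K1_def K2_def fun_eq_iff algebra_simps)
    have ex: "exp (\<beta> * (x $ i - x0 $ i)) = e" by (simp add: 1 e_def a_def)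
    show thesis
    proof (rule that[OF sw b1[unfolded b2]])
      show "exp (\<beta> * (x $ i - x0 $ i)) * v $ 1 = K2 / 2" "exp (\<beta> * (x $ i - x0 $ i)) * v $ 2 = - K1 / 2"
        unfolding ex using e by (simp_all add: v_def K1_def K2_def field_simps)
    qed
  next
    case 2
    define e where "e = exp (\<beta> * b)"
    have e: "e > 0" by (simp add: e_def)
    define v :: "real^2" where "v = (\<chi> j. if j = 1 then - (k * b / e) - \<beta> * a * (k * (a * e)) else k * (a * e))"
    have c1: "swirl \<beta> i x0 r t x $ 1 = x0 $ 1 + (cos (t * k) * (a * e) - sin (t * k) * b) * exp (- \<beta> * (sin (t * k) * (a * e) + cos (t * k) * b))" for t
      by (simp add: 2 swirl_def stretch_def twist_def Let_def) (simp add: a_def b_def e_def k_def q_def 2 stretch_def)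
    have c2: "swirl \<beta> i x0 r t x $ 2 = x0 $ 2 + (sin (t * k) * (a * e) + cos (t * k) * b)" for t
      by (simp add: 2 swirl_def stretch_def twist_def Let_def) (simp add: a_def b_def e_def k_def q_def 2 stretch_def)
    have sw: "((\<lambda>t. swirl \<beta> i x0 r t x) has_vector_derivative v) (at 0)"
    proof (rule vecI)
      show "((\<lambda>t. swirl \<beta> i x0 r t x $ 2) has_real_derivative v $ 2) (at 0)"
        unfolding c2 by (auto intro!: derivative_eq_intros simp: v_def)
      have ex: "exp (- (\<beta> * b)) = 1 / e" by (simp add: e_def exp_minus divide_inverse)
      show "((\<lambda>t. swirl \<beta> i x0 r t x $ 1) has_real_derivative v $ 1) (at 0)"
        unfolding c1 using e by (auto intro!: derivative_eq_intros simp: v_def ex field_simps)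
    qed
    define K1 where "K1 = - (k * (2 * (a * e) * e))"
    define K2 where "K2 = - (k * (2 * b + 2 * \<beta> * (a * e) * (a * e)))"
    have Q: "((\<lambda>x. r\<^sup>2 - sq_radius (stretch \<beta> i (x - x0))) has_derivative
        (\<lambda>h. - ((2 * (a * e) * e) * h $ 1 + (2 * b + 2 * \<beta> * (a * e) * (a * e)) * h $ 2))) (at x)"
    proof -
      have E: "((\<lambda>x::real^2. exp (\<beta> * (x $ 2 - x0 $ 2))) has_derivative (\<lambda>h. e * (\<beta> * h $ 2))) (at x)"
        using has_derivative_compose[OF has_derivative_mult_right[OF nth, of \<beta> 2] DERIV_exp[THEN has_field_derivative_imp_has_derivative]]
        by (simp add: e_def b_def)
      have P: "((\<lambda>x::real^2. (x $ 1 - x0 $ 1) * exp (\<beta> * (x $ 2 - x0 $ 2))) has_derivative (\<lambda>h. a * (e * (\<beta> * h $ 2)) + h $ 1 * e)) (at x)"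
        using has_derivative_mult[OF nth E, of 1] by (simp add: e_def a_def b_def)
      have "((\<lambda>x::real^2. r\<^sup>2 - (((x $ 1 - x0 $ 1) * exp (\<beta> * (x $ 2 - x0 $ 2))) * ((x $ 1 - x0 $ 1) * exp (\<beta> * (x $ 2 - x0 $ 2))) + (x $ 2 - x0 $ 2) * (x $ 2 - x0 $ 2))) has_derivative
          (\<lambda>h. 0 - (((a * e) * (a * (e * (\<beta> * h $ 2)) + h $ 1 * e) + (a * (e * (\<beta> * h $ 2)) + h $ 1 * e) * (a * e)) + (b * h $ 2 + h $ 2 * b)))) (at x)"
        using has_derivative_diff[OF has_derivative_const has_derivative_add[OF has_derivative_mult[OF P P] has_derivative_mult[OF nth nth, of 2 2]], of "r\<^sup>2"]
        by (simp add: e_def a_def b_def)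
      then show ?thesis
        by (simp add: 2 sq_radius_def stretch_def power2_eq_square algebra_simps)
    qed
    have b1: "(bump \<beta> i x0 r has_derivative (\<lambda>h. k * - ((2 * (a * e) * e) * h $ 1 + (2 * b + 2 * \<beta> * (a * e) * (a * e)) * h $ 2))) (at x)"
      using has_derivative_compose[OF Q, of "flat_exp 0" "\<lambda>h. k * h"] fl by (simp add: bump_def[abs_def] q_def)
    have b2: "(\<lambda>h::real^2. k * - ((2 * (a * e) * e) * h $ 1 + (2 * b + 2 * \<beta> * (a * e) * (a * e)) * h $ 2)) = (\<lambda>h. K1 * h $ 1 + K2 * h $ 2)"
      by (simp add: K1_def K2_def fun_eq_iff algebra_simps)
    have ex: "exp (\<beta> * (x $ i - x0 $ i)) = e" by (simp add: 2 e_def b_def)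
    show thesis
    proof (rule that[OF sw b1[unfolded b2]])
      show "exp (\<beta> * (x $ i - x0 $ i)) * v $ 1 = K2 / 2" "exp (\<beta> * (x $ i - x0 $ i)) * v $ 2 = - K1 / 2"
        unfolding ex using e by (simp_all add: v_def K1_def K2_def field_simps)
    qed
  qed
qed


section \<open>Flows on a surface supported in one chart\<close>

text \<open>Boundary points are never mapped to interior points by a transition map: its second component
  would have a local minimum at an interior point, so that its derivative would be singular.\<close>

lemma interior_point_invariant:
  assumes N: "oriented_surface N" and c: "c \<in> charts_at N p" and d: "d \<in> charts_at N p" and pos: "0 < snd c p $ 2"
  shows "0 < snd d p $ 2"
proof (rule ccontr)
  note ca = charts_atD[OF c] and da = charts_atD[OF d]
  note C = oriented_surfaceD(2)[OF N ca(1)] and D = oriented_surfaceD(2)[OF N da(1)]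
  let ?x = "snd c p" and ?t = "local_rep c d id"
  assume "\<not> 0 < snd d p $ 2"
  moreover have "snd d p \<in> half_plane" using is_chartD(5)[OF D] chart_in_image[OF da(2)] by blast
  ultimately have z: "snd d p $ 2 = 0" by (simp add: half_plane_def)
  obtain W where W: "open W" "local_dom c d id = half_plane \<inter> W"
    using local_dom_openin[OF C D smooth_mapD(1)[OF oriented_surfaceD(4)[OF N]]] openin_half_plane_iff by auto
  define G where "G = W \<inter> {x. 0 < x $ 2}"
  have G: "open G" unfolding G_def using W(1) by (intro open_Int open_Collect_less continuous_intros)
  have Osub: "G \<subseteq> local_dom c d id" unfolding W(2) G_def by (auto simp: half_plane_def)
  have xdom: "?x \<in> local_dom c d id" by (rule local_domI) (use ca da in auto)
  have xO: "?x \<in> G" using xdom W pos by (auto simp: G_def)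
  have "(?t has_derivative local_deriv c d id p) (at ?x within local_dom c d id)"
    by (rule smooth_map_local_deriv[OF oriented_surfaceD(4)[OF N] c]) (simp add: d)
  from has_derivative_subset[OF this Osub]
  have der: "(?t has_derivative local_deriv c d id p) (at ?x)" using at_within_open[OF xO G] by simp
  have "((\<lambda>y. ?t y $ 2) has_derivative (\<lambda>h. local_deriv c d id p h $ 2)) (at ?x)"
    by (rule bounded_linear.has_derivative[OF bounded_linear_vec_nth der])
  moreover have "eventually (\<lambda>y. ?t ?x $ 2 \<le> ?t y $ 2) (at ?x)"
  proof -
    have "0 \<le> ?t y $ 2" if y: "y \<in> G" for y
    proof -
      have "y \<in> local_dom c d id" using y Osub by blast
      then obtain q where q: "q \<in> fst c" "q \<in> fst d" "y = snd c q" by (auto simp: local_dom_def)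
      then have "?t y \<in> half_plane" using is_chartD(5)[OF D] chart_in_image[OF q(2)] by (auto simp: local_rep_apply[OF C])
      then show ?thesis by (simp add: half_plane_def)
    qed
    moreover have "?t ?x $ 2 = 0" using z by (simp add: local_rep_apply[OF C ca(2)])
    ultimately show ?thesis unfolding eventually_at_topological using G xO by (intro exI[of _ G]) auto
  qed
  ultimately have "(\<lambda>h. local_deriv c d id p h $ 2) = (\<lambda>h. 0)" by (rule has_derivative_local_min)
  then have "det (matrix (local_deriv c d id p)) = 0" by (simp add: det_matrix_real2 fun_eq_iff)
  then show False using oriented_surfaceD(5)[OF N charts_at_in_points[OF N c] c d] by simp
qed

text \<open>A complete smooth flow in the plane which is the identity off a compact set of interior points of one
  chart defines a flow on the surface.\<close>

locale chart_flow =
  fixes N :: "'a surface" and c :: "'a chart" and E :: "(real^2) set" and F :: "real \<Rightarrow> real^2 \<Rightarrow> real^2"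
  assumes N: "oriented_surface N" and c: "c \<in> atlas N"
    and E: "compact E" "E \<subseteq> chart_image c" and interior: "\<And>x. x \<in> E \<Longrightarrow> 0 < x $ 2"
    and F_smooth: "smooth_on UNIV (\<lambda>(t, x). F t x)"
    and F_0: "F 0 x = x" and F_add: "F s (F t x) = F (s + t) x"
    and F_in: "x \<in> E \<Longrightarrow> F t x \<in> E" and F_out: "x \<notin> E \<Longrightarrow> F t x = x"
begin

definition flow :: "real \<Rightarrow> 'a \<Rightarrow> 'a" where
  "flow t q = (if q \<in> fst c then chart_inv c (F t (snd c q)) else q)"

text \<open>The field is defined as the velocity of the flow at time zero in every chart. Its smoothness, its
  transformation behaviour and the differential equation then follow from smoothness and the
  group law of the flow.\<close>

definition generator :: "'a \<Rightarrow> 'a tangent" where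
  "generator q = (\<lambda>d. if d \<in> charts_at N q then vector_derivative (\<lambda>s. snd d (flow s q)) (at 0) else 0)"

definition core :: "'a set" where
  "core = chart_inv c ` E"

lemma C: "is_chart (surf_top N) c"
  by (rule oriented_surfaceD(2)[OF N c])

lemma F_chart: "x \<in> chart_image c \<Longrightarrow> F t x \<in> chart_image c"
  using F_in[of x t] F_out[of x t] E(2) by (cases "x \<in> E") auto

lemma flow_in_chart:
  assumes "q \<in> fst c" shows "flow t q \<in> fst c" "snd c (flow t q) = F t (snd c q)"
proof -
  have "F t (snd c q) \<in> chart_image c" by (rule F_chart[OF chart_in_image[OF assms]])
  then show "flow t q \<in> fst c" "snd c (flow t q) = F t (snd c q)"
    using assms by (auto simp: flow_def chart_inv_in chart_chart_inv)
qed

lemma flow_outside_chart: "q \<notin> fst c \<Longrightarrow> flow t q = q"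
  by (simp add: flow_def)

lemma flow_add: "flow s (flow t q) = flow (s + t) q"
proof (cases "q \<in> fst c")
  case True
  then show ?thesis using flow_in_chart[OF True, of t] by (simp add: flow_def[of s] flow_def[of "s + t"] F_add)
qed (simp add: flow_outside_chart)

lemma flow_0: "flow 0 q = q"
  by (simp add: flow_def F_0 chart_inv_chart[OF C])

lemma core_subset: "core \<subseteq> fst c"
  unfolding core_def using E(2) by (blast intro: chart_inv_in)

lemma flow_outside_core:
  assumes "q \<notin> core" shows "flow t q = q"
proof (cases "q \<in> fst c")
  case True
  have "snd c q \<notin> E"
  proof
    assume "snd c q \<in> E"
    then have "chart_inv c (snd c q) \<in> core" by (simp add: core_def)
    then show False using assms by (simp add: chart_inv_chart[OF C True])
  qed
  then show ?thesis by (simp add: flow_def F_out chart_inv_chart[OF C])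
qed (simp add: flow_outside_chart)

text \<open>A compact set in a Hausdorff space is closed. Hence the surface is covered by the chart domain and an open set on
  which the flow is stationary; continuity and smoothness are checked on these two.\<close>

lemma openin_outside_core: "openin (surf_top N) (points N - core)"
proof -
  have "compactin (top_of_set (chart_image c)) E" using E by (simp add: compactin_subtopology)
  then have "compactin (surf_top N) core"
    unfolding core_def by (rule image_compactin[OF _ chart_inv_continuous_map[OF C]])
  then have "closedin (surf_top N) core" by (rule compactin_imp_closedin[OF oriented_surfaceD(1)[OF N]])
  then show ?thesis by blast
qed

lemma flow_continuous:
  "continuous_map (prod_topology (top_of_set T) (surf_top N)) (surf_top N) (\<lambda>(t, q). flow t q)"
proof (rule pasting_lemma[where I = UNIV and f = "\<lambda>_::bool. \<lambda>(t, q). flow t q"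
      and T = "\<lambda>i. if i then T \<times> fst c else T \<times> (points N - core)"])
  let ?X = "prod_topology (top_of_set T) (surf_top N)"
  show "openin ?X (if i then T \<times> fst c else T \<times> (points N - core))" for i
    using is_chartD(1)[OF C] openin_outside_core by (simp add: openin_prod_Times_iff)
  fix i :: bool
  show "continuous_map (subtopology ?X (if i then T \<times> fst c else T \<times> (points N - core))) (surf_top N) (\<lambda>(t, q). flow t q)"
  proof (cases i)
    case True
    let ?Y = "prod_topology (top_of_set T) (subtopology (surf_top N) (fst c))"
    have fc: "continuous_map ?Y euclidean (\<lambda>z. F (fst z) (snd c (snd z)))"
    proof -
      have "continuous_map ?Y euclidean (\<lambda>z. snd c (snd z))"
        using continuous_map_compose[OF continuous_map_snd chart_continuous_map[OF C]] by (simp add: o_def)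
      moreover have "continuous_map ?Y euclidean fst"
        by (rule continuous_map_into_fulltopology[OF continuous_map_fst])
      ultimately have "continuous_map ?Y (prod_topology euclidean euclidean) (\<lambda>z. (fst z, snd c (snd z)))"
        by (intro continuous_map_pairedI)
      then have "continuous_map ?Y euclidean (\<lambda>z. (fst z, snd c (snd z)))" by (simp add: euclidean_product_topology)
      moreover have "continuous_map euclidean euclidean (\<lambda>(t, x). F t x)"
        using smooth_on_imp_continuous_on[OF F_smooth] by simp
      ultimately have "continuous_map ?Y euclidean ((\<lambda>(t, x). F t x) \<circ> (\<lambda>z. (fst z, snd c (snd z))))"
        by (rule continuous_map_compose)
      then show ?thesis by (simp add: o_def)
    qed
    have "F (fst z) (snd c (snd z)) \<in> chart_image c" if "z \<in> topspace ?Y" for z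
      by (rule F_chart[OF chart_in_image]) (use that in auto)
    then have "continuous_map ?Y (top_of_set (chart_image c)) (\<lambda>z. F (fst z) (snd c (snd z)))"
      using fc by (auto simp: continuous_map_in_subtopology)
    from continuous_map_compose[OF this chart_inv_continuous_map[OF C]]
    have "continuous_map ?Y (surf_top N) (\<lambda>z. chart_inv c (F (fst z) (snd c (snd z))))" by (simp add: o_def)
    then have "continuous_map ?Y (surf_top N) (\<lambda>(t, q). flow t q)"
      by (rule continuous_map_eq) (auto simp: flow_def)
    then show ?thesis using True by (simp add: subtopology_Times subtopology_subtopology)
  next
    case False
    have "continuous_map (subtopology ?X (T \<times> (points N - core))) (surf_top N) snd"
      by (rule continuous_map_from_subtopology[OF continuous_map_snd])
    then have "continuous_map (subtopology ?X (T \<times> (points N - core))) (surf_top N) (\<lambda>(t, q). flow t q)"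
      by (rule continuous_map_eq) (auto simp: flow_outside_core)
    then show ?thesis using False by simp
  qed
next
  fix z assume "z \<in> topspace (prod_topology (top_of_set T) (surf_top N))"
  then show "\<exists>j. j \<in> UNIV \<and> z \<in> (if j then T \<times> fst c else T \<times> (points N - core)) \<and> (\<lambda>(t, q). flow t q) z = (\<lambda>(t, q). flow t q) z"
    using core_subset by (cases "snd z \<in> fst c") (auto intro!: exI[of _ "snd z \<in> fst c"])
qed simp

lemma flow_smooth:
  assumes a: "a \<in> atlas N" and b: "b \<in> atlas N"
  shows "smooth_on {(t, x). t \<in> T \<and> x \<in> local_dom a b (flow t)} (\<lambda>(t, x). local_rep a b (flow t) x)"
    (is "smooth_on ?S ?f")
proof (rule smooth_on_local)
  note A = oriented_surfaceD(2)[OF N a]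
  note idm = oriented_surfaceD(4)[OF N]
  fix z assume z: "z \<in> ?S"
  obtain t0 x1 where tx: "z = (t0, x1)" by (cases z)
  obtain p where p: "p \<in> fst a" "flow t0 p \<in> fst b" "x1 = snd a p" using z tx by (auto simp: local_dom_def)
  have ex: "\<exists>q. q \<in> fst a \<and> q \<in> G \<and> flow t q \<in> fst b \<and> x = snd a q"
    if S: "(t, x) \<in> ?S" "x \<in> W" and W: "snd a ` (fst a \<inter> G) = half_plane \<inter> W" for t x W G
  proof -
    have x: "x \<in> local_dom a b (flow t)" using S by auto
    then have "x \<in> chart_image a" "flow t (chart_inv a x) \<in> fst b" using local_dom_iff[OF A, of x b "flow t"] by blast+
    then have "x \<in> half_plane \<inter> W" using S is_chartD(5)[OF A] by blast
    then obtain q where q: "q \<in> fst a" "q \<in> G" "x = snd a q" using W by blast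
    then show ?thesis using \<open>flow t (chart_inv a x) \<in> fst b\<close> by (auto simp: chart_inv_chart[OF A])
  qed
  show "\<exists>U. open U \<and> z \<in> U \<and> smooth_on (?S \<inter> U) ?f"
  proof (cases "p \<in> fst c")
    case True
    obtain W where W: "open W" "snd a ` (fst a \<inter> fst c) = half_plane \<inter> W"
      using chart_image_openin[OF A openin_Int[OF is_chartD(1)[OF A] is_chartD(1)[OF C]]] openin_half_plane_iff by auto
    let ?U = "UNIV \<times> W"
    have ex': "\<exists>q. q \<in> fst a \<and> q \<in> fst c \<and> flow t q \<in> fst b \<and> x = snd a q" if "(t, x) \<in> ?S \<inter> ?U" for t x
      by (rule ex[OF _ _ W(2)]) (use that in auto)
    have s1: "smooth_on (?S \<inter> ?U) (\<lambda>y. local_rep a c id (snd y))"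
    proof (rule smooth_on_compose[OF smooth_mapD(3)[OF idm a c] smooth_on_bounded_linear[OF bounded_linear_snd]])
      show "snd ` (?S \<inter> ?U) \<subseteq> local_dom a c id"
      proof
        fix x assume "x \<in> snd ` (?S \<inter> ?U)"
        then obtain t where "(t, x) \<in> ?S \<inter> ?U" by auto
        from ex'[OF this] show "x \<in> local_dom a c id" by (auto intro: local_domI)
      qed
    qed
    have "smooth_on (?S \<inter> ?U) (\<lambda>y. (\<lambda>(t, x). F t x) (fst y, local_rep a c id (snd y)))"
      by (rule smooth_on_compose[OF F_smooth smooth_on_Pair[OF smooth_on_bounded_linear[OF bounded_linear_fst] s1]]) simp
    then have s2: "smooth_on (?S \<inter> ?U) (\<lambda>y. F (fst y) (local_rep a c id (snd y)))" by simp
    have "smooth_on (?S \<inter> ?U) (\<lambda>y. local_rep c b id (F (fst y) (local_rep a c id (snd y))))"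
    proof (rule smooth_on_compose[OF smooth_mapD(3)[OF idm c b] s2])
      show "(\<lambda>y. F (fst y) (local_rep a c id (snd y))) ` (?S \<inter> ?U) \<subseteq> local_dom c b id"
      proof
        fix w assume "w \<in> (\<lambda>y. F (fst y) (local_rep a c id (snd y))) ` (?S \<inter> ?U)"
        then obtain t x where tx: "(t, x) \<in> ?S \<inter> ?U" "w = F t (local_rep a c id x)" by auto
        from ex'[OF tx(1)] obtain q where q: "q \<in> fst a" "q \<in> fst c" "flow t q \<in> fst b" "x = snd a q" by auto
        then have "w = snd c (flow t q)" using flow_in_chart[OF q(2)] tx by (simp add: local_rep_apply[OF A])
        then show "w \<in> local_dom c b id" using flow_in_chart(1)[OF q(2), of t] q(3) local_domI[of "flow t q" c id b] by simp
      qed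
    qed
    then have "smooth_on (?S \<inter> ?U) ?f"
    proof (rule smooth_on_cong)
      fix y assume y: "y \<in> ?S \<inter> ?U"
      obtain t x where tx: "y = (t, x)" by (cases y)
      from ex'[of t x] y tx obtain q where q: "q \<in> fst a" "q \<in> fst c" "flow t q \<in> fst b" "x = snd a q" by auto
      then show "local_rep c b id (F (fst y) (local_rep a c id (snd y))) = ?f y"
        using flow_in_chart[OF q(2), of t] local_rep_apply[OF C, of "flow t q" b id] by (simp add: tx local_rep_apply[OF A])
    qed
    moreover have "x1 \<in> W" using W(2) p True by blast
    ultimately show ?thesis using W(1) tx by (intro exI[of _ ?U]) (auto simp: open_Times)
  next
    case False
    have pn: "p \<in> points N" using p is_chartD(2)[OF A] by blast
    obtain W where W: "open W" "snd a ` (fst a \<inter> (points N - core)) = half_plane \<inter> W"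
      using chart_image_openin[OF A openin_Int[OF is_chartD(1)[OF A] openin_outside_core]] openin_half_plane_iff by auto
    let ?U = "UNIV \<times> W"
    have ex': "\<exists>q. q \<in> fst a \<and> q \<in> points N - core \<and> flow t q \<in> fst b \<and> x = snd a q" if "(t, x) \<in> ?S \<inter> ?U" for t x
      by (rule ex[OF _ _ W(2)]) (use that in auto)
    have "smooth_on (?S \<inter> ?U) (\<lambda>y. local_rep a b id (snd y))"
    proof (rule smooth_on_compose[OF smooth_mapD(3)[OF idm a b] smooth_on_bounded_linear[OF bounded_linear_snd]])
      show "snd ` (?S \<inter> ?U) \<subseteq> local_dom a b id"
      proof
        fix x assume "x \<in> snd ` (?S \<inter> ?U)"
        then obtain t where "(t, x) \<in> ?S \<inter> ?U" by auto
        from ex'[OF this] show "x \<in> local_dom a b id" by (auto intro: local_domI simp: flow_outside_core)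
      qed
    qed
    then have "smooth_on (?S \<inter> ?U) ?f"
    proof (rule smooth_on_cong)
      fix y assume y: "y \<in> ?S \<inter> ?U"
      obtain t x where tx: "y = (t, x)" by (cases y)
      from ex'[of t x] y tx obtain q where q: "q \<in> fst a" "q \<notin> core" "x = snd a q" by auto
      then show "local_rep a b id (snd y) = ?f y" by (simp add: tx local_rep_apply[OF A] flow_outside_core)
    qed
    moreover have "x1 \<in> W" using W(2) p False core_subset pn by blast
    ultimately show ?thesis using W(1) tx by (intro exI[of _ ?U]) (auto simp: open_Times)
  qed
qed

lemma flow_smooth_map: "smooth_map N N (flow t)"
  by (rule smooth_map_time_slice[where T = UNIV, OF flow_continuous flow_smooth]) auto

lemma flow_near_0:
  assumes d: "d \<in> charts_at N q"
  obtains I where "open I" "0 \<in> I" "\<And>s. s \<in> I \<Longrightarrow> flow s q \<in> fst d"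
proof -
  note da = charts_atD[OF d]
  have q: "q \<in> points N" by (rule charts_at_in_points[OF N d])
  have "continuous_map euclidean (prod_topology (top_of_set (UNIV::real set)) (surf_top N)) (\<lambda>s. (s, q))"
    using q by (intro continuous_map_pairedI) auto
  from continuous_map_compose[OF this flow_continuous]
  have "continuous_map euclidean (surf_top N) (\<lambda>s. flow s q)" by (simp add: o_def)
  from openin_continuous_map_preimage[OF this is_chartD(1)[OF oriented_surfaceD(2)[OF N da(1)]]]
  have "open {s. flow s q \<in> fst d}" by simp
  then show ?thesis using da(2) by (intro that[of "{s. flow s q \<in> fst d}"]) (auto simp: flow_0)
qed

text \<open>The velocity is the time derivative of any smooth extension of the coordinate representation
  of the flow, whence its smooth dependence on the point.\<close>

lemma flow_curve_extension:
  assumes d: "d \<in> atlas N" and x: "x \<in> chart_image d" and U: "open U" "(0, x) \<in> U" "\<And>k. Ck_on_open k U \<Phi>"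
    and eq: "\<And>y. y \<in> U \<Longrightarrow> y \<in> {(t, x). t \<in> (UNIV::real set) \<and> x \<in> local_dom d d (flow t)} \<Longrightarrow> \<Phi> y = (\<lambda>(t, x). local_rep d d (flow t) x) y"
  shows "((\<lambda>s. snd d (flow s (chart_inv d x))) has_vector_derivative frechet_derivative \<Phi> (at (0, x)) (1, 0)) (at 0)"
proof -
  note D = oriented_surfaceD(2)[OF N d]
  let ?q = "chart_inv d x"
  have dq: "d \<in> charts_at N ?q" by (rule chart_inv_charts_at[OF d x])
  obtain I where I: "open I" "0 \<in> I" "\<And>s. s \<in> I \<Longrightarrow> flow s ?q \<in> fst d" by (rule flow_near_0[OF dq]) (rule that)
  define J where "J = I \<inter> {s. (s, x) \<in> U}"
  have "open {s. (s, x) \<in> U}"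
    using open_vimage[OF U(1), of "\<lambda>s. (s, x)"] by (simp add: vimage_def continuous_on_Pair)
  then have J: "open J" "0 \<in> J" using I U by (auto simp: J_def)
  have der: "(\<Phi> has_derivative frechet_derivative \<Phi> (at (0, x))) (at (0, x))"
    by (rule Ck_on_open_has_derivative[OF U(3)[of "Suc 0"] U(2)])
  have "((\<lambda>s. (s, x)) has_derivative (\<lambda>h. (h, 0))) (at 0)"
    by (rule has_derivative_Pair[OF has_derivative_ident has_derivative_const])
  from has_derivative_compose[OF this der]
  have 1: "((\<lambda>s. \<Phi> (s, x)) has_derivative (\<lambda>h. frechet_derivative \<Phi> (at (0, x)) (h, 0))) (at 0)" .
  have "frechet_derivative \<Phi> (at (0, x)) (h, 0) = h *\<^sub>R frechet_derivative \<Phi> (at (0, x)) (1, 0)" for h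
    using linear_scale[OF has_derivative_linear[OF der], of h "(1, 0)"] by simp
  then have lin: "(\<lambda>h. frechet_derivative \<Phi> (at (0, x)) (h, 0)) = (\<lambda>h. h *\<^sub>R frechet_derivative \<Phi> (at (0, x)) (1, 0))"
    by (rule ext)
  have "((\<lambda>s. \<Phi> (s, x)) has_vector_derivative frechet_derivative \<Phi> (at (0, x)) (1, 0)) (at 0)"
    unfolding has_vector_derivative_def using 1 unfolding lin .
  then show ?thesis
  proof (rule has_vector_derivative_transform_within_open[OF _ J])
    fix s assume s: "s \<in> J"
    then have "flow s ?q \<in> fst d" "(s, x) \<in> U" using I by (auto simp: J_def)
    then have "x \<in> local_dom d d (flow s)" using local_dom_iff[OF D, of x d "flow s"] x by blast
    then show "\<Phi> (s, x) = snd d (flow s ?q)"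
      using eq[of "(s, x)"] \<open>(s, x) \<in> U\<close> by (simp add: local_rep_def)
  qed
qed

lemma flow_extension:
  assumes d: "d \<in> atlas N" and x: "x \<in> chart_image d"
  obtains U \<Phi> where "open U" "(0, x) \<in> U" "\<And>k. Ck_on_open k U \<Phi>"
    "\<And>y. y \<in> U \<Longrightarrow> y \<in> {(t, x). t \<in> (UNIV::real set) \<and> x \<in> local_dom d d (flow t)} \<Longrightarrow> \<Phi> y = (\<lambda>(t, x). local_rep d d (flow t) x) y"
proof -
  note D = oriented_surfaceD(2)[OF N d]
  have "x \<in> local_dom d d (flow 0)" using local_dom_iff[OF D, of x d "flow 0"] x chart_inv_in[OF x] by (simp add: flow_0)
  then have "(0, x) \<in> {(t, x). t \<in> (UNIV::real set) \<and> x \<in> local_dom d d (flow t)}" by simp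
  then show ?thesis by (rule smooth_onE[OF flow_smooth[OF d d]]) (rule that)
qed

lemma flow_curve:
  assumes d: "d \<in> charts_at N q"
  shows "((\<lambda>s. snd d (flow s q)) has_vector_derivative generator q d) (at 0)"
proof -
  note da = charts_atD[OF d]
  note D = oriented_surfaceD(2)[OF N da(1)]
  have x: "snd d q \<in> chart_image d" by (rule chart_in_image[OF da(2)])
  obtain U \<Phi> where U: "open U" "(0, snd d q) \<in> U" "\<And>k. Ck_on_open k U \<Phi>"
    "\<And>y. y \<in> U \<Longrightarrow> y \<in> {(t, x). t \<in> (UNIV::real set) \<and> x \<in> local_dom d d (flow t)} \<Longrightarrow> \<Phi> y = (\<lambda>(t, x). local_rep d d (flow t) x) y"
    by (rule flow_extension[OF da(1) x]) (rule that)
  from flow_curve_extension[OF da(1) x U]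
  have *: "((\<lambda>s. snd d (flow s q)) has_vector_derivative frechet_derivative \<Phi> (at (0, snd d q)) (1, 0)) (at 0)"
    by (simp add: chart_inv_chart[OF D da(2)])
  then have "vector_derivative (\<lambda>s. snd d (flow s q)) (at 0) = frechet_derivative \<Phi> (at (0, snd d q)) (1, 0)"
    by (rule vector_derivative_at)
  then show ?thesis using * d by (simp add: generator_def)
qed

lemma generator_smooth:
  assumes d: "d \<in> atlas N"
  shows "smooth_on (chart_image d) (\<lambda>x. generator (chart_inv d x) d)"
proof (rule smooth_on_local)
  fix x1 assume x1: "x1 \<in> chart_image d"
  obtain U \<Phi> where U: "open U" "(0, x1) \<in> U" "\<And>k. Ck_on_open k U \<Phi>"
    "\<And>y. y \<in> U \<Longrightarrow> y \<in> {(t, x). t \<in> (UNIV::real set) \<and> x \<in> local_dom d d (flow t)} \<Longrightarrow> \<Phi> y = (\<lambda>(t, x). local_rep d d (flow t) x) y"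
    by (rule flow_extension[OF d x1]) (rule that)
  define W where "W = {x. (0, x) \<in> U}"
  have W: "open W" unfolding W_def
    using open_vimage[OF U(1), of "\<lambda>x. (0, x)"] by (simp add: vimage_def continuous_on_Pair)
  have "smooth_on (chart_image d \<inter> W) (\<lambda>x. frechet_derivative \<Phi> (at (0, x)) (1, 0))"
    by (rule smooth_on_compose[OF smooth_on_frechet_derivative[OF U(1) Ck_on_open_imp_smooth_on[OF U(1,3)]]
          smooth_on_Pair[OF smooth_on_const smooth_on_id]])
       (auto simp: W_def)
  then have "smooth_on (chart_image d \<inter> W) (\<lambda>x. generator (chart_inv d x) d)"
  proof (rule smooth_on_cong)
    fix x assume "x \<in> chart_image d \<inter> W"
    then have x: "x \<in> chart_image d" "(0, x) \<in> U" by (auto simp: W_def)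
    from flow_curve_extension[OF d x(1) U(1) x(2) U(3,4)]
    have "vector_derivative (\<lambda>s. snd d (flow s (chart_inv d x))) (at 0) = frechet_derivative \<Phi> (at (0, x)) (1, 0)"
      by (rule vector_derivative_at)
    then show "frechet_derivative \<Phi> (at (0, x)) (1, 0) = generator (chart_inv d x) d"
      using chart_inv_charts_at[OF d x(1)] by (simp add: generator_def)
  qed
  then show "\<exists>U. open U \<and> x1 \<in> U \<and> smooth_on (chart_image d \<inter> U) (\<lambda>x. generator (chart_inv d x) d)"
    using W U(2) by (intro exI[of _ W]) (auto simp: W_def)
qed

lemma generator_change_of_chart:
  assumes a: "a \<in> charts_at N q" and b: "b \<in> charts_at N q"
  shows "generator q b = local_deriv a b id q (generator q a)"
proof -
  note aa = charts_atD[OF a]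
  note A = oriented_surfaceD(2)[OF N aa(1)]
  obtain I where I: "open I" "0 \<in> I" "\<And>s. s \<in> I \<Longrightarrow> flow s q \<in> fst a" by (rule flow_near_0[OF a]) (rule that)
  obtain J where J: "open J" "0 \<in> J" "\<And>s. s \<in> J \<Longrightarrow> flow s q \<in> fst b" by (rule flow_near_0[OF b]) (rule that)
  let ?L = "local_deriv a b id q" and ?K = "I \<inter> J"
  have K: "open ?K" "0 \<in> ?K" using I J by auto
  have 1: "((\<lambda>s. snd a (flow s q)) has_derivative (\<lambda>h. h *\<^sub>R generator q a)) (at 0 within ?K)"
    using flow_curve[OF a] unfolding has_vector_derivative_def by (rule has_derivative_at_withinI)
  have img: "(\<lambda>s. snd a (flow s q)) ` ?K \<subseteq> local_dom a b id" using I(3) J(3) by (auto intro!: local_domI)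
  have "(local_rep a b id has_derivative ?L) (at (snd a q) within local_dom a b id)"
    by (rule smooth_map_local_deriv[OF oriented_surfaceD(4)[OF N] a]) (simp add: b)
  then have L: "linear ?L" by (rule has_derivative_linear)
  have "(local_rep a b id has_derivative ?L) (at (snd a (flow 0 q)) within (\<lambda>s. snd a (flow s q)) ` ?K)"
    unfolding flow_0 by (rule has_derivative_subset[OF \<open>(local_rep a b id has_derivative ?L) _\<close> img])
  from diff_chain_within[OF 1 this]
  have "((\<lambda>s. local_rep a b id (snd a (flow s q))) has_derivative (\<lambda>h. ?L (h *\<^sub>R generator q a))) (at 0)"
    using at_within_open[OF K(2,1)] by (simp add: o_def)
  then have "((\<lambda>s. local_rep a b id (snd a (flow s q))) has_vector_derivative ?L (generator q a)) (at 0)"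
    by (simp add: has_vector_derivative_def linear_scale[OF L])
  then have "((\<lambda>s. snd b (flow s q)) has_vector_derivative ?L (generator q a)) (at 0)"
    by (rule has_vector_derivative_transform_within_open[OF _ K]) (use I(3) in \<open>auto simp: local_rep_apply[OF A]\<close>)
  from vector_derivative_at[OF this] show ?thesis using b by (simp add: generator_def)
qed

text \<open>The core consists of interior points, so the flow is stationary near the boundary.\<close>

lemma generator_admissible: "admissible_field N generator"
  unfolding admissible_field_def smooth_vector_field_def
proof (intro conjI ballI)
  show "generator q \<in> tangent_space N q" for q
    unfolding tangent_space_def mem_Collect_eq
    using generator_change_of_chart by (intro conjI ballI allI impI) (blast, simp add: generator_def)
  show "smooth_on (chart_image d) (\<lambda>x. generator (chart_inv d x) d)" if "d \<in> atlas N" for d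
    by (rule generator_smooth[OF that])
  fix q assume "q \<in> surface_boundary N"
  then obtain a where a: "a \<in> charts_at N q" "snd a q $ 2 = 0" by (auto simp: surface_boundary_def)
  have "q \<notin> core"
  proof
    assume "q \<in> core"
    then obtain x where x: "x \<in> E" "q = chart_inv c x" by (auto simp: core_def)
    then have "x \<in> chart_image c" using E by blast
    then have "c \<in> charts_at N q" "0 < snd c q $ 2"
      using chart_inv_charts_at[OF c] interior x by (auto simp: chart_chart_inv)
    from interior_point_invariant[OF N this(1) a(1) this(2)] show False using a(2) by simp
  qed
  then show "generator q = (\<lambda>_. 0)"
    by (auto simp: generator_def fun_eq_iff flow_outside_core)
qed

lemma local_flow_generator: "local_flow N generator flow"
  unfolding local_flow_def
proof (intro exI[of _ 1] conjI ballI)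
  fix t q d assume q: "q \<in> points N" and d: "d \<in> charts_at N (flow t q)"
  have "((\<lambda>s. s - t) has_vector_derivative 1) (at t)" by (auto intro!: derivative_eq_intros)
  moreover have "((\<lambda>s. snd d (flow s (flow t q))) has_vector_derivative generator (flow t q) d) (at (t - t))"
    using flow_curve[OF d] by simp
  ultimately have "((\<lambda>s. snd d (flow s (flow t q))) \<circ> (\<lambda>s. s - t) has_vector_derivative 1 *\<^sub>R generator (flow t q) d) (at t)"
    by (rule vector_diff_chain_at)
  then show "((\<lambda>s. snd d (flow s q)) has_vector_derivative generator (flow t q) d) (at t)"
    by (simp add: o_def flow_add)
next
  show "continuous_map (prod_topology (top_of_set {-1<..<1}) (surf_top N)) (surf_top N) (\<lambda>(t, q). flow t q)"
    by (rule flow_continuous)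
  show "smooth_on {(t, x). t \<in> {-1<..<1} \<and> x \<in> local_dom a b (flow t)} (\<lambda>(t, x). local_rep a b (flow t) x)"
    if "a \<in> atlas N" "b \<in> atlas N" for a b by (rule flow_smooth[OF that])
qed (simp_all add: flow_0)

lemma flow_area_ratio_outside:
  assumes R: "riemannian_surface N" and q: "q \<in> points N" "q \<notin> core"
  shows "area_ratio N N (flow t) q = 1"
proof -
  have "area_ratio N N (flow t) q = area_ratio N N id q"
    by (rule area_ratio_cong[OF R R flow_smooth_map oriented_surfaceD(4)[OF N] openin_outside_core])
       (use q in \<open>auto simp: flow_outside_core\<close>)
  then show ?thesis using area_ratio_id[OF R q(1)] by simp
qed

lemma flow_area_ratio_inside:
  assumes R: "riemannian_surface N" and q: "q \<in> fst c" and L: "(F t has_derivative L) (at (snd c q))"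
  shows "area_ratio N N (flow t) q = area_density N c (flow t q) * det (matrix L) / area_density N c q"
proof -
  have cq: "c \<in> charts_at N q" "c \<in> charts_at N (flow t q)" using flow_in_chart[OF q] q c by (auto simp: charts_at_def)
  have "local_deriv c c (flow t) q = L"
  proof (rule local_deriv_eqI[OF flow_smooth_map cq is_chartD(4)[OF C] chart_in_image[OF q]])
    show "chart_image c \<subseteq> local_dom c c (flow t)"
      using flow_in_chart by (auto simp: chart_image_def intro!: local_domI)
    have "(F t has_derivative L) (at (snd c q) within chart_image c)" by (rule has_derivative_at_withinI[OF L])
    then show "(local_rep c c (flow t) has_derivative L) (at (snd c q) within chart_image c)"
    proof (rule has_derivative_transform[OF chart_in_image[OF q], rotated])
      fix x assume x: "x \<in> chart_image c"
      show "local_rep c c (flow t) x = F t x"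
        using flow_in_chart[OF chart_inv_in[OF x]] by (simp add: local_rep_def chart_chart_inv[OF x])
    qed
  qed
  then show ?thesis by (simp add: area_ratio_eq[OF R R flow_smooth_map cq])
qed

end


section \<open>Critical maps have constant area ratio\<close>

text \<open>In coordinates this is the smooth area ratio composed with the representation of the inverse \<open>h\<close> of \<open>f\<close>.\<close>

lemma smooth_on_pushforward_ratio:
  assumes RM: "riemannian_surface M" and RN: "riemannian_surface N"
    and f: "smooth_map M N f" and h: "smooth_map N M h" and fh: "\<And>q. q \<in> points N \<Longrightarrow> f (h q) = q" and c: "c \<in> atlas N"
  shows "smooth_on (chart_image c) (\<lambda>x. area_ratio M N f (h (chart_inv c x)))"
proof (rule smooth_on_local)
  note M = riemannian_surface_oriented[OF RM] and N = riemannian_surface_oriented[OF RN]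
  note C = oriented_surfaceD(2)[OF N c]
  fix x1 assume x1: "x1 \<in> chart_image c"
  have "chart_inv c x1 \<in> points N" using chart_inv_in[OF x1] is_chartD(2)[OF C] by blast
  from ex_charts_at[OF M smooth_mapD(2)[OF h this]] obtain b where b: "b \<in> charts_at M (h (chart_inv c x1))" by auto
  note ba = charts_atD[OF b]
  note B = oriented_surfaceD(2)[OF M ba(1)]
  obtain W where W: "open W" "local_dom c b h = half_plane \<inter> W"
    using local_dom_openin[OF C B smooth_mapD(1)[OF h]] openin_half_plane_iff by auto
  have dom: "x \<in> chart_image c \<and> h (chart_inv c x) \<in> fst b \<and> chart_inv c x \<in> points N" if "x \<in> local_dom c b h" for x
  proof -
    have x: "x \<in> chart_image c" "h (chart_inv c x) \<in> fst b" using that local_dom_iff[OF C, of x b h] by blast+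
    then show ?thesis using chart_inv_in[OF x(1)] is_chartD(2)[OF C] by blast
  qed
  have "smooth_on (local_dom c b h) (\<lambda>x. area_ratio M N f (chart_inv b (local_rep c b h x)))"
  proof (rule smooth_on_compose[OF smooth_on_area_ratio[OF RM RN ba(1) c f] smooth_mapD(3)[OF h c ba(1)]])
    show "local_rep c b h ` local_dom c b h \<subseteq> local_dom b c f"
    proof
      fix y assume "y \<in> local_rep c b h ` local_dom c b h"
      then obtain x where x: "x \<in> local_dom c b h" "y = snd b (h (chart_inv c x))" by (auto simp: local_rep_def)
      have "f (h (chart_inv c x)) = chart_inv c x" using fh dom[OF x(1)] by blast
      then have "f (h (chart_inv c x)) \<in> fst c" using chart_inv_in dom[OF x(1)] by metis
      then show "y \<in> local_dom b c f" unfolding x(2) using dom[OF x(1)] by (intro local_domI) auto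
    qed
  qed
  then have "smooth_on (local_dom c b h) (\<lambda>x. area_ratio M N f (h (chart_inv c x)))"
    by (rule smooth_on_cong) (use dom in \<open>auto simp: local_rep_def chart_inv_chart[OF B]\<close>)
  moreover have "chart_image c \<inter> W \<subseteq> local_dom c b h" using W(2) is_chartD(5)[OF C] by blast
  moreover have "x1 \<in> W"
  proof -
    have "x1 \<in> local_dom c b h" using local_dom_iff[OF C, of x1 b h] x1 ba(2) by blast
    then show ?thesis using W(2) by blast
  qed
  ultimately show "\<exists>U. open U \<and> x1 \<in> U \<and> smooth_on (chart_image c \<inter> U) (\<lambda>x. area_ratio M N f (h (chart_inv c x)))"
    using W(1) smooth_on_subset by (intro exI[of _ W]) blast
qed

lemma chart_interior:
  assumes C: "is_chart X c"
  obtains G where "open G" "G \<subseteq> chart_image c" "\<And>x. x \<in> G \<Longrightarrow> 0 < x $ 2"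
    "\<And>x. x \<in> chart_image c \<Longrightarrow> 0 < x $ 2 \<Longrightarrow> x \<in> G"
proof -
  obtain W where W: "open W" "chart_image c = half_plane \<inter> W" using is_chartD(4)[OF C] openin_half_plane_iff by auto
  show ?thesis
  proof (rule that[of "W \<inter> {x. 0 < x $ 2}"])
    show "open (W \<inter> {x. 0 < x $ 2})" using W(1) by (intro open_Int open_Collect_less continuous_intros)
    show "W \<inter> {x. 0 < x $ 2} \<subseteq> chart_image c" unfolding W(2) by (auto simp: half_plane_def)
    show "x \<in> W \<inter> {x. 0 < x $ 2}" if "x \<in> chart_image c" "0 < x $ 2" for x using that W(2) by blast
  qed simp
qed

text \<open>Multiplying the density by \<open>exp (- \<beta> (x\<^sub>i - x0\<^sub>i))\<close> changes its gradient at \<open>x0\<close> by a multiple of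
  the \<open>i\<close>-th unit vector, so any nonzero gradient \<open>(P1, P2)\<close> can be made transversal to it.\<close>

lemma ex_transversal_weight:
  fixes P1 P2 R1 R2 \<rho> :: real
  assumes "0 < \<rho>" "P1 \<noteq> 0 \<or> P2 \<noteq> 0"
  shows "\<exists>\<beta> (i::2). 0 < P1 * (R2 - (if i = 2 then \<beta> * \<rho> else 0)) - P2 * (R1 - (if i = 1 then \<beta> * \<rho> else 0))"
proof (cases "P2 = 0")
  case True
  then have "P1 \<noteq> 0" using assms by simp
  then have "P1 * (R2 - ((P1 * R2 - 1) / (P1 * \<rho>)) * \<rho>) = 1" using assms(1) by (simp add: field_simps)
  then show ?thesis using True by (intro exI[of _ "(P1 * R2 - 1) / (P1 * \<rho>)"] exI[of _ 2]) simp
next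
  case False
  then have "P1 * R2 - P2 * (R1 - ((1 - P1 * R2 + P2 * R1) / (P2 * \<rho>)) * \<rho>) = 1" using assms(1) by (simp add: field_simps)
  then show ?thesis by (intro exI[of _ "(1 - P1 * R2 + P2 * R1) / (P2 * \<rho>)"] exI[of _ 1]) simp
qed

text \<open>A nonnegative continuous function with vanishing integral is zero almost everywhere, hence not
  positive on any disc.\<close>

lemma integral_zero_imp_eq_zero:
  fixes g :: "real^2 \<Rightarrow> real"
  assumes int: "integrable lborel g" and nn: "\<And>x. 0 \<le> g x" and z: "(\<integral>x. g x \<partial>lborel) = 0" and cont: "continuous_on UNIV g"
  shows "g x0 = 0"
proof (rule ccontr)
  assume "g x0 \<noteq> 0"
  then have pos: "0 < g x0" using nn[of x0] by simp
  have "open {x. 0 < g x}" using cont by (intro open_Collect_less continuous_on_const)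
  then obtain r where r: "0 < r" "ball x0 r \<subseteq> {x. 0 < g x}" using pos open_contains_ball by blast
  have "AE x in lborel. g x = 0" using integral_nonneg_eq_0_iff_AE[OF int] nn z by simp
  then have "AE x in lborel. x \<notin> ball x0 r" by (rule AE_mp) (use r(2) in \<open>auto intro!: AE_I2\<close>)
  then have "emeasure lborel (ball x0 r) = 0" by (subst (asm) AE_iff_measurable[of "ball x0 r"]) auto
  then have "measure lborel (ball x0 r) = 0" by (simp add: measure_def)
  then show False using content_ball_pos[OF r(1), of x0] by simp
qed

text \<open>The pushed forward area ratio \<open>u\<close> of a critical map has no gradient at an interior point \<open>x0\<close> of a chart.
  Otherwise choose \<open>\<beta>\<close> and \<open>i\<close> such that \<open>du \<and> dw\<close> is positive near \<open>x0\<close>, where \<open>w = \<rho> / \<sigma>\<close> is the density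
  relative to \<open>\<sigma> dx\<close>. The swirl preserves \<open>\<sigma> dx\<close>, so its area ratio at \<open>x\<close> is \<open>w (\<phi>\<^sub>t x) / w x\<close>, and the first variation
  becomes $\int 2 u\, dw(V)\, \sigma\, dx$. By the Hamiltonian property this is the integral of
  \<open>u dw \<and> dK\<close> with the bump function \<open>K\<close>, which equals that of \<open>K du \<and> dw\<close>; but this one is positive.\<close>

lemma critical_imp_gradient_zero:
  assumes RM: "riemannian_surface M" and KM: "compact_space (surf_top M)"
    and RN: "riemannian_surface N" and KN: "compact_space (surf_top N)"
    and f: "orientation_preserving_diffeomorphism M N f"
    and crit: "\<And>V \<phi>. admissible_field N V \<Longrightarrow> local_flow N V \<phi> \<Longrightarrow>
      ((\<lambda>t. stretch_energy M N (\<phi> t \<circ> f)) has_real_derivative 0) (at 0)"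
    and c: "c \<in> atlas N" and x0: "x0 \<in> chart_image c" "0 < x0 $ 2"
  defines "u \<equiv> \<lambda>x. area_ratio M N f (inv_into (points M) f (chart_inv c x))"
  shows "partial 1 u x0 = 0 \<and> partial 2 u x0 = 0"
proof (rule ccontr)
  assume contra: "\<not> (partial 1 u x0 = 0 \<and> partial 2 u x0 = 0)"
  note M = riemannian_surface_oriented[OF RM] and N = riemannian_surface_oriented[OF RN]
  note f' = diffeomorphismD[OF f]
  note C = oriented_surfaceD(2)[OF N c]
  define h where "h = inv_into (points M) f"
  define \<rho> where "\<rho> x = area_density N c (chart_inv c x)" for x
  obtain G where G: "open G" "G \<subseteq> chart_image c" "\<And>x. x \<in> G \<Longrightarrow> 0 < x $ 2"
    "\<And>x. x \<in> chart_image c \<Longrightarrow> 0 < x $ 2 \<Longrightarrow> x \<in> G" by (rule chart_interior[OF C]) (rule that)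
  have x0G: "x0 \<in> G" by (rule G(4)[OF x0])
  have u: "smooth_on G u" unfolding u_def
    by (rule smooth_on_subset[OF smooth_on_pushforward_ratio[OF RM RN f'(1,2,4) c] G(2)])
  have rho: "smooth_on G \<rho>" unfolding \<rho>_def by (rule smooth_on_subset[OF smooth_on_area_density[OF RN c] G(2)])
  have rho_pos: "0 < \<rho> x" if "x \<in> chart_image c" for x
    unfolding \<rho>_def by (rule area_density_pos[OF RN chart_inv_charts_at[OF c that]])
  \<comment> \<open>The positive quantity is the coefficient of \<open>du \<and> dw\<close> at \<open>x0\<close>; see \<open>pw\<close> for the gradient of \<open>w\<close>.\<close>
  obtain \<beta> and i :: 2 where bi: "0 < partial 1 u x0 * (partial 2 \<rho> x0 - (if i = 2 then \<beta> * \<rho> x0 else 0))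
      - partial 2 u x0 * (partial 1 \<rho> x0 - (if i = 1 then \<beta> * \<rho> x0 else 0))"
    using ex_transversal_weight[OF rho_pos[OF x0(1)], of "partial 1 u x0" "partial 2 u x0" "partial 2 \<rho> x0" "partial 1 \<rho> x0"] contra by auto
  define \<sigma> where "\<sigma> x = exp (\<beta> * (x $ i - x0 $ i))" for x :: "real^2"
  have sig_pos: "0 < \<sigma> x" for x by (simp add: \<sigma>_def)
  define w where "w x = \<rho> x / \<sigma> x" for x
  have w: "smooth_on G w"
    unfolding w_def
  proof (rule smooth_on_divide[OF rho])
    show "smooth_on G \<sigma>" unfolding \<sigma>_def
      by (intro smooth_on_exp smooth_on_mult smooth_on_const smooth_on_diff smooth_on_vec_nth smooth_on_id)
  qed (simp add: \<sigma>_def)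
  have w_pos: "0 < w x" if "x \<in> chart_image c" for x using rho_pos[OF that] sig_pos by (simp add: w_def)
  have pw: "partial k w x0 = partial k \<rho> x0 - (if k = i then \<beta> * \<rho> x0 else 0)" for k
  proof -
    have dr: "(\<rho> has_derivative frechet_derivative \<rho> (at x0)) (at x0)" by (rule smooth_on_open_has_derivative[OF G(1) rho x0G])
    have nth: "((\<lambda>x::real^2. x $ i - x0 $ i) has_derivative (\<lambda>h. h $ i)) (at x0)"
      using has_derivative_diff[OF bounded_linear_imp_has_derivative[OF bounded_linear_vec_nth] has_derivative_const] by simp
    have "((\<lambda>x::real^2. exp (- \<beta> * (x $ i - x0 $ i))) has_derivative (\<lambda>h. - \<beta> * h $ i)) (at x0)"
      using has_derivative_compose[OF has_derivative_mult_right[OF nth, of "- \<beta>"] DERIV_exp[THEN has_field_derivative_imp_has_derivative]] by simp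
    from has_derivative_mult[OF dr this]
    have 1: "((\<lambda>x. \<rho> x * exp (- \<beta> * (x $ i - x0 $ i))) has_derivative (\<lambda>h. \<rho> x0 * (- \<beta> * h $ i) + frechet_derivative \<rho> (at x0) h)) (at x0)" by simp
    have 2: "(\<lambda>x. \<rho> x * exp (- \<beta> * (x $ i - x0 $ i))) = w"
      by (simp add: w_def \<sigma>_def fun_eq_iff exp_minus divide_inverse)
    from frechet_derivative_at[OF 1[unfolded 2], symmetric] show ?thesis by (simp add: axis_def)
  qed
  define \<Delta> where "\<Delta> x = partial 1 u x * partial 2 w x - partial 2 u x * partial 1 w x" for x
  have D0: "0 < \<Delta> x0" using bi unfolding \<Delta>_def pw by simp
  have "smooth_on G \<Delta>" unfolding \<Delta>_def
    by (intro smooth_on_diff smooth_on_mult smooth_on_frechet_derivative[OF G(1)] u w)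
  then have "continuous_on G \<Delta>" by (rule smooth_on_imp_continuous_on)
  then have "open (G \<inter> \<Delta> -` {0<..})" by (rule continuous_open_preimage[OF _ G(1)]) simp
  moreover have "x0 \<in> G \<inter> \<Delta> -` {0<..}" using D0 x0G by simp
  ultimately obtain R where R: "0 < R" "ball x0 R \<subseteq> G \<inter> \<Delta> -` {0<..}" using open_contains_ball by blast
  define B where "B = ball x0 R"
  have B: "open B" "B \<subseteq> G" "\<And>x. x \<in> B \<Longrightarrow> 0 < \<Delta> x" "x0 \<in> B" using R by (auto simp: B_def)
  obtain r where r: "0 < r" "swirl_support \<beta> i x0 r \<subseteq> ball x0 R" by (rule swirl_support_small[OF R(1)]) (rule that)
  define E where "E = swirl_support \<beta> i x0 r"
  define K where "K = bump \<beta> i x0 r"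
  define F where "F = swirl \<beta> i x0 r"
  have EB: "E \<subseteq> B" using r by (simp add: E_def B_def)
  have Ecl: "closed E" unfolding E_def by (rule closed_swirl_support)
  have Ecb: "E \<subseteq> cball x0 R" using EB by (auto simp: B_def)
  have Ecomp: "compact E"
    using Ecl bounded_subset[OF bounded_cball Ecb] by (simp add: compact_eq_bounded_closed)
  interpret chart_flow N c E F
  proof
    show "compact E" by (rule Ecomp)
    show "E \<subseteq> chart_image c" using EB B(2) G(2) by blast
    show "0 < x $ 2" if "x \<in> E" for x using that EB B(2) G(3) by blast
    show "smooth_on UNIV (\<lambda>(t, x). F t x)" unfolding F_def by (rule smooth_on_swirl)
  qed (simp_all add: N c Ecomp E_def F_def swirl_0 swirl_add swirl_outside swirl_in_support)
  have FB: "F t x \<in> B" if "x \<in> B" for t x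
    using F_in[of x t] F_out[of x t] EB that by (cases "x \<in> E") auto
  have "\<forall>x. \<exists>v. ((\<lambda>t. F t x) has_vector_derivative v) (at 0) \<and>
      2 * \<sigma> x * v $ 1 = partial 2 K x \<and> 2 * \<sigma> x * v $ 2 = - partial 1 K x"
  proof
    fix x
    obtain v K1 K2 where v0: "((\<lambda>t. swirl \<beta> i x0 r t x) has_vector_derivative v) (at 0)"
      and k0: "(bump \<beta> i x0 r has_derivative (\<lambda>h. K1 * h $ 1 + K2 * h $ 2)) (at x)"
      and e0: "exp (\<beta> * (x $ i - x0 $ i)) * v $ 1 = K2 / 2" "exp (\<beta> * (x $ i - x0 $ i)) * v $ 2 = - K1 / 2"
      by (rule swirl_hamiltonian[of \<beta> i x0 r x]) (rule that)
    note v = v0[folded F_def] and k = k0[folded K_def] and e = e0[folded \<sigma>_def]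
    have "frechet_derivative K (at x) = (\<lambda>h. K1 * h $ 1 + K2 * h $ 2)" using frechet_derivative_at[OF k] by simp
    then have "partial 1 K x = K1" "partial 2 K x = K2" by (simp_all add: axis_def)
    then show "\<exists>v. ((\<lambda>t. F t x) has_vector_derivative v) (at 0) \<and>
      2 * \<sigma> x * v $ 1 = partial 2 K x \<and> 2 * \<sigma> x * v $ 2 = - partial 1 K x"
      using v e by (intro exI[of _ v]) simp
  qed
  then obtain v where v: "\<And>x. ((\<lambda>t. F t x) has_vector_derivative v x) (at 0)"
    "\<And>x. 2 * \<sigma> x * v x $ 1 = partial 2 K x" "\<And>x. 2 * \<sigma> x * v x $ 2 = - partial 1 K x" by metis
  define Dx where "Dx x = (partial 1 w x * v x $ 1 + partial 2 w x * v x $ 2) / w x" for x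
  define D where "D q = (if q \<in> fst c \<and> snd c q \<in> B then Dx (snd c q) else 0)" for q
  have D: "((\<lambda>t. area_ratio N N (flow t) q) has_real_derivative D q) (at 0)" if q: "q \<in> points N" for q
  proof (cases "q \<in> fst c \<and> snd c q \<in> B")
    case True
    define x where "x = snd c q"
    have xB: "x \<in> B" using True by (simp add: x_def)
    have ratio: "area_ratio N N (flow t) q = w (F t x) / w x" for t
    proof -
      obtain L where L: "(F t has_derivative L) (at (snd c q))" "det (matrix L) = \<sigma> x / \<sigma> (F t x)"
        using swirl_has_derivative[of \<beta> i x0 r t x] by (auto simp: F_def \<sigma>_def x_def)
      have "chart_inv c x = q" using True by (simp add: x_def chart_inv_chart[OF C])
      moreover have "chart_inv c (F t x) = flow t q" using True by (simp add: x_def flow_def)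
      ultimately show ?thesis
        using flow_area_ratio_inside[OF RN _ L(1)] True sig_pos by (simp add: L(2) w_def \<rho>_def)
    qed
    have dw: "(w has_derivative frechet_derivative w (at x)) (at (F 0 x))"
      unfolding F_0 using smooth_on_open_has_derivative[OF G(1) w] xB B(2) by blast
    from has_derivative_compose[OF v(1)[of x, unfolded has_vector_derivative_def] dw]
    have "((\<lambda>t. w (F t x)) has_derivative (\<lambda>s. frechet_derivative w (at x) (s *\<^sub>R v x))) (at 0)" .
    moreover have "(\<lambda>s. frechet_derivative w (at x) (s *\<^sub>R v x)) = (*) (partial 1 w x * v x $ 1 + partial 2 w x * v x $ 2)"
      using linear_scale[OF has_derivative_linear[OF dw]] linear_real2[OF has_derivative_linear[OF dw], of "v x"]
      by (simp add: fun_eq_iff algebra_simps)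
    ultimately have "((\<lambda>t. w (F t x)) has_real_derivative (partial 1 w x * v x $ 1 + partial 2 w x * v x $ 2)) (at 0)"
      by (simp add: has_field_derivative_def)
    from DERIV_cdivide[OF this, of "w x"] show ?thesis
      using True by (simp add: ratio D_def Dx_def x_def)
  next
    case False
    have "q \<notin> core"
    proof
      assume "q \<in> core"
      then obtain y where y: "y \<in> E" "q = chart_inv c y" by (auto simp: core_def)
      then have "y \<in> chart_image c" using E by blast
      then have "q \<in> fst c" "snd c q = y" using y by (auto simp: chart_inv_in chart_chart_inv)
      then show False using False y EB by auto
    qed
    then have "area_ratio N N (flow t) q = 1" for t by (rule flow_area_ratio_outside[OF RN q])
    moreover have "D q = 0" using False by (auto simp: D_def)
    ultimately show ?thesis by simp
  qed
  have hp: "h (f p) = p" if "p \<in> points M" for p using f'(3)[OF that] by (simp add: h_def)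
  define k where "k q = 2 * area_ratio M N f (h q) * D q" for q
  have meas: "k \<in> borel_measurable (borel_of (surf_top N))"
  proof -
    have "(\<lambda>q. area_ratio M N f (h q)) \<in> borel_measurable (borel_of (surf_top N))"
      unfolding h_def
      by (rule measurable_compose[OF continuous_map_measurable[OF smooth_mapD(1)[OF f'(2)]]
            continuous_map_borel_measurable[OF continuous_map_area_ratio[OF RM RN f'(1)]]])
    moreover have "D \<in> borel_measurable (borel_of (surf_top N))"
    proof (rule borel_measurable_LIMSEQ_real)
      define s where "s n = inverse (real (Suc n))" for n
      show "(\<lambda>q. (area_ratio N N (flow (s n)) q - area_ratio N N (flow 0) q) / s n) \<in> borel_measurable (borel_of (surf_top N))" for n
        using continuous_map_borel_measurable[OF continuous_map_area_ratio[OF RN RN flow_smooth_map]] by measurable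
      fix q assume "q \<in> space (borel_of (surf_top N))"
      then have "q \<in> points N" by simp
      from D[OF this] have "((\<lambda>t. (area_ratio N N (flow (0 + t)) q - area_ratio N N (flow 0) q) / t) \<longlongrightarrow> D q) (at 0)"
        by (simp only: DERIV_def)
      moreover have "\<forall>n. s n \<in> UNIV - {0}" by (simp add: s_def)
      moreover have "s \<longlonglongrightarrow> 0" unfolding s_def by (rule LIMSEQ_inverse_real_of_nat)
      ultimately have "((\<lambda>t. (area_ratio N N (flow (0 + t)) q - area_ratio N N (flow 0) q) / t) \<circ> s) \<longlonglongrightarrow> D q"
        unfolding tendsto_at_iff_sequentially by blast
      then show "(\<lambda>n. (area_ratio N N (flow (s n)) q - area_ratio N N (flow 0) q) / s n) \<longlonglongrightarrow> D q" by (simp add: o_def)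
    qed
    ultimately show ?thesis unfolding k_def by measurable
  qed
  have "(\<integral>p. 2 * (area_ratio M N f p)\<^sup>2 * D (f p) \<partial>area_measure M) = 0"
    by (rule DERIV_unique[OF variation_formulas(1)[OF RM KM RN KN f'(1) local_flow_generator D]
          crit[OF generator_admissible local_flow_generator]])
  also have "(\<integral>p. 2 * (area_ratio M N f p)\<^sup>2 * D (f p) \<partial>area_measure M) = (\<integral>p. area_ratio M N f p * k (f p) \<partial>area_measure M)"
    by (rule Bochner_Integration.integral_cong)
       (auto simp: k_def hp power2_eq_square space_area_measure[OF RM KM])
  also have "\<dots> = (\<integral>q. k q \<partial>area_measure N)"
    by (rule integral_pullback[OF RM KM RN KN f'(1) smooth_mapD(1)[OF f'(2)] f'(3,4) _ meas])
       (auto intro: less_imp_le[OF diffeomorphism_area_ratio_pos[OF RM RN f]])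
  also have "\<dots> = (\<integral>x. indicator (chart_image c) x *\<^sub>R (area_density N c (chart_inv c x) * k (chart_inv c x)) \<partial>lborel)"
    by (rule integral_area_chart[OF RN KN c meas]) (simp add: k_def D_def)
  also have "\<dots> = (\<integral>x. indicator B x * (u x * (partial 1 w x * partial 2 K x - partial 2 w x * partial 1 K x)) \<partial>lborel)"
  proof (rule Bochner_Integration.integral_cong[OF refl])
    fix x
    show "indicator (chart_image c) x *\<^sub>R (area_density N c (chart_inv c x) * k (chart_inv c x))
        = indicator B x * (u x * (partial 1 w x * partial 2 K x - partial 2 w x * partial 1 K x))"
    proof (cases "x \<in> B")
      case True
      then have xc: "x \<in> chart_image c" using B(2) G(2) by blast
      have "\<rho> x * (2 * u x * Dx x) = u x * ((\<rho> x / w x) * 2 * (partial 1 w x * v x $ 1 + partial 2 w x * v x $ 2))"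
        by (simp add: Dx_def)
      \<comment> \<open>The density relative to \<open>\<sigma> dx\<close> cancels the denominator of the logarithmic derivative.\<close>
      also have "\<rho> x / w x = \<sigma> x" using rho_pos[OF xc] sig_pos[of x] by (simp add: w_def)
      also have "\<sigma> x * 2 * (partial 1 w x * v x $ 1 + partial 2 w x * v x $ 2)
          = partial 1 w x * (2 * \<sigma> x * v x $ 1) + partial 2 w x * (2 * \<sigma> x * v x $ 2)" by (simp add: algebra_simps)
      also have "\<dots> = partial 1 w x * partial 2 K x - partial 2 w x * partial 1 K x" unfolding v(2,3) by simp
      finally show ?thesis
        using True xc by (simp add: k_def D_def chart_inv_in chart_chart_inv u_def h_def \<rho>_def)
    next
      case False
      then show ?thesis by (auto simp: k_def D_def indicator_def chart_chart_inv)
    qed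
  qed
  also have "\<dots> = (\<integral>x. indicator B x * (\<Delta> x * K x) \<partial>lborel)"
    unfolding \<Delta>_def
    by (rule green_identity(1)[OF B(1) Ecl EB Ecb smooth_on_subset[OF u B(2)] smooth_on_subset[OF w B(2)]])
       (simp_all add: K_def smooth_on_bump bump_outside E_def)
  finally have z: "(\<integral>x. indicator B x * (\<Delta> x * K x) \<partial>lborel) = 0" .
  have K: "smooth_on UNIV K" "\<And>x. x \<notin> E \<Longrightarrow> K x = 0"
    by (simp_all add: K_def smooth_on_bump bump_outside E_def)
  note gi = green_identity(2,3)[OF B(1) Ecl EB Ecb smooth_on_subset[OF u B(2)] smooth_on_subset[OF w B(2)] K, folded \<Delta>_def]
  have "indicator B x0 * (\<Delta> x0 * K x0) = 0"
  proof (rule integral_zero_imp_eq_zero[OF gi(1) _ z gi(2)])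
    show "0 \<le> indicator B x * (\<Delta> x * K x)" for x
      using B(3)[of x] bump_nonneg[of \<beta> i x0 r x] by (auto simp: indicator_def K_def less_imp_le)
  qed
  moreover have "0 < K x0" unfolding K_def by (rule bump_center_pos[OF r(1)])
  ultimately show False using D0 B(4) by simp
qed

text \<open>The interior part of a half-disc is convex, so a function with vanishing gradient is constant there;
  by continuity the constant extends to the boundary points.\<close>

lemma gradient_zero_imp_locally_constant:
  fixes u :: "real^2 \<Rightarrow> real"
  assumes S: "cball x1 r \<inter> half_plane \<subseteq> S" and r: "0 < r" and x1: "x1 \<in> half_plane" and u: "smooth_on S u"
    and G: "open G" "G \<subseteq> S" "\<And>x. x \<in> S \<Longrightarrow> 0 < x $ 2 \<Longrightarrow> x \<in> G"
    and z: "\<And>x. x \<in> G \<Longrightarrow> partial 1 u x = 0 \<and> partial 2 u x = 0"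
    and x: "x \<in> ball x1 r \<inter> half_plane"
  shows "u x = u x1"
proof -
  let ?Q = "ball x1 r \<inter> {x. 0 < x $ 2}"
  have QG: "?Q \<subseteq> G"
  proof
    fix y assume y: "y \<in> ?Q"
    then have "y \<in> S" using S by (auto simp: half_plane_def)
    then show "y \<in> G" using G(3) y by auto
  qed
  have conv: "convex ?Q"
  proof (intro convex_Int convex_ball)
    have "{x::real^2. 0 < x $ 2} = {x. inner (axis 2 1) x > 0}" by (simp add: inner_axis' )
    then show "convex {x::real^2. 0 < x $ 2}" by (simp add: convex_halfspace_gt)
  qed
  have "\<exists>a. \<forall>y\<in>?Q. u y = a"
  proof (rule has_derivative_zero_constant[OF conv])
    fix y assume "y \<in> ?Q"
    then have y: "y \<in> G" using QG by blast
    have der: "(u has_derivative frechet_derivative u (at y)) (at y)"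
      by (rule smooth_on_open_has_derivative[OF G(1) smooth_on_subset[OF u G(2)] y])
    have "frechet_derivative u (at y) = (\<lambda>h. 0)"
      using linear_real2[OF has_derivative_linear[OF der]] z[OF y] by (simp add: fun_eq_iff)
    with der show "(u has_derivative (\<lambda>h. 0)) (at y within ?Q)" by (metis has_derivative_at_withinI)
  qed
  then obtain a where a: "\<And>y. y \<in> ?Q \<Longrightarrow> u y = a" by blast
  have cl: "closure ?Q \<subseteq> cball x1 r \<inter> half_plane"
    by (rule closure_minimal) (auto simp: half_plane_def[symmetric] half_plane_closed intro!: closed_Int, simp add: half_plane_def)
  have cont: "continuous_on (closure ?Q) u"
    by (rule continuous_on_subset[OF smooth_on_imp_continuous_on[OF u]]) (use cl S in blast)
  have const: "u y = a" if y: "y \<in> ball x1 r \<inter> half_plane" for y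
  proof (rule continuous_constant_on_closure[OF cont a])
    show "y \<in> closure ?Q"
      unfolding closure_approachable
    proof (intro allI impI)
      fix e :: real assume e: "0 < e"
      have "y \<in> ball x1 r" using y by simp
      then obtain d where d: "d > 0" "ball y d \<subseteq> ball x1 r" by (rule openE[OF open_ball])
      define m where "m = min d e / 2"
      have m: "0 < m" "m < d" "m < e" using d e by (auto simp: m_def min_def)
      have dm: "dist y (y + m *\<^sub>R axis 2 1) = m" using m by (simp add: dist_norm norm_axis_1)
      have "y + m *\<^sub>R axis 2 1 \<in> ball y d" using dm m by simp
      then have "y + m *\<^sub>R axis 2 1 \<in> ball x1 r" using d(2) by blast
      moreover have "0 < (y + m *\<^sub>R axis 2 1) $ 2" using y m by (simp add: half_plane_def axis_def)
      ultimately show "\<exists>y'\<in>?Q. dist y' y < e"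
        using dm m by (intro bexI[of _ "y + m *\<^sub>R axis 2 1"] IntI CollectI) (simp_all add: dist_commute)
    qed
  qed
  have "x1 \<in> ball x1 r \<inter> half_plane" using r x1 by simp
  then show ?thesis using const[OF x] const by metis
qed

text \<open>The set where the pushed forward area ratio takes a given value is closed, and open because the function is
  locally constant in charts; the surface is connected.\<close>

theorem critical_imp_area_ratio_constant:
  assumes RM: "riemannian_surface M" and KM: "compact_space (surf_top M)"
    and RN: "riemannian_surface N" and KN: "compact_space (surf_top N)" and conn: "connected_space (surf_top N)"
    and f: "orientation_preserving_diffeomorphism M N f"
    and crit: "\<And>V \<phi>. admissible_field N V \<Longrightarrow> local_flow N V \<phi> \<Longrightarrow>
      ((\<lambda>t. stretch_energy M N (\<phi> t \<circ> f)) has_real_derivative 0) (at 0)"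
    and p: "p0 \<in> points M" "p \<in> points M"
  shows "area_ratio M N f p = area_ratio M N f p0"
proof -
  note M = riemannian_surface_oriented[OF RM] and N = riemannian_surface_oriented[OF RN]
  note f' = diffeomorphismD[OF f]
  let ?X = "surf_top N"
  define h where "h = inv_into (points M) f"
  define u where "u q = area_ratio M N f (h q)" for q
  have cu: "continuous_map ?X euclidean u"
    using continuous_map_compose[OF smooth_mapD(1)[OF f'(2)] continuous_map_area_ratio[OF RM RN f'(1)]]
    by (simp add: u_def[abs_def] h_def o_def)
  define Z where "Z = {q \<in> points N. u q = u (f p0)}"
  have fp: "f p \<in> points N" "f p0 \<in> points N" using smooth_mapD(2)[OF f'(1)] p by auto
  have "closedin ?X {q \<in> topspace ?X. u q \<in> {u (f p0)}}"
    by (rule closedin_continuous_map_preimage[OF cu]) simp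
  then have "closedin ?X Z" by (simp add: Z_def)
  moreover have "openin ?X Z"
  proof (subst openin_subopen, intro ballI)
    fix q assume q: "q \<in> Z"
    then have qN: "q \<in> points N" by (simp add: Z_def)
    obtain c where c: "c \<in> charts_at N q" using ex_charts_at[OF N qN] by auto
    note ca = charts_atD[OF c]
    note C = oriented_surfaceD(2)[OF N ca(1)]
    obtain r where r: "0 < r" "cball (snd c q) r \<inter> half_plane \<subseteq> chart_image c" by (rule chart_cball[OF C ca(2)])
    obtain G where G: "open G" "G \<subseteq> chart_image c" "\<And>x. x \<in> G \<Longrightarrow> 0 < x $ 2"
      "\<And>x. x \<in> chart_image c \<Longrightarrow> 0 < x $ 2 \<Longrightarrow> x \<in> G" by (rule chart_interior[OF C]) (rule that)
    let ?U = "{q' \<in> fst c. snd c q' \<in> ball (snd c q) r}"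
    have "u q' = u q" if q': "q' \<in> ?U" for q'
    proof -
      have "u (chart_inv c (snd c q')) = u (chart_inv c (snd c q))"
        unfolding u_def h_def
      proof (rule gradient_zero_imp_locally_constant[OF r(2,1) _ smooth_on_pushforward_ratio[OF RM RN f'(1,2,4) ca(1)] G(1,2,4)])
        show "snd c q \<in> half_plane" using is_chartD(5)[OF C] chart_in_image[OF ca(2)] by blast
        show "snd c q' \<in> ball (snd c q) r \<inter> half_plane" using q' is_chartD(5)[OF C] by (auto simp: chart_image_def)
        show "partial 1 (\<lambda>x. area_ratio M N f (inv_into (points M) f (chart_inv c x))) x = 0 \<and>
            partial 2 (\<lambda>x. area_ratio M N f (inv_into (points M) f (chart_inv c x))) x = 0" if "x \<in> G" for x
          by (rule critical_imp_gradient_zero[OF RM KM RN KN f crit ca(1)]) (use that G in auto)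
      qed
      then show ?thesis using q' ca(2) by (simp add: chart_inv_chart[OF C])
    qed
    then have "?U \<subseteq> Z" using q is_chartD(2)[OF C] by (auto simp: Z_def)
    moreover have "openin ?X ?U" by (rule chart_preimage_openin[OF C open_ball])
    ultimately show "\<exists>T. openin ?X T \<and> q \<in> T \<and> T \<subseteq> Z" using ca(2) r(1) by (intro exI[of _ ?U]) auto
  qed
  ultimately have "Z = {} \<or> Z = topspace ?X" using conn unfolding connected_space_clopen_in by blast
  moreover have "f p0 \<in> Z" using fp by (simp add: Z_def)
  ultimately have "f p \<in> Z" using fp by auto
  then show ?thesis using f'(3) p by (simp add: Z_def u_def h_def)
qed

section \<open>The characterization of area-preserving maps\<close>

text \<open>Local flows only see the values of a field at points of the surface. The first variation
  in the direction \<open>V \<circ> f\<close> may be computed with any field that agrees with \<open>V\<close> there, as \<open>f\<close> is surjective.\<close>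

lemma local_flow_cong:
  assumes N: "oriented_surface N" and flow: "local_flow N V \<phi>" and eq: "\<And>q. q \<in> points N \<Longrightarrow> V q = V' q"
  shows "local_flow N V' \<phi>"
proof -
  obtain \<epsilon> where e: "0 < \<epsilon>"
    "continuous_map (prod_topology (top_of_set {-\<epsilon><..<\<epsilon>}) (surf_top N)) (surf_top N) (\<lambda>(t, q). \<phi> t q)"
    "\<And>c d. c \<in> atlas N \<Longrightarrow> d \<in> atlas N \<Longrightarrow>
      smooth_on {(t, x). t \<in> {-\<epsilon><..<\<epsilon>} \<and> x \<in> local_dom c d (\<phi> t)} (\<lambda>(t, x). local_rep c d (\<phi> t) x)"
    "\<And>q. q \<in> points N \<Longrightarrow> \<phi> 0 q = q"
    "\<And>t q d. t \<in> {-\<epsilon><..<\<epsilon>} \<Longrightarrow> q \<in> points N \<Longrightarrow> d \<in> charts_at N (\<phi> t q) \<Longrightarrow>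
      ((\<lambda>s. snd d (\<phi> s q)) has_vector_derivative V (\<phi> t q) d) (at t)"
    by (rule local_flowE[OF N flow]) (rule that)
  show ?thesis
    unfolding local_flow_def
  proof (intro exI[of _ \<epsilon>] conjI ballI e)
    fix t q d assume "t \<in> {-\<epsilon><..<\<epsilon>}" "q \<in> points N" and d: "d \<in> charts_at N (\<phi> t q)"
    from e(5)[OF this] show "((\<lambda>s. snd d (\<phi> s q)) has_vector_derivative V' (\<phi> t q) d) (at t)"
      using eq[OF charts_at_in_points[OF N d]] by simp
  qed
qed

theorem theorem2:
  fixes M :: "'a surface" and N :: "'b surface" and f :: "'a \<Rightarrow> 'b"
  assumes "riemannian_surface M" and "compact_space (surf_top M)" and "connected_space (surf_top M)"
    and "riemannian_surface N" and "compact_space (surf_top N)" and "connected_space (surf_top N)"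
    and "area M = area N"
    and "orientation_preserving_diffeomorphism M N f"
  shows "(\<forall>p\<in>points M. area_ratio M N f p = 1) \<longleftrightarrow>
    (\<forall>V. admissible_field N V \<longrightarrow> has_first_variation M N f (V \<circ> f) 0)"
proof
  note RM = assms(1) and KM = assms(2) and RN = assms(4) and KN = assms(5) and f = assms(8)
  note N = riemannian_surface_oriented[OF RN]
  note f' = diffeomorphismD[OF f]
  {
    assume J: "\<forall>p\<in>points M. area_ratio M N f p = 1"
    show "\<forall>V. admissible_field N V \<longrightarrow> has_first_variation M N f (V \<circ> f) 0"
    proof (intro allI impI)
      fix V assume V: "admissible_field N V"
      then have "smooth_vector_field N V" by (simp add: admissible_field_def)
      note crit = area_preserving_imp_critical[OF RM KM RN KN f J[rule_format] this]
      show "has_first_variation M N f (V \<circ> f) 0"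
        unfolding has_first_variation_def using V crit by (intro exI[of _ V]) auto
    qed
  next
    assume var: "\<forall>V. admissible_field N V \<longrightarrow> has_first_variation M N f (V \<circ> f) 0"
    have crit: "((\<lambda>t. stretch_energy M N (\<phi> t \<circ> f)) has_real_derivative 0) (at 0)"
      if V: "admissible_field N V" and flow: "local_flow N V \<phi>" for V \<phi>
    proof -
      obtain V' where V': "\<forall>p\<in>points M. (V \<circ> f) p = V' (f p)"
        "\<forall>\<phi>. local_flow N V' \<phi> \<longrightarrow> ((\<lambda>t. stretch_energy M N (\<phi> t \<circ> f)) has_real_derivative 0) (at 0)"
        using var V unfolding has_first_variation_def by blast
      have "V q = V' q" if q: "q \<in> points N" for q
        using V'(1) smooth_mapD(2)[OF f'(2) q] f'(4)[OF q] by force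
      from local_flow_cong[OF N flow this] show ?thesis using V'(2) by blast
    qed
    show "\<forall>p\<in>points M. area_ratio M N f p = 1"
    proof
      fix p0 assume p0: "p0 \<in> points M"
      let ?a = "area_ratio M N f p0"
      note const = critical_imp_area_ratio_constant[OF RM KM RN KN assms(6) f crit p0]
      \<comment> \<open>The constant area ratio is the quotient of the total areas.\<close>
      have "(\<integral>p. area_ratio M N f p * 1 \<partial>area_measure M) = (\<integral>q. 1 \<partial>area_measure N)"
        by (rule integral_pullback[OF RM KM RN KN f'(1) smooth_mapD(1)[OF f'(2)] f'(3,4)])
           (auto intro: less_imp_le[OF diffeomorphism_area_ratio_pos[OF RM RN f]])
      also have "\<dots> = (\<integral>p. 1 \<partial>area_measure M)"
        using assms(7) by (simp add: area_def surface_integral_def)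
      also have "(\<integral>p. area_ratio M N f p * 1 \<partial>area_measure M) = (\<integral>p. ?a \<partial>area_measure M)"
        by (rule Bochner_Integration.integral_cong) (use const in \<open>auto simp: space_area_measure[OF RM KM]\<close>)
      finally have "?a * measure (area_measure M) (points M) = measure (area_measure M) (points M)"
        by (simp add: space_area_measure[OF RM KM] mult.commute)
      then show "?a = 1" using area_measure_pos[OF RM KM p0] by simp
    qed
  }
qed

end
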